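(* Let $\mathfrak{F}\subseteq\mathfrak{F}_{\mathrm{all}}$ satisfy $\mathfrak{F}\supseteq\mathfrak{F}_{\mathrm{AR}(2)}^{ext}$ and suppose that the polynomial trend assumption holds: $X=(F,\tilde X)$, where $F$ is $n\times k_F$-dimensional ($1\le k_F\le k$) with $j$-th column $(1^{j-1},\ldots,n^{j-1})'$, where $\tilde X$ is an $n\times(k-k_F)$-dimensional matrix such that $X$ has rank $k$ ($\tilde X$ is the empty matrix if $k_F=k$), and the restriction matrix $R$ has a nonzero column $R_{\cdot i}$ for some $i\in\{1,\ldots,k_F\}$. Let $m',m'',m'''\in\mathbb{N}$, $a_i\in(0,\infty)$ for $i=0,\ldots,m'$, $\bar a_i\in\mathbb{R}$ for $i=1,\ldots,m'$, $h_i\in\mathbb{R}$ for $i=0,\ldots,m''$ with $h_{m''}\ne0$, and $p_i\in\mathbb{R}$ for $i=0,\ldots,m'''$ with $p_{m'''}\ne0$. Furthermore, for the statements that involve $U$, suppose $U$ is an $n\times m$-dimensional matrix with $m\ge1$ such that $(X,U)$ is of full column-rank $k+m<n$. Then $\check\beta=\hat\beta$ and $\check\Omega=\check\Omega_{a,\bar a,h,p}^{\mathrm{BV}}$ satisfy the estimator conditions with $N=N_{\mathrm{BV}}$, and $\check\beta=\hat\beta$ and $\check\Omega=\check\Omega_{U,a,\bar a,h,p}^{\mathrm{BV},J}$ satisfy the estimator conditions with $N=N_{\mathrm{BV},U}$. Let $T$ be the nonsphericity-corrected F-type test statistic with $\check\beta=\hat\beta$, $\check\Omega=\check\Omega_{a,\bar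 a,h,p}^{\mathrm{BV}}$, and $N=N_{\mathrm{BV}}$, or with $\check\beta=\hat\beta$, $\check\Omega=\check\Omega_{U,a,\bar a,h,p}^{\mathrm{BV},J}$, and $N=N_{\mathrm{BV},U}$. Then $$\sup_{f\in\mathfrak{F}}P_{\mu_0,\sigma^2\Sigma(f)}(\{y\in\mathbb{R}^n:T(y)\ge C_{\mathrm{BV}}(y,h)\})=1$$ holds for every $\mu_0\in\mathfrak{M}_0$ and for every $\sigma^2\in(0,\infty)$.
   Context: Model: $n,k,q$ are positive integers with $1\le k<n$; $X\in\mathbb{R}^{n\times k}$ is a fixed matrix of rank $k$; $R\in\mathbb{R}^{q\times k}$ has rank $q\ge 1$; $r\in\mathbb{R}^q$. (One tests $R\beta=r$ in $\mathbf{Y}=X\beta+\mathbf{U}$, $\mathbf{U}\sim N(0,\sigma^2\Sigma(f))$, $0<\sigma^2<\infty$, $f\in\mathfrak{F}$.) $'$ on a matrix, vector or vector-valued function is transpose, $\mathrm{span}(\cdot)$ is column space, $\Pi_{\mathcal{L}}$ is orthogonal projection onto $\mathcal{L}$, $\mathfrak{M}_0=\{X\beta:R\beta=r\}$; for $Z$ of full column rank $\hat\beta_Z(y)=(Z'Z)^{-1}Z'y$; $\hat\beta=\hat\beta_X$, $\hat u(y)=y-X\hat\beta(y)$. $P_{\mu,B}$ is the Gaussian measure on $\mathbb{R}^n$ with mean $\mu$ and covariance $B$. $\lambda_{\mathbb{R}^n}$ is Lebesgue measure. Spectral densities: $\mathfrak{F}_{\mathrm{all}}$ is the set of all normalized spectral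 densities of real weakly stationary processes (nonnegative, even, integrable $f$ on $[-\pi,\pi]$ with $\int_{-\pi}^{\pi}f=1$); $\mathfrak{F}_{\mathrm{AR}(2)}$ is the subset of those corresponding to stationary autoregressive processes of order at most two; $\mathfrak{F}_{\mathrm{AR}(2)}^{ext}$ is the set of all $c_1f+(2\pi)^{-1}c_2$ with $f\in\mathfrak{F}_{\mathrm{AR}(2)}$, $c_1,c_2\ge0$, $c_1+c_2=1$; $\Sigma(f)=\left[\int_{-\pi}^{\pi}e^{-\iota(j-l)\omega}f(\omega)d\omega\right]_{j,l=1}^n$, $\iota$ the imaginary unit. Data-driven quantities: $\hat\rho(y)=\sum_{i=2}^n\hat u_i(y)\hat u_{i-1}(y)/\sum_{i=1}^{n-1}\hat u_i^2(y)$, which under the polynomial trend assumption is well-defined exactly for $y\in\mathbb{R}^n\setminus\mathrm{span}(X)$. For such $y$, $$b_{\mathrm{BV}}(y,a,\bar a)=a_0+\sum_{i=1}^{m'}a_i\mathbf{1}_{[\bar a_i,\infty)}(\hat\rho(y)),$$ $$C_{\mathrm{BV}}(y,h)=\sum_{i=0}^{m''}h_i(b_{\mathrm{BV}}(y,a,\bar a))^i,\qquad c_{\mathrm{BV}}(y,p)=\sum_{i=0}^{m'''}p_i(b_{\mathrm{BV}}(y,a,\bar a))^i,$$ $$\mathcal{W}_{\mathrm{BV}}(y)=\left[\kappa_D(|i-j|/\max(b_{\mathrm{BV}}(y,a,\bar a)n,2))\right]_{i,j=1}^n,$$ with $\kappa_D$ the Daniell kernel, $\kappa_D(x)=\sin(\pi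 x)/(\pi x)$ for $x\ne0$, $\kappa_D(0)=1$. On $\mathrm{span}(X)$, $C_{\mathrm{BV}}(y,h)$ is set equal to an arbitrary fixed real value ($0$, say). Let $\hat\omega_{\mathcal{W}_{\mathrm{BV}}}(y)=n^{-1}\hat u'(y)\mathcal{W}_{\mathrm{BV}}(y)\hat u(y)$ and $$\check\Omega_{U,a,\bar a,h,p}^{\mathrm{BV},J}(y)=\hat\omega_{\mathcal{W}_{\mathrm{BV}}}(y)\exp\left(c_{\mathrm{BV}}(y,p)J_{n,U}^1(y)\right)R(X'X)^{-1}R',$$ $$\check\Omega_{a,\bar a,h,p}^{\mathrm{BV}}(y)=\hat\omega_{\mathcal{W}_{\mathrm{BV}}}(y)\exp\left(c_{\mathrm{BV}}(y,p)n^{-2}\frac{\hat u'(y)A'A\hat u(y)}{\hat u'(y)\hat u(y)}\right)R(X'X)^{-1}R',$$ where $A$ is the $n\times n$ matrix with $0$ above the main diagonal and $1$ on and below it, $G=(0,I_m)\in\mathbb{R}^{m\times(k+m)}$, $s_{I_n,(X,U)}^2(y)=n^{-1}y'\Pi_{\mathrm{span}(X,U)^\perp}y$, and $J_{n,U}^1(y)=n^{-1}\hat\beta_{(X,U)}'(y)G'\left(s_{I_n,(X,U)}^2(y)G((X,U)'(X,U))^{-1}G'\right)^{-1}G\hat\beta_{(X,U)}(y)$. Exceptional sets: if $\hat\rho$ attains at least two different values on $\mathbb{R}^n\setminus\mathrm{span}(X)$, then $N_{\mathrm{BV}}=\mathrm{span}(X)\cup\{y\in\mathbb{R}^n\setminus\mathrm{span}(X):\hat\rho(y)\in\{\bar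 a_1,\ldots,\bar a_{m'}\}\}$ and $N_{\mathrm{BV},U}=\mathrm{span}(X,U)\cup\{y\in\mathbb{R}^n\setminus\mathrm{span}(X,U):\hat\rho(y)\in\{\bar a_1,\ldots,\bar a_{m'}\}\}$; otherwise $N_{\mathrm{BV}}=\mathrm{span}(X)$ and $N_{\mathrm{BV},U}=\mathrm{span}(X,U)$. Estimator conditions on $(\check\beta,\check\Omega,N)$: (i) $\check\beta:\mathbb{R}^n\setminus N\to\mathbb{R}^k$ and $\check\Omega:\mathbb{R}^n\setminus N\to\mathbb{R}^{q\times q}$ are well-defined and continuous on $\mathbb{R}^n\setminus N$, where $N$ is a closed $\lambda_{\mathbb{R}^n}$-null set, and $\check\Omega(y)$ is symmetric for every $y\in\mathbb{R}^n\setminus N$; (ii) $y\in\mathbb{R}^n\setminus N$ implies $\delta y+X\eta\in\mathbb{R}^n\setminus N$ for all $\delta\ne0$, $\eta\in\mathbb{R}^k$; (iii) $\check\beta(\delta y+X\eta)=\delta\check\beta(y)+\eta$ and $\check\Omega(\delta y+X\eta)=\delta^2\check\Omega(y)$ for all $y\in\mathbb{R}^n\setminus N$, $\delta\neq0$, $\eta\in\mathbb{R}^k$; (iv) $\check\Omega$ is $\lambda_{\mathbb{R}^n}$-almost everywhere nonsingular on $\mathbb{R}^n\setminus N$. Nonsphericity-corrected F-type test statistic: with $N^*=N\cup\{y\in\mathbb{R}^n\setminus N:\det\check\Omega(y)=0\}$, $T(y)=(R\check\beta(y)-r)'\check\Omega^{-1}(y)(R\check\beta(y)-r)$ for $y\in\mathbb{R}^n\setminus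 N^*$ and $T(y)=0$ for $y\in N^*$. *)

theory Defs
  imports "HOL-Probability.Probability"
begin

text \<open>
  The dimensions \<open>n, k, q, m\<close> are the cardinalities of index types.  Where the numerical position of
  an index matters (observations and columns of \<open>X\<close>) the index type is a finite linear order, and
  \<open>pos i\<close> is the position \<open>1, 2, \<dots>\<close> of \<open>i\<close> in this order.
\<close>

definition pos :: "'a::{finite,linorder} \<Rightarrow> nat" where
  "pos i = card {..i}"

definition at_pos :: "nat \<Rightarrow> 'a::{finite,linorder}" where
  "at_pos t = (THE i. pos i = t)"

lemma strict_mono_pos: "strict_mono (pos :: 'a::{finite,linorder} \<Rightarrow> nat)"
  unfolding strict_mono_def pos_def by (auto intro!: psubset_card_mono)

lemma bij_betw_pos: "bij_betw pos (UNIV :: 'a::{finite,linorder} set) {1..CARD('a)}"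
proof -
  have inj: "inj (pos :: 'a \<Rightarrow> nat)"
    using strict_mono_pos by (rule strict_mono_imp_inj_on)
  have sub: "range (pos :: 'a \<Rightarrow> nat) \<subseteq> {1..CARD('a)}"
    by (auto simp: pos_def card_mono Suc_le_eq card_gt_0_iff)
  have "range (pos :: 'a \<Rightarrow> nat) = {1..CARD('a)}"
    by (rule card_subset_eq[OF _ sub]) (simp_all add: card_image inj)
  with inj show ?thesis by (simp add: bij_betw_def)
qed

lemma at_pos_pos: "at_pos (pos i) = i"
  unfolding at_pos_def
  using strict_mono_eq[OF strict_mono_pos] by (intro the_equality) auto


section \<open>Linear model\<close>

abbreviation col_space :: "real^'k^'n \<Rightarrow> (real^'n) set" where
  "col_space Z \<equiv> span (columns Z)"

definition hcat :: "real^'k^'n \<Rightarrow> real^'m^'n \<Rightarrow> real^('k + 'm)^'n" where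
  "hcat X U = (\<chi> i j. case j of Inl a \<Rightarrow> X $ i $ a | Inr b \<Rightarrow> U $ i $ b)"

definition OLS :: "real^'k^'n \<Rightarrow> real^'n \<Rightarrow> real^'k" where
  "OLS Z y = (matrix_inv (transpose Z ** Z) ** transpose Z) *v y"

definition OLS_resid :: "real^'k^'n \<Rightarrow> real^'n \<Rightarrow> real^'n" where
  "OLS_resid Z y = y - Z *v OLS Z y"

definition null_means :: "real^'k^'n \<Rightarrow> real^'k^'q \<Rightarrow> real^'q \<Rightarrow> (real^'n) set" where
  "null_means X R r = {X *v \<beta> | \<beta>. R *v \<beta> = r}"

definition orth_proj :: "(real^'n) set \<Rightarrow> real^'n \<Rightarrow> real^'n" where
  "orth_proj L y = (THE p. p \<in> L \<and> y - p \<in> L\<^sup>\<bottom>)"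

text \<open>Here \<open>kF\<close> is the number of leading columns of \<open>X\<close> that form the polynomial trend block.\<close>

definition polynomial_trend ::
    "real^'k::{finite,linorder}^'n::{finite,linorder} \<Rightarrow> real^'k::_^'q \<Rightarrow> nat \<Rightarrow> bool" where
  "polynomial_trend X R kF \<longleftrightarrow>
     1 \<le> kF \<and> kF \<le> CARD('k) \<and>
     (\<forall>i j. pos j \<le> kF \<longrightarrow> X $ i $ j = real (pos i) ^ (pos j - 1)) \<and>
     rank X = CARD('k) \<and>
     (\<exists>j. pos j \<le> kF \<and> column j R \<noteq> 0)"


section \<open>Spectral densities and Gaussian measures\<close>

text \<open>
  Spectral densities are functions on \<open>[-\<pi>, \<pi>]\<close>, i.e. HOL functions that are \<open>extensional\<close> on this
  interval; their values outside the interval carry no information.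
\<close>

definition spectral_all :: "(real \<Rightarrow> real) set" where
  "spectral_all = {f \<in> extensional {-pi..pi}.
     (\<forall>\<omega>\<in>{-pi..pi}. 0 \<le> f \<omega> \<and> f (-\<omega>) = f \<omega>) \<and>
     f absolutely_integrable_on {-pi..pi} \<and> integral {-pi..pi} f = 1}"

text \<open>
  The autoregressive equation \<open>Y\<^sub>t = \<phi>1 Y\<^sub>t\<^sub>-\<^sub>1 + \<phi>2 Y\<^sub>t\<^sub>-\<^sub>2 + \<epsilon>\<^sub>t\<close> with white noise \<open>\<epsilon>\<close> of variance \<open>v > 0\<close>
  has a weakly stationary solution iff \<open>1 - \<phi>1 z - \<phi>2 z\<^sup>2\<close> has no zero on the unit circle; its spectral
  density is \<open>v / (2\<pi>) / |1 - \<phi>1 e\<^sup>-\<^sup>\<iota>\<^sup>\<omega> - \<phi>2 e\<^sup>-\<^sup>2\<^sup>\<iota>\<^sup>\<omega>|\<^sup>2\<close>.  Requiring the zeros to lie outside the closed unit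
  disc gives the same set of densities, since zeros can be reflected at the circle at the price of
  changing \<open>v\<close>.  Orders less than two correspond to \<open>\<phi>2 = 0\<close>.
\<close>

definition spectral_AR2 :: "(real \<Rightarrow> real) set" where
  "spectral_AR2 = {f \<in> spectral_all. \<exists>\<phi>1 \<phi>2 v :: real. v > 0 \<and>
     (\<forall>z::complex. norm z = 1 \<longrightarrow> 1 - of_real \<phi>1 * z - of_real \<phi>2 * z\<^sup>2 \<noteq> 0) \<and>
     (\<forall>\<omega>\<in>{-pi..pi}. f \<omega> =
        v / (2 * pi) / (norm (1 - of_real \<phi>1 * cis (-\<omega>) - of_real \<phi>2 * cis (-(2 * \<omega>))))\<^sup>2)}"

definition spectral_AR2_ext :: "(real \<Rightarrow> real) set" where
  "spectral_AR2_ext = {restrict (\<lambda>\<omega>. c1 * f \<omega> + c2 / (2 * pi)) {-pi..pi} | c1 c2 f.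
     f \<in> spectral_AR2 \<and> c1 \<ge> 0 \<and> c2 \<ge> 0 \<and> c1 + c2 = 1}"

text \<open>The complex integral below is real because \<open>f\<close> is even.\<close>

definition spectral_cov :: "(real \<Rightarrow> real) \<Rightarrow> real^'n::{finite,linorder}^'n::_" where
  "spectral_cov f = (\<chi> j l. Re (integral {-pi..pi}
     (\<lambda>\<omega>. exp (- (\<i> * of_real ((real (pos j) - real (pos l)) * \<omega>))) * complex_of_real (f \<omega>))))"

definition std_gauss :: "(real^'n) measure" where
  "std_gauss = density lborel (\<lambda>z. ennreal (\<Prod>i\<in>UNIV. std_normal_density (z $ i)))"

text \<open>
  The Gaussian measure with mean \<open>\<mu>\<close> and (positive semidefinite, possibly singular) covariance matrix
  \<open>B\<close>, as the law of \<open>\<mu> + S z\<close> for standard Gaussian \<open>z\<close> and \<open>S S' = B\<close>; this law does not depend on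
  which \<open>S\<close> is chosen.
\<close>

definition gauss_measure :: "real^'n \<Rightarrow> real^'n^'n \<Rightarrow> (real^'n) measure" where
  "gauss_measure \<mu> B =
     distr std_gauss borel (\<lambda>z. \<mu> + (SOME S :: real^'n^'n. S ** transpose S = B) *v z)"


section \<open>Estimator conditions and test statistic\<close>

text \<open>
  HOL functions are total, so the requirement that the estimators be well-defined off \<open>N\<close> is expressed
  through the set \<open>D\<close> of those \<open>y\<close> at which every quotient and every matrix inverse in the defining
  formulas of \<open>\<beta>c\<close> and \<open>\<Omega>c\<close> is meaningful.
\<close>

definition estimator_conditions ::
    "real^'k^'n \<Rightarrow> (real^'n) set \<Rightarrow> (real^'n \<Rightarrow> real^'k) \<Rightarrow> (real^'n \<Rightarrow> real^'q^'q) \<Rightarrow>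
     (real^'n) set \<Rightarrow> bool" where
  "estimator_conditions X D \<beta>c \<Omega>c N \<longleftrightarrow>
     (- N \<subseteq> D \<and> continuous_on (- N) \<beta>c \<and> continuous_on (- N) \<Omega>c \<and>
      closed N \<and> N \<in> null_sets lborel \<and> (\<forall>y. y \<notin> N \<longrightarrow> transpose (\<Omega>c y) = \<Omega>c y)) \<and>
     (\<forall>y \<delta> \<eta>. y \<notin> N \<and> \<delta> \<noteq> 0 \<longrightarrow> \<delta> *\<^sub>R y + X *v \<eta> \<notin> N) \<and>
     (\<forall>y \<delta> \<eta>. y \<notin> N \<and> \<delta> \<noteq> 0 \<longrightarrow>
        \<beta>c (\<delta> *\<^sub>R y + X *v \<eta>) = \<delta> *\<^sub>R \<beta>c y + \<eta> \<and>
        \<Omega>c (\<delta> *\<^sub>R y + X *v \<eta>) = \<delta>\<^sup>2 *\<^sub>R \<Omega>c y) \<and>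
     (AE y in lborel. y \<notin> N \<longrightarrow> det (\<Omega>c y) \<noteq> 0)"

definition F_type_stat ::
    "real^'k^'q \<Rightarrow> real^'q \<Rightarrow> (real^'n \<Rightarrow> real^'k) \<Rightarrow> (real^'n \<Rightarrow> real^'q^'q) \<Rightarrow> (real^'n) set \<Rightarrow>
     real^'n \<Rightarrow> real" where
  "F_type_stat R r \<beta>c \<Omega>c N y =
     (if y \<in> N \<union> {y. y \<notin> N \<and> det (\<Omega>c y) = 0} then 0
      else (R *v \<beta>c y - r) \<bullet> (matrix_inv (\<Omega>c y) *v (R *v \<beta>c y - r)))"


section \<open>Data-driven bandwidth, critical value and covariance estimators\<close>

definition rho_num :: "real^'k^'n::{finite,linorder} \<Rightarrow> real^'n::_ \<Rightarrow> real" where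
  "rho_num X y =
     (\<Sum>t = 2..CARD('n). OLS_resid X y $ at_pos t * OLS_resid X y $ at_pos (t - 1))"

definition rho_denom :: "real^'k^'n::{finite,linorder} \<Rightarrow> real^'n::_ \<Rightarrow> real" where
  "rho_denom X y = (\<Sum>t = 1..CARD('n) - 1. (OLS_resid X y $ at_pos t)\<^sup>2)"

definition rho_hat :: "real^'k^'n::{finite,linorder} \<Rightarrow> real^'n::_ \<Rightarrow> real" where
  "rho_hat X y = rho_num X y / rho_denom X y"

definition b_BV ::
    "real^'k^'n::{finite,linorder} \<Rightarrow> nat \<Rightarrow> (nat \<Rightarrow> real) \<Rightarrow> (nat \<Rightarrow> real) \<Rightarrow> real^'n::_ \<Rightarrow> real" where
  "b_BV X m1 a abar y = a 0 + (\<Sum>i = 1..m1. a i * indicat_real {abar i..} (rho_hat X y))"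

text \<open>\<open>C0\<close> is the arbitrary value given to the critical value on \<open>span(X)\<close>.\<close>

definition C_BV ::
    "real^'k^'n::{finite,linorder} \<Rightarrow> nat \<Rightarrow> (nat \<Rightarrow> real) \<Rightarrow> (nat \<Rightarrow> real) \<Rightarrow>
     nat \<Rightarrow> (nat \<Rightarrow> real) \<Rightarrow> real \<Rightarrow> real^'n::_ \<Rightarrow> real" where
  "C_BV X m1 a abar m2 h C0 y =
     (if y \<in> col_space X then C0 else (\<Sum>i = 0..m2. h i * b_BV X m1 a abar y ^ i))"

definition c_BV ::
    "real^'k^'n::{finite,linorder} \<Rightarrow> nat \<Rightarrow> (nat \<Rightarrow> real) \<Rightarrow> (nat \<Rightarrow> real) \<Rightarrow>
     nat \<Rightarrow> (nat \<Rightarrow> real) \<Rightarrow> real^'n::_ \<Rightarrow> real" where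
  "c_BV X m1 a abar m3 p y = (\<Sum>i = 0..m3. p i * b_BV X m1 a abar y ^ i)"

definition daniell :: "real \<Rightarrow> real" where
  "daniell x = (if x = 0 then 1 else sin (pi * x) / (pi * x))"

definition W_BV ::
    "real^'k^'n::{finite,linorder} \<Rightarrow> nat \<Rightarrow> (nat \<Rightarrow> real) \<Rightarrow> (nat \<Rightarrow> real) \<Rightarrow> real^'n::_ \<Rightarrow>
     real^'n::_^'n::_" where
  "W_BV X m1 a abar y = (\<chi> i j.
     daniell (\<bar>real (pos i) - real (pos j)\<bar> / max (b_BV X m1 a abar y * real CARD('n)) 2))"

definition omega_BV ::
    "real^'k^'n::{finite,linorder} \<Rightarrow> nat \<Rightarrow> (nat \<Rightarrow> real) \<Rightarrow> (nat \<Rightarrow> real) \<Rightarrow> real^'n::_ \<Rightarrow> real" where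
  "omega_BV X m1 a abar y =
     (OLS_resid X y \<bullet> (W_BV X m1 a abar y *v OLS_resid X y)) / real CARD('n)"

definition selector :: "real^('k::finite + 'm::finite)^'m::_" where
  "selector = hcat (0 :: real^'k^'m) (mat 1)"

definition s2_stat :: "real^'k^'n \<Rightarrow> real^'m^'n \<Rightarrow> real^'n \<Rightarrow> real" where
  "s2_stat X U y = (y \<bullet> orth_proj ((col_space (hcat X U))\<^sup>\<bottom>) y) / real CARD('n)"

definition J_mat :: "real^'k^'n \<Rightarrow> real^'m^'n \<Rightarrow> real^'n \<Rightarrow> real^'m^'m" where
  "J_mat X U y = s2_stat X U y *\<^sub>R
     ((selector :: real^('k + 'm)^'m) ** matrix_inv (transpose (hcat X U) ** hcat X U) **
      transpose selector)"

definition J_stat :: "real^'k^'n \<Rightarrow> real^'m^'n \<Rightarrow> real^'n \<Rightarrow> real" where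
  "J_stat X U y =
     (let g = (selector :: real^('k + 'm)^'m) *v OLS (hcat X U) y
      in (g \<bullet> (matrix_inv (J_mat X U y) *v g)) / real CARD('n))"

definition cumsum_mat :: "real^'n::{finite,linorder}^'n::_" where
  "cumsum_mat = (\<chi> i j. if j \<le> i then 1 else 0)"

definition cumsum_ratio :: "real^'k^'n::{finite,linorder} \<Rightarrow> real^'n::_ \<Rightarrow> real" where
  "cumsum_ratio X y =
     (OLS_resid X y \<bullet> ((transpose cumsum_mat ** cumsum_mat) *v OLS_resid X y)) /
     (OLS_resid X y \<bullet> OLS_resid X y)"

definition Omega_BV ::
    "real^'k^'n::{finite,linorder} \<Rightarrow> real^'k^'q \<Rightarrow> nat \<Rightarrow> (nat \<Rightarrow> real) \<Rightarrow> (nat \<Rightarrow> real) \<Rightarrow>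
     nat \<Rightarrow> (nat \<Rightarrow> real) \<Rightarrow> real^'n::_ \<Rightarrow> real^'q^'q" where
  "Omega_BV X R m1 a abar m3 p y =
     (omega_BV X m1 a abar y *
      exp (c_BV X m1 a abar m3 p y * (cumsum_ratio X y / (real CARD('n))\<^sup>2))) *\<^sub>R
     (R ** matrix_inv (transpose X ** X) ** transpose R)"

definition Omega_BV_J ::
    "real^'k^'n::{finite,linorder} \<Rightarrow> real^'m^'n::_ \<Rightarrow> real^'k^'q \<Rightarrow> nat \<Rightarrow> (nat \<Rightarrow> real) \<Rightarrow>
     (nat \<Rightarrow> real) \<Rightarrow> nat \<Rightarrow> (nat \<Rightarrow> real) \<Rightarrow> real^'n::_ \<Rightarrow> real^'q^'q" where
  "Omega_BV_J X U R m1 a abar m3 p y =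
     (omega_BV X m1 a abar y * exp (c_BV X m1 a abar m3 p y * J_stat X U y)) *\<^sub>R
     (R ** matrix_inv (transpose X ** X) ** transpose R)"

text \<open>
  The sets on which the formulas for the OLS estimator and \<open>Omega_BV\<close>, respectively \<open>Omega_BV_J\<close>, are
  meaningful.
\<close>

definition dom_BV :: "real^'k^'n::{finite,linorder} \<Rightarrow> (real^'n::_) set" where
  "dom_BV X = {y. invertible (transpose X ** X) \<and> rho_denom X y \<noteq> 0 \<and>
     OLS_resid X y \<bullet> OLS_resid X y \<noteq> 0}"

definition dom_BV_J :: "real^'k^'n::{finite,linorder} \<Rightarrow> real^'m^'n::_ \<Rightarrow> (real^'n::_) set" where
  "dom_BV_J X U = {y. invertible (transpose X ** X) \<and> rho_denom X y \<noteq> 0 \<and>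
     invertible (transpose (hcat X U) ** hcat X U) \<and> invertible (J_mat X U y)}"

definition rho_nonconst :: "real^'k^'n::{finite,linorder} \<Rightarrow> bool" where
  "rho_nonconst X \<longleftrightarrow> (\<exists>y z. y \<notin> col_space X \<and> z \<notin> col_space X \<and> rho_hat X y \<noteq> rho_hat X z)"

definition N_BV :: "real^'k^'n::{finite,linorder} \<Rightarrow> nat \<Rightarrow> (nat \<Rightarrow> real) \<Rightarrow> (real^'n::_) set" where
  "N_BV X m1 abar =
     (if rho_nonconst X
      then col_space X \<union> {y. y \<notin> col_space X \<and> rho_hat X y \<in> abar ` {1..m1}}
      else col_space X)"

definition N_BV_U ::
    "real^'k^'n::{finite,linorder} \<Rightarrow> real^'m^'n::_ \<Rightarrow> nat \<Rightarrow> (nat \<Rightarrow> real) \<Rightarrow> (real^'n::_) set" where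
  "N_BV_U X U m1 abar =
     (if rho_nonconst X
      then col_space (hcat X U) \<union> {y. y \<notin> col_space (hcat X U) \<and> rho_hat X y \<in> abar ` {1..m1}}
      else col_space (hcat X U))"

end

(*
  Take spectral densities c1 f + c2 / (2 pi) with f of order AR(2) and its mass concentrated near the
  frequencies +-gamma, and let gamma -> 0 with c2 = gamma^(2 kF).  The covariance is then close to
  [cos ((j - l) gamma)] plus noise of variance gamma^(2 kF).  Expanding exp (i gamma j) in powers of
  gamma shows that directions orthogonal to the polynomial trend have standard deviation of
  order at most gamma^kF, while R beta_hat - r has a component of order gamma^l0, where l0 < kF is the
  smallest degree whose coefficient is restricted by R.  With probability close to one the estimators
  of the long run variance are therefore at most of order gamma^(2 kF), so T is at least of order
  gamma^(2 l0 - 2 kF), which exceeds the bounded critical value.  The noise bounds the residuals of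
  (X, U) from below, and this keeps the correction factor exp (c J) bounded.
*)

theory Submission
  imports Defs "HOL-Computational_Algebra.Polynomial"
begin

section \<open>Autoregressive spectral densities concentrated at a frequency\<close>

text \<open>The matrix with entries \<open>cos ((j - l) * \<gamma>)\<close> has rank at most two, so
  a Gaussian law with that covariance lives on a plane through its mean, where neither the null set
  \<open>N\<close> nor the correction factor is under control. Hence the argument uses positive
  definite covariances and bounds uniform in them. The Gaussian input has constants \<open>K\<close>
  and \<open>d\<close> that depend only on the tolerated probability: all linear functionals of the
  centred data are at most \<open>K\<close> standard deviations, and two chosen ones are at least
  \<open>d\<close> standard deviations. This permits the order of choices \<open>K\<close> and
  \<open>d\<close>, then a lower bound \<open>\<kappa>\<close> for |v . y| relative to the residual
  norm, then a growth constant \<open>G\<close> of the estimator, and only then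
  \<open>\<gamma>\<close>. The exponent 2 kF of the noise weight is what makes
  \<open>\<kappa>\<close> independent of \<open>\<gamma>\<close>: residuals keep order at most
  \<open>\<gamma> ^ kF\<close>, while \<open>v\<close> orthogonal to the regressors has at least
  that order. For fixed \<open>\<gamma>\<close>, the zeros of the autoregressive polynomial are
  moved so close to the unit circle that the autocorrelations differ from the cosines by no more
  than the noise weight.\<close>

text \<open>For 0 < \<rho> < 1 the zeros of the polynomial are exp (+- i \<gamma>) / \<rho>, so for
  \<rho> near 1 the reciprocal peaks at the frequencies +-\<gamma>. The sign in
  \<open>-(\<rho>\<^sup>2)\<close> follows the shape used in \<open>spectral_AR2\<close>.\<close>

definition ar_poly_sq :: "real \<Rightarrow> real \<Rightarrow> real \<Rightarrow> real" where
  "ar_poly_sq \<rho> \<gamma> \<omega> =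
     (norm (1 - of_real (2 * \<rho> * cos \<gamma>) * cis (-\<omega>) - of_real (-(\<rho>\<^sup>2)) * cis (-(2 * \<omega>))))\<^sup>2"

lemma ar_poly_factor:
  fixes z :: complex
  shows "1 - of_real (2 * \<rho> * cos \<gamma>) * z - of_real (-(\<rho>\<^sup>2)) * z\<^sup>2 =
    (1 - of_real \<rho> * cis \<gamma> * z) * (1 - of_real \<rho> * cis (-\<gamma>) * z)"
proof -
  have 1: "cis \<gamma> + cis (-\<gamma>) = of_real (2 * cos \<gamma>)"
    by (simp add: complex_eq_iff)
  have 2: "cis \<gamma> * cis (-\<gamma>) = 1"
    by (simp add: cis_mult)
  have "(1 - of_real \<rho> * cis \<gamma> * z) * (1 - of_real \<rho> * cis (-\<gamma>) * z)
    = 1 - of_real \<rho> * (cis \<gamma> + cis (-\<gamma>)) * z + (of_real \<rho>)\<^sup>2 * (cis \<gamma> * cis (-\<gamma>)) * z\<^sup>2"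
    by (simp add: algebra_simps power2_eq_square)
  then show ?thesis unfolding 1 2 by (simp add: algebra_simps)
qed

lemma one_minus_cis_mult_nz:
  fixes z :: complex
  assumes "0 \<le> \<rho>" "\<rho> < 1" "norm z = 1"
  shows "1 - of_real \<rho> * cis \<gamma> * z \<noteq> 0"
proof
  assume "1 - of_real \<rho> * cis \<gamma> * z = 0"
  then have "norm (of_real \<rho> * cis \<gamma> * z) = 1" by (metis eq_iff_diff_eq_0 norm_one)
  with assms show False by (simp add: norm_mult)
qed

lemma cis_double_neg: "cis (-(2 * \<omega>)) = (cis (-\<omega>))\<^sup>2"
  by (simp add: power2_eq_square cis_mult)

lemma ar_poly_sq_eq:
  "ar_poly_sq \<rho> \<gamma> \<omega> =
    (norm (1 - of_real \<rho> * cis (\<gamma> - \<omega>)))\<^sup>2 * (norm (1 - of_real \<rho> * cis (-\<gamma> - \<omega>)))\<^sup>2"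
proof -
  have "cis \<gamma> * cis (-\<omega>) = cis (\<gamma> - \<omega>)" "cis (-\<gamma>) * cis (-\<omega>) = cis (-\<gamma> - \<omega>)"
    by (simp_all add: cis_mult)
  then show ?thesis
    unfolding ar_poly_sq_def cis_double_neg ar_poly_factor
    by (simp add: norm_mult power_mult_distrib mult.assoc)
qed

lemma ar_poly_sq_pos:
  assumes "0 \<le> \<rho>" "\<rho> < 1" shows "0 < ar_poly_sq \<rho> \<gamma> \<omega>"
  unfolding ar_poly_sq_def cis_double_neg ar_poly_factor
  using one_minus_cis_mult_nz[OF assms] by simp

lemma continuous_ar_poly_sq: "continuous_on S (ar_poly_sq \<rho> \<gamma>)"
  unfolding ar_poly_sq_def cis.ctr by (intro continuous_intros)

lemma ar_poly_sq_even: "ar_poly_sq \<rho> \<gamma> (-\<omega>) = ar_poly_sq \<rho> \<gamma> \<omega>"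
proof -
  have "norm (1 - of_real \<rho> * cis (\<gamma> + \<omega>)) = norm (1 - of_real \<rho> * cis (-\<gamma> - \<omega>))"
    using complex_mod_cnj[of "1 - of_real \<rho> * cis (\<gamma> + \<omega>)"] by (simp add: cis_cnj)
  moreover have "norm (1 - of_real \<rho> * cis (\<omega> - \<gamma>)) = norm (1 - of_real \<rho> * cis (\<gamma> - \<omega>))"
    using complex_mod_cnj[of "1 - of_real \<rho> * cis (\<gamma> - \<omega>)"] by (simp add: cis_cnj)
  ultimately show ?thesis unfolding ar_poly_sq_eq by simp
qed

text \<open>Multiplying the polynomial by the unimodular \<open>cis (h * \<omega>)\<close> keeps its
  modulus, and the left side is the squared real part of the product.\<close>

lemma ar_recursion_sq_le:
  "(cos (h * \<omega>) - 2 * \<rho> * cos \<gamma> * cos ((h - 1) * \<omega>) + \<rho>\<^sup>2 * cos ((h - 2) * \<omega>))\<^sup>2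
    \<le> ar_poly_sq \<rho> \<gamma> \<omega>"
proof -
  let ?P = "1 - of_real (2 * \<rho> * cos \<gamma>) * cis (-\<omega>) - of_real (-(\<rho>\<^sup>2)) * cis (-(2 * \<omega>))"
  have "cis (h * \<omega>) * ?P = cis (h * \<omega>) - of_real (2 * \<rho> * cos \<gamma>) * (cis (h * \<omega>) * cis (-\<omega>))
      - of_real (-(\<rho>\<^sup>2)) * (cis (h * \<omega>) * cis (-(2 * \<omega>)))"
    by (simp add: algebra_simps)
  also have "\<dots> = cis (h * \<omega>) - of_real (2 * \<rho> * cos \<gamma>) * cis ((h - 1) * \<omega>)
      + of_real (\<rho>\<^sup>2) * cis ((h - 2) * \<omega>)"
    by (simp add: cis_mult algebra_simps)
  finally have "Re (cis (h * \<omega>) * ?P) =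
      cos (h * \<omega>) - 2 * \<rho> * cos \<gamma> * cos ((h - 1) * \<omega>) + \<rho>\<^sup>2 * cos ((h - 2) * \<omega>)"
    by simp
  moreover have "\<bar>Re (cis (h * \<omega>) * ?P)\<bar> \<le> norm ?P"
    using abs_Re_le_cmod[of "cis (h * \<omega>) * ?P"] by (simp add: norm_mult)
  ultimately show ?thesis
    unfolding ar_poly_sq_def by (metis abs_le_square_iff abs_norm_cancel)
qed

text \<open>The factor belonging to the opposite peak is at most 2. The near factor is at most the
  distance 1 - \<rho> of the root from the circle plus the distance of the frequencies, hence at
  most 2 (1 - \<rho>).\<close>

lemma ar_poly_sq_le:
  assumes "0 \<le> \<rho>" "\<rho> < 1" "\<bar>\<omega> - \<gamma>\<bar> \<le> 1 - \<rho>"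
  shows "ar_poly_sq \<rho> \<gamma> \<omega> \<le> 16 * (1 - \<rho>)\<^sup>2"
proof -
  have a: "norm (1 - of_real \<rho> * cis (-\<gamma> - \<omega>)) \<le> 2"
    using norm_triangle_ineq4[of 1 "of_real \<rho> * cis (-\<gamma> - \<omega>)"] assms by (simp add: norm_mult)
  have c: "norm (1 - cis x) \<le> \<bar>x\<bar>" for x
  proof -
    have "(norm (1 - cis x))\<^sup>2 = (1 - cos x)\<^sup>2 + (sin x)\<^sup>2"
      by (simp add: cmod_power2)
    also have "\<dots> = 2 - 2 * cos x"
      using sin_cos_squared_add[of x] by (simp add: power2_eq_square algebra_simps)
    also have "\<dots> = (2 * sin (x / 2))\<^sup>2"
      using cos_double_sin[of "x/2"] by (simp add: power2_eq_square)
    also have "\<dots> \<le> x\<^sup>2"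
      using abs_sin_x_le_abs_x[of "x / 2"] by (subst abs_le_square_iff[symmetric]) (simp add: abs_mult)
    finally show ?thesis by (simp add: abs_le_square_iff[symmetric])
  qed
  have "1 - of_real \<rho> * cis (\<gamma> - \<omega>) = of_real (1 - \<rho>) + of_real \<rho> * (1 - cis (\<gamma> - \<omega>))"
    by (simp add: algebra_simps)
  then have "norm (1 - of_real \<rho> * cis (\<gamma> - \<omega>)) \<le> (1 - \<rho>) + \<rho> * norm (1 - cis (\<gamma> - \<omega>))"
    using norm_triangle_ineq[of "of_real (1 - \<rho>)" "of_real \<rho> * (1 - cis (\<gamma> - \<omega>))"] assms
    by (simp add: norm_mult del: of_real_diff)
  also have "\<dots> \<le> (1 - \<rho>) + 1 * \<bar>\<gamma> - \<omega>\<bar>"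
    by (intro add_left_mono mult_mono c) (use assms in auto)
  also have "\<dots> \<le> 2 * (1 - \<rho>)" using assms by simp
  finally have b: "norm (1 - of_real \<rho> * cis (\<gamma> - \<omega>)) \<le> 2 * (1 - \<rho>)" .
  have "ar_poly_sq \<rho> \<gamma> \<omega> \<le> (2 * (1 - \<rho>))\<^sup>2 * 2\<^sup>2"
    unfolding ar_poly_sq_eq by (intro mult_mono power_mono a b) auto
  then show ?thesis by (simp add: power2_eq_square algebra_simps)
qed

definition ar_mass :: "real \<Rightarrow> real \<Rightarrow> real" where
  "ar_mass \<rho> \<gamma> = integral {-pi..pi} (\<lambda>\<omega>. 1 / ar_poly_sq \<rho> \<gamma> \<omega>)"

definition ar_density :: "real \<Rightarrow> real \<Rightarrow> real \<Rightarrow> real" where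
  "ar_density \<rho> \<gamma> \<omega> = 1 / (ar_mass \<rho> \<gamma> * ar_poly_sq \<rho> \<gamma> \<omega>)"

lemma continuous_inv_ar_poly_sq:
  assumes "0 \<le> \<rho>" "\<rho> < 1"
  shows "continuous_on S (\<lambda>\<omega>. 1 / ar_poly_sq \<rho> \<gamma> \<omega>)"
  by (intro continuous_intros continuous_ar_poly_sq) (use ar_poly_sq_pos[OF assms] in \<open>auto simp: less_le\<close>)

text \<open>On a window of length 2 (1 - \<rho>) around \<gamma> the integrand is at least 1 / (16
  (1 - \<rho>)^2). The last two hypotheses keep this window inside the interval of integration. The
  mass therefore blows up as \<rho> tends to 1.\<close>

lemma ar_mass_lower:
  assumes "0 \<le> \<rho>" "\<rho> < 1" "0 < \<gamma>" "\<gamma> < pi" "1 - \<rho> \<le> \<gamma>" "1 - \<rho> \<le> pi - \<gamma>"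
  shows "1 / (8 * (1 - \<rho>)) \<le> ar_mass \<rho> \<gamma>"
proof -
  let ?I = "{\<gamma> - (1 - \<rho>)..\<gamma> + (1 - \<rho>)}"
  have sub: "?I \<subseteq> {-pi..pi}" using assms by auto
  have "1 / (8 * (1 - \<rho>)) = integral ?I (\<lambda>_. 1 / (16 * (1 - \<rho>)\<^sup>2))"
    using assms by (simp add: power2_eq_square divide_simps) (simp add: algebra_simps)
  also have "\<dots> \<le> integral ?I (\<lambda>\<omega>. 1 / ar_poly_sq \<rho> \<gamma> \<omega>)"
  proof (rule integral_le)
    show "(\<lambda>\<omega>. 1 / ar_poly_sq \<rho> \<gamma> \<omega>) integrable_on ?I"
      by (rule integrable_continuous_real[OF continuous_inv_ar_poly_sq]) (use assms in auto)
    fix \<omega> assume "\<omega> \<in> ?I"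
    then have "\<bar>\<omega> - \<gamma>\<bar> \<le> 1 - \<rho>" by auto
    from ar_poly_sq_le[OF _ _ this] ar_poly_sq_pos assms
    show "1 / (16 * (1 - \<rho>)\<^sup>2) \<le> 1 / ar_poly_sq \<rho> \<gamma> \<omega>"
      by (intro divide_left_mono) auto
  qed auto
  also have "\<dots> \<le> ar_mass \<rho> \<gamma>"
    unfolding ar_mass_def
    by (intro integral_subset_le sub integrable_continuous_real[OF continuous_inv_ar_poly_sq])
       (use assms ar_poly_sq_pos[of \<rho>] in \<open>auto simp: less_imp_le\<close>)
  finally show ?thesis .
qed

lemma continuous_ar_density:
  assumes "0 \<le> \<rho>" "\<rho> < 1"
  shows "continuous_on S (ar_density \<rho> \<gamma>)"
proof -
  have "ar_density \<rho> \<gamma> = (\<lambda>\<omega>. (1 / ar_mass \<rho> \<gamma>) * (1 / ar_poly_sq \<rho> \<gamma> \<omega>))"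
    by (auto simp: ar_density_def)
  then show ?thesis
    by (metis continuous_inv_ar_poly_sq[OF assms] continuous_on_mult_left)
qed

lemma integral_ar_density:
  assumes "0 < ar_mass \<rho> \<gamma>"
  shows "integral {-pi..pi} (ar_density \<rho> \<gamma>) = 1"
proof -
  have "ar_density \<rho> \<gamma> = (\<lambda>\<omega>. (1 / ar_mass \<rho> \<gamma>) * (1 / ar_poly_sq \<rho> \<gamma> \<omega>))"
    by (auto simp: ar_density_def)
  then have "integral {-pi..pi} (ar_density \<rho> \<gamma>) = (1 / ar_mass \<rho> \<gamma>) * ar_mass \<rho> \<gamma>"
    unfolding ar_mass_def by (metis integral_mult_right)
  with assms show ?thesis by simp
qed

lemma ar_density_in_spectral_AR2:
  assumes "0 \<le> \<rho>" "\<rho> < 1" "0 < ar_mass \<rho> \<gamma>"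
  shows "restrict (ar_density \<rho> \<gamma>) {-pi..pi} \<in> spectral_AR2"
proof -
  let ?f = "restrict (ar_density \<rho> \<gamma>) {-pi..pi}"
  have int: "integral {-pi..pi} ?f = integral {-pi..pi} (ar_density \<rho> \<gamma>)"
    by (rule integral_cong) auto
  have abs: "?f absolutely_integrable_on {-pi..pi}"
    by (intro absolutely_integrable_continuous_real continuous_on_eq[OF continuous_ar_density[OF assms(1,2)]]) auto
  have all: "?f \<in> spectral_all"
    unfolding spectral_all_def using int abs integral_ar_density[OF assms(3)] assms ar_poly_sq_pos[OF assms(1,2)]
    by (auto simp: ar_density_def ar_poly_sq_even less_imp_le)
  have nz: "\<forall>z::complex. norm z = 1 \<longrightarrow>
      1 - of_real (2 * \<rho> * cos \<gamma>) * z - of_real (-(\<rho>\<^sup>2)) * z\<^sup>2 \<noteq> 0"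
    unfolding ar_poly_factor using one_minus_cis_mult_nz[OF assms(1,2)] by auto
  \<comment> \<open>The innovation variance \<open>2 * pi / ar_mass \<rho> \<gamma>\<close> is the
    one that normalizes the density.\<close>
  have form: "\<forall>\<omega>\<in>{-pi..pi}. ?f \<omega> = (2 * pi / ar_mass \<rho> \<gamma>) / (2 * pi) /
      (norm (1 - of_real (2 * \<rho> * cos \<gamma>) * cis (-\<omega>) - of_real (-(\<rho>\<^sup>2)) * cis (-(2 * \<omega>))))\<^sup>2"
    unfolding ar_poly_sq_def[symmetric] by (auto simp: ar_density_def)
  have v: "0 < 2 * pi / ar_mass \<rho> \<gamma>" using assms by simp
  show ?thesis unfolding spectral_AR2_def using all nz form v by blast
qed

text \<open>Since the density is even, this is the autocorrelation at lag \<open>h\<close>. A real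
  lag lets the recursion reach back to lag -1.\<close>

definition ar_corr :: "real \<Rightarrow> real \<Rightarrow> real \<Rightarrow> real" where
  "ar_corr \<rho> \<gamma> h = integral {-pi..pi} (\<lambda>\<omega>. cos (h * \<omega>) * ar_density \<rho> \<gamma> \<omega>)"

text \<open>
  The squared modulus of the autoregressive polynomial has mean \<open>2 * pi / ar_mass \<rho> \<gamma>\<close> under its own
  normalized spectral density.  As \<open>\<rho> \<rightarrow> 1\<close> this tends to zero, and the autocorrelations satisfy in the
  limit the recursion of \<open>cos (h * \<gamma>)\<close>.
\<close>

lemma ar_corr_recursion:
  assumes "0 \<le> \<rho>" "\<rho> < 1" "0 < ar_mass \<rho> \<gamma>"
  shows "\<bar>ar_corr \<rho> \<gamma> h - 2 * \<rho> * cos \<gamma> * ar_corr \<rho> \<gamma> (h - 1) + \<rho>\<^sup>2 * ar_corr \<rho> \<gamma> (h - 2)\<bar>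
    \<le> sqrt (2 * pi / ar_mass \<rho> \<gamma>)"
proof -
  define D where "D \<omega> = cos (h * \<omega>) - 2 * \<rho> * cos \<gamma> * cos ((h - 1) * \<omega>) + \<rho>\<^sup>2 * cos ((h - 2) * \<omega>)" for \<omega>
  \<comment> \<open>\<open>s\<^sup>2\<close> is the mean of the squared modulus under its own
    density. With this weight the two terms of 2 s |D| <= s^2 + D^2 contribute s / 2 each after
    integration.\<close>
  define s where "s = sqrt (2 * pi / ar_mass \<rho> \<gamma>)"
  have s: "s > 0" "s\<^sup>2 = 2 * pi / ar_mass \<rho> \<gamma>" using assms by (auto simp: s_def)
  note cd = continuous_ar_density[OF assms(1,2)]
  have ic: "(\<lambda>\<omega>. cos (x * \<omega>) * ar_density \<rho> \<gamma> \<omega>) integrable_on {-pi..pi}" for x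
    by (intro integrable_continuous_real continuous_intros cd)
  have icc: "(\<lambda>\<omega>. c * (cos (x * \<omega>) * ar_density \<rho> \<gamma> \<omega>)) integrable_on {-pi..pi}" for x c
    using integrable_on_cmult_left[OF ic[of x], of c] by simp
  have "ar_corr \<rho> \<gamma> h - 2 * \<rho> * cos \<gamma> * ar_corr \<rho> \<gamma> (h - 1) + \<rho>\<^sup>2 * ar_corr \<rho> \<gamma> (h - 2)
     = integral {-pi..pi} (\<lambda>\<omega>. cos (h * \<omega>) * ar_density \<rho> \<gamma> \<omega>
        - (2 * \<rho> * cos \<gamma>) * (cos ((h - 1) * \<omega>) * ar_density \<rho> \<gamma> \<omega>)
        + \<rho>\<^sup>2 * (cos ((h - 2) * \<omega>) * ar_density \<rho> \<gamma> \<omega>))"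
    unfolding ar_corr_def
    by (subst integral_add integral_diff; (intro integrable_diff ic icc)?)+ simp
  also have "\<dots> = integral {-pi..pi} (\<lambda>\<omega>. D \<omega> * ar_density \<rho> \<gamma> \<omega>)"
    by (simp add: D_def algebra_simps)
  finally have eq: "ar_corr \<rho> \<gamma> h - 2 * \<rho> * cos \<gamma> * ar_corr \<rho> \<gamma> (h - 1) + \<rho>\<^sup>2 * ar_corr \<rho> \<gamma> (h - 2)
     = integral {-pi..pi} (\<lambda>\<omega>. D \<omega> * ar_density \<rho> \<gamma> \<omega>)" .
  have "norm (integral {-pi..pi} (\<lambda>\<omega>. D \<omega> * ar_density \<rho> \<gamma> \<omega>)) \<le>
     integral {-pi..pi} (\<lambda>\<omega>. s / 2 * ar_density \<rho> \<gamma> \<omega> + 1 / (2 * s * ar_mass \<rho> \<gamma>))"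
  proof (rule integral_norm_bound_integral)
    show "(\<lambda>\<omega>. D \<omega> * ar_density \<rho> \<gamma> \<omega>) integrable_on {-pi..pi}"
      unfolding D_def by (intro integrable_continuous_real continuous_intros cd)
    show "(\<lambda>\<omega>. s / 2 * ar_density \<rho> \<gamma> \<omega> + 1 / (2 * s * ar_mass \<rho> \<gamma>)) integrable_on {-pi..pi}"
      by (intro integrable_continuous_real continuous_intros cd)
    fix \<omega>
    have p: "0 < ar_poly_sq \<rho> \<gamma> \<omega>" by (rule ar_poly_sq_pos[OF assms(1,2)])
    have D: "(D \<omega>)\<^sup>2 \<le> ar_poly_sq \<rho> \<gamma> \<omega>" unfolding D_def by (rule ar_recursion_sq_le)
    have dpos: "0 < ar_density \<rho> \<gamma> \<omega>" using p assms by (simp add: ar_density_def)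
    have "0 \<le> (\<bar>D \<omega>\<bar> - s)\<^sup>2" by simp
    then have "2 * s * \<bar>D \<omega>\<bar> \<le> s\<^sup>2 + (D \<omega>)\<^sup>2" by (simp add: power2_eq_square algebra_simps)
    also have "\<dots> \<le> s\<^sup>2 + ar_poly_sq \<rho> \<gamma> \<omega>" using D by simp
    finally have "\<bar>D \<omega>\<bar> \<le> (s\<^sup>2 + ar_poly_sq \<rho> \<gamma> \<omega>) / (2 * s)"
      using s by (simp add: field_simps)
    then have "\<bar>D \<omega>\<bar> * ar_density \<rho> \<gamma> \<omega> \<le> (s\<^sup>2 + ar_poly_sq \<rho> \<gamma> \<omega>) / (2 * s) * ar_density \<rho> \<gamma> \<omega>"
      using dpos by (intro mult_right_mono) auto
    also have "\<dots> = s / 2 * ar_density \<rho> \<gamma> \<omega> + 1 / (2 * s * ar_mass \<rho> \<gamma>)"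
      using s(1) p assms(3) by (simp add: ar_density_def divide_simps power2_eq_square)
    finally show "norm (D \<omega> * ar_density \<rho> \<gamma> \<omega>) \<le> s / 2 * ar_density \<rho> \<gamma> \<omega> + 1 / (2 * s * ar_mass \<rho> \<gamma>)"
      using dpos by (simp add: abs_mult)
  qed
  also have "\<dots> = s / 2 * 1 + 2 * pi / (2 * s * ar_mass \<rho> \<gamma>)"
    by (subst integral_add)
       (auto intro!: integrable_continuous_real continuous_intros cd simp: integral_ar_density[OF assms(3)])
  also have "\<dots> = s / 2 + s\<^sup>2 / (2 * s)" by (simp add: s(2))
  also have "\<dots> = s" using s(1) by (simp add: power2_eq_square)
  finally show ?thesis unfolding eq s_def by simp
qed

text \<open>The defect of the second-order recursion vanishes in the limit, so it remains to find
  two initial values: lag 0 from normalization, lag 1 from the recursion itself and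
  evenness.\<close>

lemma ar_corr_tendsto:
  assumes "0 < \<gamma>" "\<gamma> < pi"
  shows "((\<lambda>\<rho>. ar_corr \<rho> \<gamma> (real h)) \<longlongrightarrow> cos (real h * \<gamma>)) (at_left 1)"
proof -
  define e where "e \<rho> = sqrt (2 * pi * (8 * (1 - \<rho>)))" for \<rho> :: real
  have e0: "(e \<longlongrightarrow> 0) (at_left 1)"
    unfolding e_def by (auto intro!: tendsto_eq_intros)
  have id: "((\<lambda>\<rho>::real. \<rho>) \<longlongrightarrow> 1) (at_left 1)" by (rule tendsto_ident_at)
  have ev: "eventually (\<lambda>\<rho>::real. 0 \<le> \<rho> \<and> \<rho> < 1 \<and> 1 - \<rho> \<le> \<gamma> \<and> 1 - \<rho> \<le> pi - \<gamma>) (at_left 1)"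
    using assms eventually_at_left_real[of "max 0 (max (1 - \<gamma>) (1 - (pi - \<gamma>)))" "1::real"]
    by (auto elim!: eventually_mono)
  have mass: "0 < ar_mass \<rho> \<gamma> \<and> sqrt (2 * pi / ar_mass \<rho> \<gamma>) \<le> e \<rho>"
    if "0 \<le> \<rho> \<and> \<rho> < 1 \<and> 1 - \<rho> \<le> \<gamma> \<and> 1 - \<rho> \<le> pi - \<gamma>" for \<rho>
  proof -
    have 1: "1 / (8 * (1 - \<rho>)) \<le> ar_mass \<rho> \<gamma>" using ar_mass_lower[of \<rho> \<gamma>] that assms by auto
    have 0: "0 < 1 / (8 * (1 - \<rho>))" using that by simp
    with 1 have 2: "0 < ar_mass \<rho> \<gamma>" by linarith
    have "1 / ar_mass \<rho> \<gamma> \<le> 8 * (1 - \<rho>)" using 1 2 that by (simp add: field_simps)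
    from mult_left_mono[OF this, of "2 * pi"] have "2 * pi / ar_mass \<rho> \<gamma> \<le> 2 * pi * (8 * (1 - \<rho>))"
      by simp
    with 2 show ?thesis by (simp add: e_def)
  qed
  have rec: "((\<lambda>\<rho>. ar_corr \<rho> \<gamma> x - 2 * \<rho> * cos \<gamma> * ar_corr \<rho> \<gamma> (x - 1)
        + \<rho>\<^sup>2 * ar_corr \<rho> \<gamma> (x - 2)) \<longlongrightarrow> 0) (at_left 1)" for x
    by (rule Lim_null_comparison[OF _ e0])
       (use ev in \<open>eventually_elim, use mass ar_corr_recursion in \<open>fastforce intro: order_trans\<close>\<close>)
  have r0: "((\<lambda>\<rho>. ar_corr \<rho> \<gamma> 0) \<longlongrightarrow> 1) (at_left 1)"
    by (rule tendsto_eventually)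
       (use ev in \<open>eventually_elim, simp add: ar_corr_def integral_ar_density mass\<close>)
  have neg: "ar_corr \<rho> \<gamma> (- x) = ar_corr \<rho> \<gamma> x" for \<rho> x by (simp add: ar_corr_def)
  \<comment> \<open>At lag 1 the recursion involves lag -1, which by evenness is lag 1 again.
    Solving for it gives the quotient below, with limit 2 cos \<gamma> / 2.\<close>
  have r1: "((\<lambda>\<rho>. ar_corr \<rho> \<gamma> 1) \<longlongrightarrow> cos \<gamma>) (at_left 1)"
  proof -
    have A: "((\<lambda>\<rho>. (ar_corr \<rho> \<gamma> 1 - 2 * \<rho> * cos \<gamma> * ar_corr \<rho> \<gamma> 0 + \<rho>\<^sup>2 * ar_corr \<rho> \<gamma> 1
        + 2 * \<rho> * cos \<gamma> * ar_corr \<rho> \<gamma> 0) / (1 + \<rho>\<^sup>2)) \<longlongrightarrow> (0 + 2 * 1 * cos \<gamma> * 1) / (1 + 1\<^sup>2)) (at_left 1)"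
      using rec[of 1] by (intro tendsto_intros r0 id) (auto simp: neg)
    have "(ar_corr \<rho> \<gamma> 1 - 2 * \<rho> * cos \<gamma> * ar_corr \<rho> \<gamma> 0 + \<rho>\<^sup>2 * ar_corr \<rho> \<gamma> 1
        + 2 * \<rho> * cos \<gamma> * ar_corr \<rho> \<gamma> 0) / (1 + \<rho>\<^sup>2) = ar_corr \<rho> \<gamma> 1" for \<rho>
    proof -
      have "1 + \<rho>\<^sup>2 \<noteq> 0" by (metis add_nonneg_eq_0_iff zero_le_one zero_le_power2 zero_neq_one)
      then show ?thesis by (simp add: divide_simps algebra_simps)
    qed
    with A show ?thesis by simp
  qed
  \<comment> \<open>The induction carries two consecutive lags because the recursion is of order
    two.\<close>
  have step: "((\<lambda>\<rho>. ar_corr \<rho> \<gamma> (real h)) \<longlongrightarrow> cos (real h * \<gamma>)) (at_left 1) \<and>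
     ((\<lambda>\<rho>. ar_corr \<rho> \<gamma> (real (Suc h))) \<longlongrightarrow> cos (real (Suc h) * \<gamma>)) (at_left 1)"
  proof (induction h)
    case 0
    then show ?case using r0 r1 by simp
  next
    case (Suc h)
    have A: "((\<lambda>\<rho>. (ar_corr \<rho> \<gamma> (real h + 2) - 2 * \<rho> * cos \<gamma> * ar_corr \<rho> \<gamma> (real h + 2 - 1) + \<rho>\<^sup>2 * ar_corr \<rho> \<gamma> (real h + 2 - 2))
        + 2 * \<rho> * cos \<gamma> * ar_corr \<rho> \<gamma> (real (Suc h)) - \<rho>\<^sup>2 * ar_corr \<rho> \<gamma> (real h))
       \<longlongrightarrow> 0 + 2 * 1 * cos \<gamma> * cos (real (Suc h) * \<gamma>) - 1\<^sup>2 * cos (real h * \<gamma>)) (at_left 1)"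
      using Suc by (intro tendsto_intros rec id) auto
    have x: "real (Suc (Suc h)) * \<gamma> = real (Suc h) * \<gamma> + \<gamma>" "real h * \<gamma> = real (Suc h) * \<gamma> - \<gamma>"
      by (auto simp: algebra_simps)
    have "2 * 1 * cos \<gamma> * cos (real (Suc h) * \<gamma>) - 1\<^sup>2 * cos (real h * \<gamma>) = cos (real (Suc (Suc h)) * \<gamma>)"
      unfolding x cos_add cos_diff by simp
    with A have "((\<lambda>\<rho>. ar_corr \<rho> \<gamma> (real (Suc (Suc h)))) \<longlongrightarrow> cos (real (Suc (Suc h)) * \<gamma>)) (at_left 1)"
      by (simp add: add.commute)
    with Suc show ?case by simp
  qed
  then show ?thesis ..
qed

section \<open>Spectral covariance matrices and their quadratic forms\<close>

lemma spectral_cov_restrict: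
  assumes "continuous_on {-pi..pi} g"
  shows "(spectral_cov (restrict g {-pi..pi}) :: real^'n::{finite,linorder}^'n::_) $ j $ l =
    integral {-pi..pi} (\<lambda>\<omega>. cos ((real (pos j) - real (pos l)) * \<omega>) * g \<omega>)"
proof -
  let ?h = "\<lambda>\<omega>. exp (- (\<i> * of_real ((real (pos j) - real (pos l)) * \<omega>))) * complex_of_real (g \<omega>)"
  have "integral {-pi..pi} (\<lambda>\<omega>. exp (- (\<i> * of_real ((real (pos j) - real (pos l)) * \<omega>))) *
      complex_of_real (restrict g {-pi..pi} \<omega>)) = integral {-pi..pi} ?h"
    by (rule integral_cong) auto
  moreover have "?h integrable_on {-pi..pi}"
    by (intro integrable_continuous_real continuous_intros assms)
  then have "Re (integral {-pi..pi} ?h) = integral {-pi..pi} (Re \<circ> ?h)"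
    by (simp add: integral_linear bounded_linear_Re)
  moreover have "Re \<circ> ?h = (\<lambda>\<omega>. cos ((real (pos j) - real (pos l)) * \<omega>) * g \<omega>)"
    by (rule ext) (simp add: Re_exp del: of_real_mult of_real_diff)
  ultimately show ?thesis
    unfolding spectral_cov_def by (simp del: of_real_mult of_real_diff)
qed

text \<open>It shows that the flat part of a spectral density contributes a multiple of the identity
  matrix.\<close>

lemma integral_cos_multiple:
  fixes d :: int
  shows "integral {-pi..pi} (\<lambda>\<omega>. cos (of_int d * \<omega>)) = (if d = 0 then 2 * pi else 0)"
proof (cases "d = 0")
  case False
  have "((\<lambda>\<omega>. cos (of_int d * \<omega>)) has_integral
     (sin (of_int d * pi) / of_int d - sin (of_int d * -pi) / of_int d)) {-pi..pi}"
    using False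
    by (intro fundamental_theorem_of_calculus)
       (auto intro!: derivative_eq_intros simp: has_real_derivative_iff_has_vector_derivative[symmetric])
  moreover have "sin (of_int d * pi) = 0" by (simp add: sin_zero_iff_int2)
  ultimately show ?thesis using False by (simp add: integral_unique)
qed simp

text \<open>Quadratic forms of cosine matrices become squared moduli of trigonometric sums. This
  serves the limiting covariance, the nonnegativity of spectral covariances and the Daniell
  kernel.\<close>

lemma norm_cis_sum_sq:
  fixes u :: "real^'n::{finite,linorder}"
  shows "(norm (\<Sum>j\<in>UNIV. u $ j *\<^sub>R cis (\<gamma> * real (pos j))))\<^sup>2 =
    (\<Sum>j\<in>UNIV. \<Sum>l\<in>UNIV. u $ j * u $ l * cos ((real (pos j) - real (pos l)) * \<gamma>))"
proof -
  let ?s = "\<Sum>j\<in>UNIV. u $ j *\<^sub>R cis (\<gamma> * real (pos j))"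
  have "(norm ?s)\<^sup>2 = (Re ?s)\<^sup>2 + (Im ?s)\<^sup>2" by (rule cmod_power2)
  also have "\<dots> = (\<Sum>j\<in>UNIV. \<Sum>l\<in>UNIV. u $ j * cos (\<gamma> * real (pos j)) * (u $ l * cos (\<gamma> * real (pos l)))
      + u $ j * sin (\<gamma> * real (pos j)) * (u $ l * sin (\<gamma> * real (pos l))))"
    by (simp add: power2_eq_square sum_product sum.distrib)
  also have "\<dots> = (\<Sum>j\<in>UNIV. \<Sum>l\<in>UNIV. u $ j * u $ l * cos ((real (pos j) - real (pos l)) * \<gamma>))"
    by (intro sum.cong refl) (simp add: left_diff_distrib cos_diff algebra_simps)
  finally show ?thesis .
qed

lemma sum_abs_sq_le:
  fixes u :: "real^'n"
  shows "(\<Sum>j\<in>UNIV. \<bar>u $ j\<bar>)\<^sup>2 \<le> real CARD('n) * (u \<bullet> u)"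
proof -
  define a o1 :: "real^'n" where "a = (\<chi> j. \<bar>u $ j\<bar>)" and "o1 = (\<chi> j. 1)"
  have "(a \<bullet> o1)\<^sup>2 \<le> (a \<bullet> a) * (o1 \<bullet> o1)"
    by (rule Cauchy_Schwarz_ineq)
  then show ?thesis by (simp add: inner_vec_def a_def o1_def mult.commute)
qed

lemma inner_matrix_vector_sum:
  fixes B :: "real^'n^'n" and u :: "real^'n"
  shows "u \<bullet> (B *v u) = (\<Sum>j\<in>UNIV. \<Sum>l\<in>UNIV. u $ j * u $ l * B $ j $ l)"
  by (simp add: inner_vec_def matrix_vector_mult_def sum_distrib_left mult.commute mult.left_commute)

text \<open>Entrywise errors sum to \<open>\<epsilon>\<close> times the squared l1 norm, and
  Cauchy-Schwarz turns that norm into n times the squared Euclidean norm. With \<open>B' = 0\<close>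
  it later bounds quadratic forms themselves.\<close>

lemma quadratic_form_perturbation:
  fixes B B' :: "real^'n^'n" and u :: "real^'n"
  assumes "\<And>j l. \<bar>B $ j $ l - B' $ j $ l\<bar> \<le> \<epsilon>"
  shows "\<bar>u \<bullet> (B *v u) - u \<bullet> (B' *v u)\<bar> \<le> \<epsilon> * real CARD('n) * (u \<bullet> u)"
proof -
  have e: "0 \<le> \<epsilon>" using assms[of undefined undefined] by linarith
  have "u \<bullet> (B *v u) - u \<bullet> (B' *v u) = (\<Sum>j\<in>UNIV. \<Sum>l\<in>UNIV. u $ j * u $ l * (B $ j $ l - B' $ j $ l))"
    by (simp add: inner_matrix_vector_sum sum_subtractf[symmetric] right_diff_distrib)
  also have "\<bar>\<dots>\<bar> \<le> (\<Sum>j\<in>UNIV. \<Sum>l\<in>UNIV. \<bar>u $ j\<bar> * \<bar>u $ l\<bar> * \<epsilon>)"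
    by (intro order_trans[OF sum_abs] sum_mono) (auto simp: abs_mult intro!: mult_left_mono assms)
  also have "\<dots> = \<epsilon> * (\<Sum>j\<in>UNIV. \<bar>u $ j\<bar>)\<^sup>2"
    by (simp add: power2_eq_square sum_product sum_distrib_left sum_distrib_right mult_ac)
  also have "\<dots> \<le> \<epsilon> * (real CARD('n) * (u \<bullet> u))"
    by (intro mult_left_mono sum_abs_sq_le e)
  finally show ?thesis by (simp add: mult_ac)
qed

text \<open>The form is the integral of |sum of u_j exp (i \<omega> j)|^2 against the nonnegative
  \<open>g\<close>.\<close>

lemma integral_cos_quadratic_form_nonneg:
  fixes u :: "real^'n::{finite,linorder}" and B :: "real^'n::_^'n::_"
  assumes "continuous_on {-pi..pi} g" "\<And>\<omega>. 0 \<le> g \<omega>"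
    and "\<And>j l. B $ j $ l = integral {-pi..pi} (\<lambda>\<omega>. cos ((real (pos j) - real (pos l)) * \<omega>) * g \<omega>)"
  shows "0 \<le> u \<bullet> (B *v u)"
proof -
  have i: "(\<lambda>\<omega>. u $ j * u $ l * (cos ((real (pos j) - real (pos l)) * \<omega>) * g \<omega>)) integrable_on {-pi..pi}" for j l
    by (intro integrable_continuous_real continuous_intros assms)
  have "u \<bullet> (B *v u) = (\<Sum>j\<in>UNIV. \<Sum>l\<in>UNIV. integral {-pi..pi}
       (\<lambda>\<omega>. u $ j * u $ l * (cos ((real (pos j) - real (pos l)) * \<omega>) * g \<omega>)))"
    by (simp add: inner_matrix_vector_sum assms(3))
  also have "\<dots> = integral {-pi..pi} (\<lambda>\<omega>. \<Sum>j\<in>UNIV. \<Sum>l\<in>UNIV.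
       u $ j * u $ l * (cos ((real (pos j) - real (pos l)) * \<omega>) * g \<omega>))"
    by (simp add: integral_sum integrable_sum i)
  also have "\<dots> = integral {-pi..pi} (\<lambda>\<omega>. (norm (\<Sum>j\<in>UNIV. u $ j *\<^sub>R cis (\<omega> * real (pos j))))\<^sup>2 * g \<omega>)"
    by (simp add: norm_cis_sum_sq sum_distrib_right mult.assoc)
  also have "0 \<le> \<dots>"
    by (rule integral_nonneg)
       (auto intro!: integrable_continuous_real continuous_intros assms simp: cis.ctr assms(2))
  finally show ?thesis .
qed

text \<open>It passes to natural lags, for which the limits of the autocorrelations are
  known.\<close>

lemma cos_pos_diff_eq:
  "cos ((real (pos j) - real (pos l)) * x) = cos (real (nat \<bar>int (pos j) - int (pos l)\<bar>) * x)"
proof -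
  have "real (nat \<bar>int (pos j) - int (pos l)\<bar>) = \<bar>real (pos j) - real (pos l)\<bar>" by simp
  then show ?thesis by (simp add: abs_if del: of_nat_nat) (metis cos_minus minus_diff_eq mult_minus_left)
qed

text \<open>With \<gamma> fixed, only finitely many lags matter, so one \<rho> close to 1 brings all
  autocorrelations within \<eta> / n of the cosines. The flat component of weight \<eta> gives the
  lower bound and thereby positive definiteness.\<close>

lemma spectral_AR2_ext_concentrated:
  assumes "0 < \<gamma>" "\<gamma> < pi" "0 < \<eta>" "\<eta> \<le> 1"
  obtains f where "f \<in> spectral_AR2_ext"
    and "transpose (spectral_cov f) = (spectral_cov f :: real^'n::{finite,linorder}^'n::_)"
    and "\<And>u :: real^'n::{finite,linorder}. \<eta> * (u \<bullet> u) \<le> u \<bullet> (spectral_cov f *v u)"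
    and "\<And>u :: real^'n::{finite,linorder}.
      \<bar>u \<bullet> (spectral_cov f *v u) - (norm (\<Sum>j\<in>UNIV. u $ j *\<^sub>R cis (\<gamma> * real (pos j))))\<^sup>2\<bar>
        \<le> (real CARD('n) + 2) * \<eta> * (u \<bullet> u)"
proof -
  define n where "n = real CARD('n)"
  have n: "n > 0" by (simp add: n_def)
  have "eventually (\<lambda>\<rho>. \<forall>h\<in>{..CARD('n)}. \<bar>ar_corr \<rho> \<gamma> (real h) - cos (real h * \<gamma>)\<bar> < \<eta> / n) (at_left 1)"
  proof (rule eventually_ball_finite[OF finite_atMost], rule ballI)
    fix h show "eventually (\<lambda>\<rho>. \<bar>ar_corr \<rho> \<gamma> (real h) - cos (real h * \<gamma>)\<bar> < \<eta> / n) (at_left 1)"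
      using tendstoD[OF ar_corr_tendsto[OF assms(1,2), of h], of "\<eta> / n"] n assms
      by (simp add: dist_real_def)
  qed
  moreover have "eventually (\<lambda>\<rho>::real. 0 \<le> \<rho> \<and> \<rho> < 1 \<and> 1 - \<rho> \<le> \<gamma> \<and> 1 - \<rho> \<le> pi - \<gamma>) (at_left 1)"
    using assms eventually_at_left_real[of "max 0 (max (1 - \<gamma>) (1 - (pi - \<gamma>)))" "1::real"]
    by (auto elim!: eventually_mono)
  ultimately have "eventually (\<lambda>\<rho>. (\<forall>h\<in>{..CARD('n)}. \<bar>ar_corr \<rho> \<gamma> (real h) - cos (real h * \<gamma>)\<bar> < \<eta> / n) \<and>
     0 \<le> \<rho> \<and> \<rho> < 1 \<and> 1 - \<rho> \<le> \<gamma> \<and> 1 - \<rho> \<le> pi - \<gamma>) (at_left 1)"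
    by (rule eventually_conj)
  then obtain \<rho> where corr: "\<And>h. h \<le> CARD('n) \<Longrightarrow> \<bar>ar_corr \<rho> \<gamma> (real h) - cos (real h * \<gamma>)\<bar> < \<eta> / n"
    and \<rho>: "0 \<le> \<rho>" "\<rho> < 1" "1 - \<rho> \<le> \<gamma>" "1 - \<rho> \<le> pi - \<gamma>"
    by (auto dest!: eventually_happens'[rotated])
  have "0 < 1 / (8 * (1 - \<rho>))" using \<rho> by simp
  with ar_mass_lower[of \<rho> \<gamma>] \<rho> assms have mass: "0 < ar_mass \<rho> \<gamma>" by linarith
  define g where "g = ar_density \<rho> \<gamma>"
  have cg: "continuous_on S g" for S unfolding g_def by (rule continuous_ar_density[OF \<rho>(1,2)])
  define f where "f = restrict (\<lambda>\<omega>. (1 - \<eta>) * g \<omega> + \<eta> / (2 * pi)) {-pi..pi}"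
  have f: "f \<in> spectral_AR2_ext"
  proof -
    have "f = restrict (\<lambda>\<omega>. (1 - \<eta>) * restrict g {-pi..pi} \<omega> + \<eta> / (2 * pi)) {-pi..pi}"
      by (auto simp: f_def)
    moreover have "restrict g {-pi..pi} \<in> spectral_AR2"
      unfolding g_def by (rule ar_density_in_spectral_AR2[OF \<rho>(1,2) mass])
    ultimately show ?thesis unfolding spectral_AR2_ext_def
      using assms by (intro CollectI exI[of _ "1 - \<eta>"] exI[of _ \<eta>] exI[of _ "restrict g {-pi..pi}"]) auto
  qed
  define B :: "real^'n::_^'n::_" where "B = (\<chi> j l. ar_corr \<rho> \<gamma> (real (pos j) - real (pos l)))"
  define E :: "real^'n::_^'n::_" where "E = (\<chi> j l. cos ((real (pos j) - real (pos l)) * \<gamma>))"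
  have S: "spectral_cov f = (1 - \<eta>) *\<^sub>R B + \<eta> *\<^sub>R (mat 1 :: real^'n::_^'n::_)"
  proof (simp add: vec_eq_iff mat_def, intro allI)
    fix j l :: 'n
    have ic: "continuous_on {-pi..pi} (\<lambda>\<omega>. (1 - \<eta>) * g \<omega> + \<eta> / (2 * pi))"
      by (intro continuous_intros cg)
    have d: "(\<lambda>\<omega>. cos ((real (pos j) - real (pos l)) * \<omega>)) = (\<lambda>\<omega>. cos (of_int (int (pos j) - int (pos l)) * \<omega>))"
      by simp
    have "(spectral_cov f :: real^'n::_^'n::_) $ j $ l = integral {-pi..pi} (\<lambda>\<omega>. (1 - \<eta>) * (cos ((real (pos j) - real (pos l)) * \<omega>) * g \<omega>)
         + \<eta> / (2 * pi) * cos ((real (pos j) - real (pos l)) * \<omega>))"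
      unfolding f_def spectral_cov_restrict[OF ic] by (rule integral_cong) (simp add: algebra_simps)
    also have "\<dots> = (1 - \<eta>) * B $ j $ l + \<eta> / (2 * pi) * integral {-pi..pi} (\<lambda>\<omega>. cos (of_int (int (pos j) - int (pos l)) * \<omega>))"
      unfolding d[symmetric]
      by (subst integral_add)
         (auto intro!: integrable_continuous_real continuous_intros continuous_ar_density[OF \<rho>(1,2)] simp: B_def ar_corr_def g_def)
    also have "\<dots> = (1 - \<eta>) * B $ j $ l + (if j = l then \<eta> else 0)"
      unfolding integral_cos_multiple by (auto simp: strict_mono_eq[OF strict_mono_pos])
    finally show "(j = l \<longrightarrow> (spectral_cov f :: real^'n::_^'n::_) $ l $ l = (1 - \<eta>) * B $ l $ l + \<eta>) \<and>
        (j \<noteq> l \<longrightarrow> (spectral_cov f :: real^'n::_^'n::_) $ j $ l = (1 - \<eta>) * B $ j $ l)" by auto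
  qed
  have Suu: "u \<bullet> (spectral_cov f *v u) = (1 - \<eta>) * (u \<bullet> (B *v u)) + \<eta> * (u \<bullet> u)" for u :: "real^'n::_"
    unfolding S by (simp add: matrix_vector_mult_add_rdistrib inner_add_right scaleR_matrix_vector_assoc[symmetric])
  have Euu: "u \<bullet> (E *v u) = (norm (\<Sum>j\<in>UNIV. u $ j *\<^sub>R cis (\<gamma> * real (pos j))))\<^sup>2" for u :: "real^'n::_"
    by (simp add: inner_matrix_vector_sum norm_cis_sum_sq E_def)
  have BE: "\<bar>B $ j $ l - E $ j $ l\<bar> \<le> \<eta> / n" for j l
  proof -
    have "pos i \<le> CARD('n)" for i :: 'n using bij_betw_pos[where 'a='n] by (auto simp: bij_betw_def)
    from this[of j] this[of l] have "nat \<bar>int (pos j) - int (pos l)\<bar> \<le> CARD('n)" by linarith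
    from corr[OF this] show ?thesis
      unfolding B_def E_def ar_corr_def by (simp only: vec_lambda_beta cos_pos_diff_eq)
  qed
  have pert: "\<bar>u \<bullet> (B *v u) - u \<bullet> (E *v u)\<bar> \<le> \<eta> * (u \<bullet> u)" for u :: "real^'n::_"
    using quadratic_form_perturbation[OF BE, of u] n by (simp add: n_def)
  have Eb: "u \<bullet> (E *v u) \<le> n * (u \<bullet> u)" "0 \<le> u \<bullet> (E *v u)" for u :: "real^'n::_"
  proof -
    have le: "norm (\<Sum>j\<in>UNIV. u $ j *\<^sub>R cis (\<gamma> * real (pos j))) \<le> (\<Sum>j\<in>UNIV. \<bar>u $ j\<bar>)"
      by (rule order_trans[OF norm_sum]) simp
    have "(norm (\<Sum>j\<in>UNIV. u $ j *\<^sub>R cis (\<gamma> * real (pos j))))\<^sup>2 \<le> (\<Sum>j\<in>UNIV. \<bar>u $ j\<bar>)\<^sup>2"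
      by (rule power_mono[OF le]) simp
    from order_trans[OF this sum_abs_sq_le[of u]] show "u \<bullet> (E *v u) \<le> n * (u \<bullet> u)" "0 \<le> u \<bullet> (E *v u)"
      unfolding Euu n_def by auto
  qed
  have Bnn: "0 \<le> u \<bullet> (B *v u)" for u :: "real^'n::_"
    by (rule integral_cos_quadratic_form_nonneg[of g])
       (use mass ar_poly_sq_pos[OF \<rho>(1,2)] cg[of "{-pi..pi}"] in \<open>auto simp: B_def ar_corr_def g_def[abs_def] less_imp_le, auto simp: ar_density_def less_imp_le\<close>)
  show ?thesis
  proof (rule that[OF f])
    show "transpose (spectral_cov f) = (spectral_cov f :: real^'n::_^'n::_)"
    proof -
      have "ar_corr \<rho> \<gamma> (real (pos j) - real (pos l)) = ar_corr \<rho> \<gamma> (real (pos l) - real (pos j))" for j l :: 'n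
        unfolding ar_corr_def cos_pos_diff_eq by (simp add: abs_minus_commute)
      then show ?thesis unfolding S by (simp add: vec_eq_iff transpose_def mat_def B_def)
    qed
    fix u :: "real^'n::_"
    show "\<eta> * (u \<bullet> u) \<le> u \<bullet> (spectral_cov f *v u)"
      unfolding Suu using Bnn[of u] assms by simp
    have "\<bar>u \<bullet> (spectral_cov f *v u) - u \<bullet> (E *v u)\<bar> =
        \<bar>(1 - \<eta>) * (u \<bullet> (B *v u) - u \<bullet> (E *v u)) + \<eta> * (u \<bullet> u) - \<eta> * (u \<bullet> (E *v u))\<bar>"
      unfolding Suu by (simp add: algebra_simps)
    also have "\<dots> \<le> \<bar>(1 - \<eta>) * (u \<bullet> (B *v u) - u \<bullet> (E *v u))\<bar> + \<bar>\<eta> * (u \<bullet> u)\<bar> + \<bar>\<eta> * (u \<bullet> (E *v u))\<bar>"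
      by linarith
    \<comment> \<open>The constant n + 2 collects three errors: one \<eta> from approximating the
      cosines, one \<eta> from the white noise, and n \<eta> because the concentrated part has
      weight 1 - \<eta> instead of 1.\<close>
    also have "\<dots> \<le> 1 * (\<eta> * (u \<bullet> u)) + \<eta> * (u \<bullet> u) + \<eta> * (n * (u \<bullet> u))"
    proof (intro add_mono)
      have "\<bar>(1 - \<eta>) * (u \<bullet> (B *v u) - u \<bullet> (E *v u))\<bar> = (1 - \<eta>) * \<bar>u \<bullet> (B *v u) - u \<bullet> (E *v u)\<bar>"
        using assms by (simp add: abs_mult)
      also have "\<dots> \<le> 1 * (\<eta> * (u \<bullet> u))"
        by (intro mult_mono pert) (use assms in auto)
      finally show "\<bar>(1 - \<eta>) * (u \<bullet> (B *v u) - u \<bullet> (E *v u))\<bar> \<le> 1 * (\<eta> * (u \<bullet> u))" .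
    qed (use assms Eb[of u] in \<open>auto simp: abs_mult\<close>)
    also have "\<dots> = (real CARD('n) + 2) * \<eta> * (u \<bullet> u)" by (simp add: n_def algebra_simps)
    finally show "\<bar>u \<bullet> (spectral_cov f *v u) - (norm (\<Sum>j\<in>UNIV. u $ j *\<^sub>R cis (\<gamma> * real (pos j))))\<^sup>2\<bar>
        \<le> (real CARD('n) + 2) * \<eta> * (u \<bullet> u)" unfolding Euu .
  qed
qed

section \<open>Gaussian measures\<close>

lemma prod_Basis_vec:
  fixes f :: "real \<Rightarrow> ennreal" and x :: "real^'n"
  shows "(\<Prod>b\<in>Basis. f (x \<bullet> b)) = (\<Prod>i\<in>UNIV. f (x $ i))"
proof -
  have B: "(Basis :: (real^'n) set) = (\<lambda>i. axis i 1) ` UNIV"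
    by (auto simp: Basis_vec_def)
  have inj: "inj (\<lambda>i. axis i 1 :: real^'n)"
    by (auto simp: inj_on_def axis_eq_axis)
  show ?thesis
    unfolding B prod.reindex[OF inj] by (simp add: inner_axis)
qed

lemma sets_std_gauss [simp, measurable_cong]: "sets std_gauss = sets borel"
  and space_std_gauss [simp]: "space std_gauss = UNIV"
  by (simp_all add: std_gauss_def)

lemma std_gauss_density_measurable:
  "(\<lambda>z :: real^'n. ennreal (\<Prod>i\<in>UNIV. std_normal_density (z $ i))) \<in> borel_measurable lborel"
  by measurable

lemma prob_space_std_gauss: "prob_space (std_gauss :: (real^'n) measure)"
proof
  have "emeasure std_gauss (space (std_gauss :: (real^'n) measure))
      = (\<integral>\<^sup>+z. ennreal (\<Prod>i\<in>UNIV. std_normal_density (z $ i)) \<partial>(lborel :: (real^'n) measure))"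
    unfolding std_gauss_def by (subst emeasure_density[OF std_gauss_density_measurable]) auto
  also have "\<dots> = (\<integral>\<^sup>+z. (\<Prod>b\<in>Basis. ennreal (std_normal_density (z \<bullet> b))) \<partial>(lborel :: (real^'n) measure))"
    unfolding prod_Basis_vec[of "\<lambda>x. ennreal (std_normal_density x)"]
    by (simp only: prod_ennreal[OF normal_density_nonneg])
  also have "\<dots> = (\<Prod>b\<in>(Basis :: (real^'n) set). \<integral>\<^sup>+x. ennreal (std_normal_density x) \<partial>lborel)"
    by (rule nn_integral_lborel_prod) auto
  also have "(\<integral>\<^sup>+x. ennreal (std_normal_density x) \<partial>lborel) = 1"
    using prob_space.emeasure_space_1[OF prob_space_normal_density[of 1 0]]
    by (simp add: emeasure_density)
  finally show "emeasure std_gauss (space (std_gauss :: (real^'n) measure)) = 1" by simp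
qed

lemma AE_std_gauss:
  assumes "N \<in> null_sets lborel"
  shows "AE z in (std_gauss :: (real^'n) measure). z \<notin> N"
proof -
  have "AE z in lborel. z \<notin> N" by (rule AE_not_in[OF assms])
  then show ?thesis
    unfolding std_gauss_def AE_density[OF std_gauss_density_measurable] by eventually_elim simp
qed

lemma prob_decseq_small:
  assumes "prob_space M" "\<And>i. A i \<in> sets M" "decseq A" "(\<Inter>i. A i) \<in> null_sets M" "\<epsilon> > 0"
  obtains i where "measure M (A i) < \<epsilon>"
proof -
  interpret prob_space M by fact
  have "(\<lambda>i. measure M (A i)) \<longlonglongrightarrow> measure M (\<Inter>i. A i)"
    by (rule finite_Lim_measure_decseq) (use assms in auto)
  moreover have "measure M (\<Inter>i. A i) = 0" using assms(4) by (simp add: measure_eq_0_null_sets)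
  ultimately have "eventually (\<lambda>i. measure M (A i) < \<epsilon>) sequentially"
    using assms(5) by (auto dest!: order_tendstoD(2))
  then show ?thesis using that by (auto dest: eventually_happens)
qed

lemma std_gauss_tail:
  assumes "\<epsilon> > 0"
  obtains K where "K > 0" "measure (std_gauss :: (real^'n) measure) {z. norm z > K} < \<epsilon>"
proof -
  let ?A = "\<lambda>i. {z :: real^'n. norm z > real (Suc i)}"
  have e: "(\<Inter>i. ?A i) = {}"
  proof -
    have "\<exists>i. norm z \<le> real (Suc i)" for z :: "real^'n"
    proof -
      obtain i where "norm z \<le> real i" using real_arch_simple by blast
      then have "norm z \<le> real (Suc i)" by simp
      then show ?thesis by blast
    qed
    then have "z \<notin> (\<Inter>i. ?A i)" for z
      unfolding INT_iff mem_Collect_eq not_less[symmetric] by blast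
    then show ?thesis by blast
  qed
  have d: "decseq ?A"
    by (auto simp: decseq_def le_less_trans[rotated])
  obtain i where "measure std_gauss (?A i) < \<epsilon>"
    by (rule prob_decseq_small[OF prob_space_std_gauss _ d _ assms]) (unfold e, auto)
  then show ?thesis by (intro that[of "real (Suc i)"]) auto
qed

text \<open>
  By compactness of the unit sphere: if slabs of width tending to zero kept probability at least
  \<open>\<epsilon>\<close>, a hyperplane orthogonal to a limit of their normals would have positive probability.
\<close>

lemma std_gauss_slab:
  assumes "\<epsilon> > 0"
  obtains d where "d > 0"
    "\<And>v :: real^'n. v \<noteq> 0 \<Longrightarrow> measure std_gauss {z. \<bar>v \<bullet> z\<bar> < d * norm v} < \<epsilon>"
proof -
  interpret prob_space "std_gauss :: (real^'n) measure" by (rule prob_space_std_gauss)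
  have "\<exists>d>0. \<forall>v :: real^'n. norm v = 1 \<longrightarrow> measure std_gauss {z. \<bar>v \<bullet> z\<bar> < d} < \<epsilon>"
  proof (rule ccontr)
    assume "\<not> ?thesis"
    then have "\<exists>v :: real^'n. norm v = 1 \<and> \<epsilon> \<le> measure std_gauss {z. \<bar>v \<bullet> z\<bar> < d}" if "d > 0" for d
      using that by (meson not_less)
    then have "\<forall>m. \<exists>v :: real^'n. norm v = 1 \<and> \<epsilon> \<le> measure std_gauss {z. \<bar>v \<bullet> z\<bar> < 1 / real (Suc m)}"
      by simp
    then obtain v :: "nat \<Rightarrow> real^'n" where v: "\<And>m. norm (v m) = 1"
      "\<And>m. \<epsilon> \<le> measure std_gauss {z. \<bar>v m \<bullet> z\<bar> < 1 / real (Suc m)}" by metis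
    have "compact (sphere (0 :: real^'n) 1)" by simp
    then obtain l s where l: "l \<in> sphere 0 1" and s: "strict_mono s" "(v \<circ> s) \<longlonglongrightarrow> l"
      by (rule seq_compactE[OF compact_imp_seq_compact, of _ v]) (use v in auto)
    define A where "A m = {z. \<bar>v (s m) \<bullet> z\<bar> < 1 / real (Suc (s m))}" for m
    have Am: "A m \<in> sets std_gauss" for m unfolding A_def by measurable
    \<comment> \<open>The slabs need not be nested, but their tail unions are. A point in all tail
      unions lies in slabs of arbitrarily large index and so is orthogonal to the limit normal
      \<open>l\<close>.\<close>
    define D where "D M = (\<Union>m\<in>{M..}. A m)" for M
    have D: "D M \<in> sets std_gauss" for M unfolding D_def using Am by auto
    have lim: "(\<Inter>M. D M) \<subseteq> {z. l \<bullet> z = 0}"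
    proof
      fix z assume z: "z \<in> (\<Inter>M. D M)"
      have "(\<lambda>m. \<bar>v (s m) \<bullet> z\<bar> - 1 / real (Suc (s m))) \<longlonglongrightarrow> \<bar>l \<bullet> z\<bar> - 0"
        using s(2) filterlim_compose[OF LIMSEQ_inverse_real_of_nat filterlim_subseq[OF s(1)]]
        by (intro tendsto_intros) (auto simp: o_def inverse_eq_divide)
      then have lim: "(\<lambda>m. \<bar>v (s m) \<bullet> z\<bar> - 1 / real (Suc (s m))) \<longlonglongrightarrow> \<bar>l \<bullet> z\<bar>" by simp
      have "\<bar>l \<bullet> z\<bar> \<le> 0"
      proof (rule ccontr)
        assume "\<not> \<bar>l \<bullet> z\<bar> \<le> 0"
        then have "eventually (\<lambda>m. 0 < \<bar>v (s m) \<bullet> z\<bar> - 1 / real (Suc (s m))) sequentially"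
          by (intro order_tendstoD(1)[OF lim]) simp
        then obtain M where M: "\<And>m. m \<ge> M \<Longrightarrow> 0 < \<bar>v (s m) \<bullet> z\<bar> - 1 / real (Suc (s m))"
          by (auto simp: eventually_sequentially)
        from z have "z \<in> D M" by blast
        then obtain m where "m \<ge> M" "z \<in> A m" by (auto simp: D_def)
        then have "\<bar>v (s m) \<bullet> z\<bar> < 1 / real (Suc (s m))" by (simp add: A_def)
        with M[OF \<open>m \<ge> M\<close>] show False by linarith
      qed
      then show "z \<in> {z. l \<bullet> z = 0}" by simp
    qed
    have "l \<noteq> 0" using l by auto
    then have "negligible {z. l \<bullet> z = 0}" by (intro negligible_hyperplane) simp
    then have "{z. l \<bullet> z = 0} \<in> null_sets lborel"
      by (auto simp: negligible_iff_null_sets null_sets_completion_iff)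
    from AE_std_gauss[OF this] have "{z. l \<bullet> z = 0} \<in> null_sets std_gauss"
      by (subst AE_iff_null_sets) (auto intro: borel_closed closed_hyperplane)
    then have Dn: "(\<Inter>M. D M) \<in> null_sets std_gauss"
      by (rule null_sets_subset) (use D lim in auto)
    have "decseq D" by (force simp: D_def decseq_def)
    from prob_decseq_small[OF prob_space_std_gauss D this Dn assms]
    obtain M where "measure std_gauss (D M) < \<epsilon>" .
    moreover have "measure std_gauss (A M) \<le> measure std_gauss (D M)"
      by (rule finite_measure_mono) (use D in \<open>auto simp: D_def\<close>)
    ultimately show False using v(2)[of "s M"] by (simp add: A_def)
  qed
  then obtain d where d: "d > 0" "\<And>v :: real^'n. norm v = 1 \<Longrightarrow> measure std_gauss {z. \<bar>v \<bullet> z\<bar> < d} < \<epsilon>"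
    by blast
  show ?thesis
  proof (rule that[OF d(1)])
    fix v :: "real^'n" assume v: "v \<noteq> 0"
    have "{z. \<bar>v \<bullet> z\<bar> < d * norm v} = {z. \<bar>(v /\<^sub>R norm v) \<bullet> z\<bar> < d}"
      using v by (auto simp: abs_mult field_simps)
    with d(2)[of "v /\<^sub>R norm v"] v show "measure std_gauss {z. \<bar>v \<bullet> z\<bar> < d * norm v} < \<epsilon>" by simp
  qed
qed

section \<open>Gaussian laws with positive definite covariance\<close>

text \<open>Gram-Schmidt for the inner product defined by \<open>B\<close> yields a matrix
  \<open>Q\<close> of B-orthonormal columns, and \<open>B ** Q\<close> is a root. The existence of a
  root is what gives the \<open>SOME\<close> in \<open>gauss_measure\<close> its meaning.\<close>

lemma positive_definite_factorization:
  fixes B :: "real^'n^'n"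
  assumes sym: "transpose B = B" and pd: "\<And>u. u \<noteq> 0 \<Longrightarrow> 0 < u \<bullet> (B *v u)"
  obtains S :: "real^'n^'n" where "S ** transpose S = B"
proof -
  have sw: "x \<bullet> (B *v y) = y \<bullet> (B *v x)" for x y
    by (metis dot_lmul_matrix inner_commute sym transpose_matrix_vector)
  have ex: "\<exists>T. finite T \<and> card T = m \<and> (\<forall>s\<in>T. \<forall>t\<in>T. s \<bullet> (B *v t) = (if s = t then 1 else 0))"
    if "m \<le> CARD('n)" for m
    using that
  proof (induction m)
    case (Suc m)
    then obtain T where T: "finite T" "card T = m"
      "\<And>s t. s \<in> T \<Longrightarrow> t \<in> T \<Longrightarrow> s \<bullet> (B *v t) = (if s = t then 1 else 0)" by auto
    have "span T \<noteq> UNIV"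
    proof
      assume "span T = UNIV"
      then have "dim T = CARD('n)" using dim_span[of T] by (simp add: dim_UNIV)
      with dim_le_card'[OF T(1)] T(2) Suc.prems show False by simp
    qed
    then obtain x where x: "x \<notin> span T" by auto
    \<comment> \<open>The component of \<open>x\<close> in the span is removed with respect to the
      inner product of \<open>B\<close>; \<open>y\<close> is nonzero because \<open>x\<close> lies
      outside the span.\<close>
    define y where "y = x - (\<Sum>t\<in>T. (t \<bullet> (B *v x)) *\<^sub>R t)"
    have "(\<Sum>t\<in>T. (t \<bullet> (B *v x)) *\<^sub>R t) \<in> span T" by (intro span_sum span_scale span_base)
    with x have y0: "y \<noteq> 0" by (auto simp: y_def)
    have ty: "t \<bullet> (B *v y) = 0" if "t \<in> T" for t
    proof -
      have "t \<bullet> (B *v y) = t \<bullet> (B *v x) - (\<Sum>s\<in>T. (s \<bullet> (B *v x)) * (t \<bullet> (B *v s)))"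
        by (simp add: y_def matrix_vector_mult_diff_distrib inner_diff_right matrix_vector_mult_scaleR
            linear_sum[OF matrix_vector_mul_linear] inner_sum_right o_def)
      also have "(\<Sum>s\<in>T. (s \<bullet> (B *v x)) * (t \<bullet> (B *v s))) = (\<Sum>s\<in>T. if t = s then s \<bullet> (B *v x) else 0)"
        by (intro sum.cong) (use T(3) that in auto)
      finally show ?thesis using T(1) that by simp
    qed
    define z where "z = y /\<^sub>R sqrt (y \<bullet> (B *v y))"
    have zz: "z \<bullet> (B *v z) = 1"
      using pd[OF y0] by (simp add: z_def matrix_vector_mult_scaleR field_simps)
    have tz: "t \<bullet> (B *v z) = 0" if "t \<in> T" for t
      using ty[OF that] by (simp add: z_def matrix_vector_mult_scaleR)
    have zt: "z \<bullet> (B *v t) = 0" if "t \<in> T" for t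
      using sw[of z t] tz[OF that] by simp
    have "z \<notin> T" using tz zz by force
    then have "finite (insert z T) \<and> card (insert z T) = Suc m \<and>
        (\<forall>s\<in>insert z T. \<forall>t\<in>insert z T. s \<bullet> (B *v t) = (if s = t then 1 else 0))"
      using T zz tz zt by auto
    then show ?case by blast
  qed (auto intro: exI[of _ "{}"])
  obtain T where T: "finite T" "card T = CARD('n)"
    "\<And>s t. s \<in> T \<Longrightarrow> t \<in> T \<Longrightarrow> s \<bullet> (B *v t) = (if s = t then 1 else 0)"
    using ex[OF order_refl] by auto
  obtain h :: "'n \<Rightarrow> real^'n" where h: "bij_betw h UNIV T"
    using finite_same_card_bij[of "UNIV :: 'n set" T] T by auto
  define Q :: "real^'n^'n" where "Q = (\<chi> i j. h j $ i)"
  have "(transpose Q ** B ** Q) $ i $ j = h i \<bullet> (B *v h j)" for i j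
    unfolding matrix_mul_assoc[symmetric] inner_vec_def
    by (simp add: matrix_matrix_mult_def matrix_vector_mult_def Q_def transpose_def)
  then have "(transpose Q ** B ** Q) $ i $ j = (mat 1 :: real^'n^'n) $ i $ j" for i j
    using T(3)[of "h i" "h j"] h by (auto simp: bij_betw_def mat_def inj_eq)
  then have "(transpose Q ** B) ** Q = mat 1"
    by (simp add: vec_eq_iff)
  then have "Q ** (transpose Q ** B) = mat 1" by (simp add: matrix_left_right_inverse)
  then have "(B ** Q) ** transpose (B ** Q) = B"
    by (metis matrix_mul_assoc matrix_mul_rid matrix_transpose_mul sym)
  then show ?thesis by (rule that)
qed

lemma (in prob_space) prob_ge_1_minus_exceptions:
  assumes A: "A \<in> events" and N: "N \<in> null_sets M"
    and E: "E1 \<in> events" "E2 \<in> events" "E3 \<in> events"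
    and imp: "\<And>z. z \<in> space M \<Longrightarrow> z \<notin> N \<Longrightarrow> z \<notin> E1 \<Longrightarrow> z \<notin> E2 \<Longrightarrow> z \<notin> E3 \<Longrightarrow> z \<in> A"
    and small: "prob E1 < a" "prob E2 < b" "prob E3 < c"
  shows "1 - (a + b + c) \<le> prob A"
proof -
  have N': "N \<in> events" "prob N = 0" using N by (auto simp: measure_eq_0_null_sets)
  have "space M = A \<union> (N \<union> (E1 \<union> (E2 \<union> E3)))"
    using imp sets.sets_into_space[OF A] sets.sets_into_space[OF N'(1)] sets.sets_into_space[OF E(1)]
      sets.sets_into_space[OF E(2)] sets.sets_into_space[OF E(3)] by blast
  then have "1 = prob (A \<union> (N \<union> (E1 \<union> (E2 \<union> E3))))"
    using prob_space by simp
  also have "\<dots> \<le> prob A + prob (N \<union> (E1 \<union> (E2 \<union> E3)))"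
    by (intro measure_Un_le sets.Un A N' E)
  also have "prob (N \<union> (E1 \<union> (E2 \<union> E3))) \<le> prob N + prob (E1 \<union> (E2 \<union> E3))"
    by (intro measure_Un_le sets.Un A N' E)
  also have "prob (E1 \<union> (E2 \<union> E3)) \<le> prob E1 + prob (E2 \<union> E3)"
    by (intro measure_Un_le sets.Un A N' E)
  also have "prob (E2 \<union> E3) \<le> prob E2 + prob E3"
    by (intro measure_Un_le sets.Un A N' E)
  finally show ?thesis using N'(2) small by simp
qed

text \<open>
  The estimates do not depend on the choice of the root \<open>S\<close> of \<open>B\<close>, because
  \<open>u \<bullet> (S *v z) = (transpose S *v u) \<bullet> z\<close> and the norm of \<open>transpose S *v u\<close> is \<open>sqrt (u \<bullet> (B *v u))\<close>.
\<close>

lemma gauss_measure_good_event: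
  assumes "\<epsilon> > 0"
  obtains K d where "K > 0" "d > 0"
    "\<And>(\<mu> :: real^'n) B v w N A. \<lbrakk>transpose B = B; \<And>u. u \<noteq> 0 \<Longrightarrow> 0 < u \<bullet> (B *v u); v \<noteq> 0; w \<noteq> 0;
       N \<in> null_sets lborel; A \<in> sets borel;
       \<And>y. y \<notin> N \<Longrightarrow> (\<And>u. \<bar>u \<bullet> (y - \<mu>)\<bar> \<le> K * sqrt (u \<bullet> (B *v u))) \<Longrightarrow>
         d * sqrt (v \<bullet> (B *v v)) \<le> \<bar>v \<bullet> (y - \<mu>)\<bar> \<Longrightarrow>
         d * sqrt (w \<bullet> (B *v w)) \<le> \<bar>w \<bullet> (y - \<mu>)\<bar> \<Longrightarrow> y \<in> A\<rbrakk>
     \<Longrightarrow> 1 - \<epsilon> \<le> measure (gauss_measure \<mu> B) A"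
proof -
  interpret prob_space "std_gauss :: (real^'n) measure" by (rule prob_space_std_gauss)
  \<comment> \<open>The tolerance is shared by three exceptional events: a large norm and the two
    slabs of \<open>v\<close> and \<open>w\<close>. Both constants are fixed before any mean or
    covariance enters.\<close>
  have e3: "\<epsilon> / 3 > 0" using assms by simp
  obtain K where K: "K > 0" "measure (std_gauss :: (real^'n) measure) {z. norm z > K} < \<epsilon> / 3"
    using std_gauss_tail[OF e3] by blast
  obtain d where d: "d > 0" "\<And>v :: real^'n. v \<noteq> 0 \<Longrightarrow> measure std_gauss {z. \<bar>v \<bullet> z\<bar> < d * norm v} < \<epsilon> / 3"
    using std_gauss_slab[OF e3] by blast
  show ?thesis
  proof (rule that[OF K(1) d(1)])
    fix \<mu> :: "real^'n" and B v w N A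
    assume sym: "transpose B = B" and pd: "\<And>u. u \<noteq> 0 \<Longrightarrow> 0 < u \<bullet> (B *v u)" and vw: "v \<noteq> 0" "w \<noteq> 0"
      and N: "N \<in> null_sets lborel" and A: "A \<in> sets borel"
      and imp: "\<And>y. y \<notin> N \<Longrightarrow> (\<And>u. \<bar>u \<bullet> (y - \<mu>)\<bar> \<le> K * sqrt (u \<bullet> (B *v u))) \<Longrightarrow>
         d * sqrt (v \<bullet> (B *v v)) \<le> \<bar>v \<bullet> (y - \<mu>)\<bar> \<Longrightarrow>
         d * sqrt (w \<bullet> (B *v w)) \<le> \<bar>w \<bullet> (y - \<mu>)\<bar> \<Longrightarrow> y \<in> A"
    define S where "S = (SOME S :: real^'n^'n. S ** transpose S = B)"
    have S: "S ** transpose S = B"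
      unfolding S_def by (rule someI_ex) (metis positive_definite_factorization[OF sym pd])
    let ?T = "\<lambda>u. transpose S *v u"
    have uS: "u \<bullet> (S *v z) = ?T u \<bullet> z" for u z
      using dot_lmul_matrix[of u S z] transpose_matrix_vector[of S u] by simp
    have nT: "norm (?T u) = sqrt (u \<bullet> (B *v u))" for u
    proof -
      have "?T u \<bullet> ?T u = u \<bullet> (S *v ?T u)" by (rule uS[symmetric])
      also have "S *v ?T u = B *v u" by (simp only: matrix_vector_mul_assoc S)
      finally show ?thesis by (simp only: norm_eq_sqrt_inner)
    qed
    have T0: "?T u \<noteq> 0" if "u \<noteq> 0" for u
    proof
      assume "?T u = 0"
      then have "sqrt (u \<bullet> (B *v u)) = 0" using nT[of u] by (simp only: norm_zero)
      with pd[OF that] show False by simp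
    qed
    \<comment> \<open>A root of a positive definite matrix is invertible. Its inverse exhibits the
      preimage of \<open>N\<close> as a linear image of a translate of \<open>N\<close>, hence as a
      null set.\<close>
    have "inj ((*v) (transpose S))"
    proof (rule injI)
      fix x y assume "?T x = ?T y"
      then have "?T (x - y) = 0" by (simp only: matrix_vector_mult_diff_distrib right_minus_eq)
      then have "x - y = 0" using T0 by blast
      then show "x = y" by (simp only: right_minus_eq)
    qed
    then have "invertible (transpose S)"
      unfolding invertible_left_inverse matrix_left_invertible_injective .
    then have "invertible S" using transpose_invertible[of "transpose S"] by simp
    then obtain P where P: "S ** P = mat 1" "P ** S = mat 1" unfolding invertible_def by blast
    let ?y = "\<lambda>z. \<mu> + S *v z"
    have ym: "?y \<in> borel_measurable borel"
      by (intro borel_measurable_continuous_onI continuous_intros)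
    have "?y -` N \<in> null_sets lborel"
    proof -
      have "?y -` N = (\<lambda>x. P *v x) ` ((+) (-\<mu>) ` N)"
      proof (intro equalityI subsetI)
        fix z assume "z \<in> ?y -` N"
        then have "\<mu> + S *v z \<in> N" by simp
        moreover have "z = P *v (- \<mu> + (\<mu> + S *v z))" by (simp add: matrix_vector_mul_assoc P)
        ultimately show "z \<in> (\<lambda>x. P *v x) ` ((+) (-\<mu>) ` N)" by blast
      next
        fix z assume "z \<in> (\<lambda>x. P *v x) ` ((+) (-\<mu>) ` N)"
        then obtain x where x: "x \<in> N" "z = P *v (- \<mu> + x)" by blast
        have "S *v z = - \<mu> + x" unfolding x(2) matrix_vector_mul_assoc P(1) by simp
        with x(1) show "z \<in> ?y -` N" by simp
      qed
      moreover have "negligible ((\<lambda>x. P *v x) ` ((+) (-\<mu>) ` N))"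
        by (intro negligible_differentiable_image_negligible negligible_translation order_refl
              linear_imp_differentiable_on matrix_vector_mul_linear
              negligible_iff_null_sets[THEN iffD2] null_sets_completionI N)
      moreover have yN: "?y -` N \<in> sets lborel"
        using measurable_sets[OF ym, of N] null_setsD2[OF N] by simp
      ultimately show ?thesis
        using null_sets_completion_iff[OF yN] by (simp add: negligible_iff_null_sets)
    qed
    then have "AE z in std_gauss. z \<notin> ?y -` N" "?y -` N \<in> sets std_gauss"
      using AE_std_gauss by (blast, simp add: null_sets_def)
    then have NN: "?y -` N \<in> null_sets std_gauss"
      using AE_iff_null_sets by blast
    define E1 where "E1 = {z :: real^'n. norm z > K}"
    define E2 where "E2 = {z. \<bar>?T v \<bullet> z\<bar> < d * norm (?T v)}"
    define E3 where "E3 = {z. \<bar>?T w \<bullet> z\<bar> < d * norm (?T w)}"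
    have slab: "{z. \<bar>x \<bullet> z\<bar> < c} \<in> events" for x :: "real^'n" and c by measurable
    have "E1 \<in> events" unfolding E1_def by measurable
    moreover have "E2 \<in> events" "E3 \<in> events"
      unfolding E2_def E3_def by (rule slab)+
    ultimately have Em: "E1 \<in> events" "E2 \<in> events" "E3 \<in> events" by this+
    have yA: "?y -` A \<in> events" using measurable_sets[OF ym, of A] A by simp
    have "1 - (\<epsilon> / 3 + \<epsilon> / 3 + \<epsilon> / 3) \<le> prob (?y -` A)"
    proof (rule prob_ge_1_minus_exceptions[OF yA NN Em])
      fix z
      assume z: "z \<notin> ?y -` N" "z \<notin> E1" "z \<notin> E2" "z \<notin> E3"
      have *: "u \<bullet> (?y z - \<mu>) = ?T u \<bullet> z" for u by (simp only: add_diff_cancel_left' uS)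
      have u: "\<bar>u \<bullet> (?y z - \<mu>)\<bar> \<le> K * sqrt (u \<bullet> (B *v u))" for u
      proof -
        have "\<bar>?T u \<bullet> z\<bar> \<le> norm (?T u) * norm z" by (rule Cauchy_Schwarz_ineq2)
        also have "\<dots> \<le> norm (?T u) * K"
          using z(2) by (intro mult_left_mono) (simp_all add: E1_def)
        also have "\<dots> = K * norm (?T u)" by (rule mult.commute)
        finally show ?thesis by (simp only: nT *)
      qed
      have zN: "?y z \<notin> N" using z(1) by (simp only: vimage_eq not_False_eq_True)
      have "d * norm (?T v) \<le> \<bar>?T v \<bullet> z\<bar>" "d * norm (?T w) \<le> \<bar>?T w \<bullet> z\<bar>"
        using z(3,4) by (simp_all only: E2_def E3_def mem_Collect_eq not_less)
      then have v': "d * sqrt (v \<bullet> (B *v v)) \<le> \<bar>v \<bullet> (?y z - \<mu>)\<bar>"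
        and w': "d * sqrt (w \<bullet> (B *v w)) \<le> \<bar>w \<bullet> (?y z - \<mu>)\<bar>"
        by (simp_all only: * nT)
      have "?y z \<in> A" by (rule imp[OF zN u v' w'])
      then show "z \<in> ?y -` A" by (simp only: vimage_eq)
    next
      show "prob E1 < \<epsilon> / 3" unfolding E1_def by (rule K(2))
      show "prob E2 < \<epsilon> / 3" unfolding E2_def by (rule d(2)[OF T0[OF vw(1)]])
      show "prob E3 < \<epsilon> / 3" unfolding E3_def by (rule d(2)[OF T0[OF vw(2)]])
    qed
    then have "1 - \<epsilon> \<le> prob (?y -` A)" by simp
    also have "\<dots> = measure (gauss_measure \<mu> B) A"
      unfolding gauss_measure_def S_def[symmetric]
      using measure_distr[of ?y std_gauss borel A] A ym by simp
    finally show "1 - \<epsilon> \<le> measure (gauss_measure \<mu> B) A" .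
  qed
qed

text \<open>Whatever matrix the \<open>SOME\<close> returns, this is the law of a continuous image
  of a standard Gaussian vector. The supremum is thus bounded by 1 over the whole family, not just
  over the constructed densities.\<close>

lemma measure_gauss_measure_le_1:
  fixes \<mu> :: "real^'n"
  shows "measure (gauss_measure \<mu> B) A \<le> 1"
proof -
  interpret prob_space "std_gauss :: (real^'n) measure" by (rule prob_space_std_gauss)
  have ym: "(\<lambda>z. \<mu> + (SOME S :: real^'n^'n. S ** transpose S = B) *v z) \<in> borel_measurable borel"
    by (intro borel_measurable_continuous_onI continuous_intros)
  interpret g: prob_space "gauss_measure \<mu> B"
    unfolding gauss_measure_def by (rule prob_space_distr) (use ym in simp)
  show ?thesis by (rule g.prob_le_1)
qed

section \<open>Least squares\<close>

lemma matrix_inv_unique: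
  fixes A :: "real^'n^'n"
  assumes "A ** B = mat 1"
  shows "matrix_inv A = B"
proof -
  have BA: "B ** A = mat 1" using assms by (simp add: matrix_left_right_inverse)
  then have "A ** matrix_inv A = mat 1"
    unfolding matrix_inv_def using assms by (rule_tac someI2[of _ B]) auto
  then have "B ** (A ** matrix_inv A) = B" by simp
  then show ?thesis by (simp only: matrix_mul_assoc BA matrix_mul_lid)
qed

lemma matrix_inv_mult:
  fixes A :: "real^'n^'n"
  assumes "invertible A"
  shows "A ** matrix_inv A = mat 1" "matrix_inv A ** A = mat 1"
proof -
  obtain B where B: "A ** B = mat 1" "B ** A = mat 1" using assms unfolding invertible_def by blast
  then show "A ** matrix_inv A = mat 1" "matrix_inv A ** A = mat 1"
    using matrix_inv_unique[OF B(1)] by simp_all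
qed

lemma matrix_inv_scaleR:
  fixes A :: "real^'n^'n"
  assumes "invertible A" "c \<noteq> 0"
  shows "matrix_inv (c *\<^sub>R A) = (1 / c) *\<^sub>R matrix_inv A"
proof (rule matrix_inv_unique)
  show "c *\<^sub>R A ** (1 / c) *\<^sub>R matrix_inv A = mat 1"
    using assms by (simp add: matrix_scalar_ac scalar_matrix_assoc matrix_inv_mult)
qed

lemma invertible_scaleR:
  fixes A :: "real^'n^'n"
  assumes "invertible A" "c \<noteq> 0"
  shows "invertible (c *\<^sub>R A)"
  using scalar_invertible[OF assms(2,1)] .

lemma transpose_matrix_inv_symmetric:
  fixes A :: "real^'n^'n"
  assumes "invertible A" "transpose A = A"
  shows "transpose (matrix_inv A) = matrix_inv A"
proof (rule matrix_inv_unique[symmetric])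
  have "A ** transpose (matrix_inv A) = transpose (matrix_inv A ** A)"
    by (simp add: matrix_transpose_mul assms)
  then show "A ** transpose (matrix_inv A) = mat 1"
    by (simp add: matrix_inv_mult[OF assms(1)] transpose_mat)
qed

lemma inner_matrix_vector_transpose:
  fixes A :: "real^'n^'m"
  shows "x \<bullet> (A *v y) = (transpose A *v x) \<bullet> y"
  using dot_lmul_matrix[of x A y] transpose_matrix_vector[of A x] by simp

lemma inner_transpose_matrix_vector:
  fixes A :: "real^'n^'m"
  shows "(transpose A *v x) \<bullet> y = x \<bullet> (A *v y)"
  by (simp only: inner_matrix_vector_transpose)

lemma col_space_range: "col_space (Z :: real^'k^'n) = range ((*v) Z)"
proof
  have "columns Z \<subseteq> range ((*v) Z)"
    unfolding columns_def using matrix_vector_mult_basis[of Z] by (auto intro!: rangeI simp flip: matrix_vector_mult_basis)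
  moreover have "subspace (range ((*v) Z))"
    by (rule linear_subspace_image) (simp_all add: matrix_vector_mul_linear)
  ultimately show "col_space Z \<subseteq> range ((*v) Z)" by (rule span_minimal)
qed (auto simp: matrix_vector_mult_in_columnspace)

lemma gram_invertible:
  fixes Z :: "real^'k^'n"
  assumes "rank Z = CARD('k)"
  shows "invertible (transpose Z ** Z)"
proof -
  have inj: "inj ((*v) Z)" using assms full_rank_injective by blast
  have "x = 0" if "(transpose Z ** Z) *v x = 0" for x
  proof -
    have "(Z *v x) \<bullet> (Z *v x) = (transpose Z *v (Z *v x)) \<bullet> x"
      by (rule inner_matrix_vector_transpose)
    also have "\<dots> = 0" using that by (simp only: matrix_vector_mul_assoc inner_zero_left)
    finally have "Z *v x = Z *v 0" by simp
    then show ?thesis using inj by (rule injD[rotated])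
  qed
  then show ?thesis
    unfolding invertible_left_inverse matrix_left_invertible_ker by blast
qed

lemma linear_OLS: "linear (OLS Z)"
  unfolding OLS_def by (rule matrix_vector_mul_linear)

lemma linear_OLS_resid: "linear (OLS_resid Z)"
  unfolding OLS_resid_def OLS_def matrix_vector_mul_assoc
  by (intro linear_compose_sub linear_id[unfolded id_def] matrix_vector_mul_linear)

lemma OLS_fitted:
  fixes Z :: "real^'k^'n"
  assumes "rank Z = CARD('k)"
  shows "OLS Z (Z *v b) = b"
  unfolding OLS_def matrix_vector_mul_assoc matrix_mul_assoc[symmetric]
  by (simp add: matrix_inv_mult[OF gram_invertible[OF assms]])

lemma OLS_resid_fitted:
  fixes Z :: "real^'k^'n"
  assumes "rank Z = CARD('k)"
  shows "OLS_resid Z (Z *v b) = 0"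
  by (simp add: OLS_resid_def OLS_fitted[OF assms])

lemma OLS_resid_orthogonal:
  fixes Z :: "real^'k^'n"
  assumes "rank Z = CARD('k)"
  shows "(Z *v b) \<bullet> OLS_resid Z y = 0"
proof -
  have "transpose Z *v OLS_resid Z y = transpose Z *v y
      - ((transpose Z ** Z) ** matrix_inv (transpose Z ** Z)) *v (transpose Z *v y)"
    unfolding OLS_resid_def OLS_def
    by (simp only: matrix_vector_mult_diff_distrib matrix_vector_mul_assoc matrix_mul_assoc)
  also have "\<dots> = 0"
    by (simp only: matrix_inv_mult[OF gram_invertible[OF assms]] matrix_vector_mul_lid diff_self)
  finally have "transpose Z *v OLS_resid Z y = 0" .
  then have "OLS_resid Z y \<bullet> (Z *v b) = 0"
    by (simp only: inner_matrix_vector_transpose inner_zero_left)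
  then show ?thesis by (simp only: inner_commute)
qed

text \<open>Residuals are orthogonal to fitted values, so both sides equal the inner product of the
  two residual vectors.\<close>

lemma OLS_resid_self_adjoint:
  fixes Z :: "real^'k^'n"
  assumes "rank Z = CARD('k)"
  shows "x \<bullet> OLS_resid Z y = OLS_resid Z x \<bullet> y"
proof -
  have 1: "x \<bullet> OLS_resid Z y = OLS_resid Z x \<bullet> OLS_resid Z y" for x y
    using OLS_resid_orthogonal[OF assms, of "OLS Z x" y]
    by (simp add: OLS_resid_def[of Z x] inner_diff_left)
  show ?thesis using 1[of x y] 1[of y x] by (simp add: inner_commute)
qed

lemma OLS_resid_idem:
  fixes Z :: "real^'k^'n"
  assumes "rank Z = CARD('k)"
  shows "OLS_resid Z x \<bullet> OLS_resid Z y = x \<bullet> OLS_resid Z y"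
  using OLS_resid_orthogonal[OF assms, of "OLS Z x" y]
  by (simp add: OLS_resid_def[of Z x] inner_diff_left)

lemma OLS_resid_eq_0_iff:
  fixes Z :: "real^'k^'n"
  assumes "rank Z = CARD('k)"
  shows "OLS_resid Z y = 0 \<longleftrightarrow> y \<in> col_space Z"
proof
  assume "OLS_resid Z y = 0"
  then have "y = Z *v OLS Z y" by (simp add: OLS_resid_def)
  then show "y \<in> col_space Z" unfolding col_space_range by blast
qed (auto simp: col_space_range OLS_resid_fitted[OF assms])

lemma OLS_resid_affine:
  fixes Z :: "real^'k^'n"
  assumes "rank Z = CARD('k)"
  shows "OLS_resid Z (\<delta> *\<^sub>R y + Z *v \<eta>) = \<delta> *\<^sub>R OLS_resid Z y"
  by (simp add: linear_add[OF linear_OLS_resid] linear_scale[OF linear_OLS_resid] OLS_resid_fitted[OF assms])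

lemma OLS_affine:
  fixes Z :: "real^'k^'n"
  assumes "rank Z = CARD('k)"
  shows "OLS Z (\<delta> *\<^sub>R y + Z *v \<eta>) = \<delta> *\<^sub>R OLS Z y + \<eta>"
  by (simp add: linear_add[OF linear_OLS] linear_scale[OF linear_OLS] OLS_fitted[OF assms])

lemma continuous_OLS: "continuous_on S (OLS (Z :: real^'k^'n))"
  by (intro linear_continuous_on linear_conv_bounded_linear[THEN iffD1] linear_OLS)

lemma continuous_OLS_resid: "continuous_on S (OLS_resid (Z :: real^'k^'n))"
  by (intro linear_continuous_on linear_conv_bounded_linear[THEN iffD1] linear_OLS_resid)

lemma col_space_affine_iff:
  fixes Z :: "real^'k^'n"
  assumes "rank Z = CARD('k)" "\<delta> \<noteq> 0"
  shows "\<delta> *\<^sub>R y + Z *v \<eta> \<in> col_space Z \<longleftrightarrow> y \<in> col_space Z"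
  unfolding OLS_resid_eq_0_iff[OF assms(1), symmetric] OLS_resid_affine[OF assms(1)]
  using assms(2) by simp

lemma col_space_null_closed:
  fixes Z :: "real^'k^'n"
  assumes "CARD('k) < CARD('n)"
  shows "closed (col_space Z)" "col_space Z \<in> null_sets lborel"
proof -
  show c: "closed (col_space Z)" by (rule closed_span)
  have "dim (col_space Z) < DIM(real^'n)"
    using rank_bound[of Z] assms by (simp add: column_rank_def span_vec_eq)
  then have "negligible (col_space Z)" by (rule negligible_lowdim)
  then show "col_space Z \<in> null_sets lborel"
    using c by (auto simp: negligible_iff_null_sets null_sets_completion_iff)
qed

text \<open>It supplies the direction along which the noise keeps the residuals away from
  zero.\<close>

lemma ex_orthogonal_col_space:
  fixes Z :: "real^'k^'n"
  assumes "CARD('k) < CARD('n)"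
  obtains v where "v \<noteq> 0" "\<And>b. v \<bullet> (Z *v b) = 0"
proof -
  have "dim (col_space Z) < DIM(real^'n)"
    using rank_bound[of Z] assms by (simp add: column_rank_def span_vec_eq)
  then obtain v where "v \<noteq> 0" "\<And>y. y \<in> span (col_space Z) \<Longrightarrow> orthogonal v y"
    by (rule orthogonal_to_subspace_exists) blast
  moreover have "Z *v b \<in> span (col_space Z)" for b
    by (rule span_base) (rule matrix_vector_mult_in_columnspace)
  ultimately show ?thesis
    by (intro that[of v]) (auto simp: orthogonal_def)
qed

text \<open>
  \<open>wald_matrix X R = L ** transpose L\<close> for \<open>L = wald_root X R\<close>, the matrix of the linear map
  \<open>y \<mapsto> R *v OLS X y\<close>.
\<close>

definition wald_matrix :: "real^'k^'n \<Rightarrow> real^'k^'q \<Rightarrow> real^'q^'q" where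
  "wald_matrix X R = R ** matrix_inv (transpose X ** X) ** transpose R"

definition wald_root :: "real^'k^'n \<Rightarrow> real^'k^'q \<Rightarrow> real^'n^'q" where
  "wald_root X R = R ** (matrix_inv (transpose X ** X) ** transpose X)"

lemma wald_root_mult: "wald_root X R *v y = R *v OLS X y"
  unfolding wald_root_def OLS_def by (simp only: matrix_vector_mul_assoc matrix_mul_assoc)

lemma wald_matrix_eq:
  fixes X :: "real^'k^'n"
  assumes "rank X = CARD('k)"
  shows "wald_matrix X R = wald_root X R ** transpose (wald_root X R)"
proof -
  let ?G = "transpose X ** X"
  note inv = gram_invertible[OF assms]
  have s: "transpose (matrix_inv ?G) = matrix_inv ?G"
    by (rule transpose_matrix_inv_symmetric[OF inv]) (simp add: matrix_transpose_mul)
  have t: "transpose (wald_root X R) = X ** matrix_inv ?G ** transpose R"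
    unfolding wald_root_def by (simp add: matrix_transpose_mul s matrix_mul_assoc)
  have "wald_root X R ** transpose (wald_root X R)
     = R ** (matrix_inv ?G ** ?G) ** matrix_inv ?G ** transpose R"
    unfolding t by (simp only: wald_root_def matrix_mul_assoc)
  also have "\<dots> = wald_matrix X R"
    unfolding matrix_inv_mult[OF inv] wald_matrix_def by simp
  finally show ?thesis by simp
qed

text \<open>The map with matrix \<open>wald_root X R\<close> is onto: each z is R b for some b, and
  X b is mapped to R b. A vector annihilated by the transpose is orthogonal to the range, hence to
  itself.\<close>

lemma transpose_wald_root_nz:
  fixes X :: "real^'k^'n" and R :: "real^'k^'q"
  assumes "rank X = CARD('k)" "rank R = CARD('q)" "z \<noteq> 0"
  shows "transpose (wald_root X R) *v z \<noteq> 0"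
proof
  assume 0: "transpose (wald_root X R) *v z = 0"
  have "surj ((*v) R)" using assms(2) full_rank_surjective by blast
  then obtain b where b: "R *v b = z" by (metis surjD)
  have "z \<bullet> (wald_root X R *v (X *v b)) = 0"
    unfolding inner_matrix_vector_transpose[of z "wald_root X R"] 0 by simp
  then have "z \<bullet> z = 0" by (simp add: wald_root_mult OLS_fitted[OF assms(1)] b)
  with assms(3) show False by simp
qed

lemma wald_matrix_invertible:
  fixes X :: "real^'k^'n" and R :: "real^'k^'q"
  assumes "rank X = CARD('k)" "rank R = CARD('q)"
  shows "invertible (wald_matrix X R)"
proof -
  let ?L = "wald_root X R"
  have "z = 0" if "wald_matrix X R *v z = 0" for z
  proof (rule ccontr)
    assume "z \<noteq> 0"
    then have nz: "transpose ?L *v z \<noteq> 0" by (rule transpose_wald_root_nz[OF assms])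
    have "(transpose ?L *v z) \<bullet> (transpose ?L *v z) = z \<bullet> (?L *v (transpose ?L *v z))"
      by (rule inner_transpose_matrix_vector)
    also have "?L *v (transpose ?L *v z) = wald_matrix X R *v z"
      by (simp only: matrix_vector_mul_assoc wald_matrix_eq[OF assms(1)])
    finally show False using nz that by simp
  qed
  then show ?thesis unfolding invertible_left_inverse matrix_left_invertible_ker by blast
qed

lemma transpose_wald_matrix:
  fixes X :: "real^'k^'n"
  assumes "rank X = CARD('k)"
  shows "transpose (wald_matrix X R) = wald_matrix X R"
  unfolding wald_matrix_eq[OF assms] by (simp add: matrix_transpose_mul)

text \<open>For M = L L', the vector w = L' M^-1 x satisfies L w = x and |w|^2 = x' M^-1 x, and
  Cauchy-Schwarz applies to its product with row s of L. The numerator of the test statistic is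
  thereby bounded below by a single coordinate of the restriction error.\<close>

lemma wald_matrix_quadratic_form_ge:
  fixes X :: "real^'k^'n" and R :: "real^'k^'q"
  assumes "rank X = CARD('k)" "rank R = CARD('q)"
  shows "(x $ s)\<^sup>2 \<le> (row s (wald_root X R) \<bullet> row s (wald_root X R)) *
    (x \<bullet> (matrix_inv (wald_matrix X R) *v x))"
proof -
  let ?L = "wald_root X R" and ?M = "wald_matrix X R"
  define z where "z = matrix_inv ?M *v x"
  define w where "w = transpose ?L *v z"
  have "?M *v z = x"
    unfolding z_def matrix_vector_mul_assoc matrix_inv_mult[OF wald_matrix_invertible[OF assms]] by simp
  then have Lw: "?L *v w = x"
    unfolding w_def by (simp only: matrix_vector_mul_assoc wald_matrix_eq[OF assms(1)])
  have "x $ s = row s ?L \<bullet> w"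
    unfolding Lw[symmetric] by (simp add: matrix_vector_mult_def inner_vec_def row_def)
  then have "(x $ s)\<^sup>2 \<le> (row s ?L \<bullet> row s ?L) * (w \<bullet> w)"
    using Cauchy_Schwarz_ineq by simp
  also have "w \<bullet> w = z \<bullet> (?L *v w)"
    unfolding w_def by (rule inner_transpose_matrix_vector)
  also have "\<dots> = x \<bullet> (matrix_inv ?M *v x)" by (simp only: Lw z_def inner_commute)
  finally show ?thesis .
qed

text \<open>Both covariance estimators are scalar functions times the same invertible matrix, so
  every condition reduces to one on the scalar \<open>g\<close>.\<close>

lemma estimator_conditions_scaled_wald_matrix:
  fixes X :: "real^'k^'n" and R :: "real^'k^'q" and g :: "real^'n \<Rightarrow> real"
  assumes X: "rank X = CARD('k)" and R: "rank R = CARD('q)"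
    and D: "- N \<subseteq> D" and N: "closed N" "N \<in> null_sets lborel"
    and g: "continuous_on (- N) g" "\<And>y. y \<notin> N \<Longrightarrow> 0 < g y"
    and inv: "\<And>y \<delta> \<eta>. y \<notin> N \<Longrightarrow> \<delta> \<noteq> 0 \<Longrightarrow> \<delta> *\<^sub>R y + X *v \<eta> \<notin> N"
    and equi: "\<And>y \<delta> \<eta>. y \<notin> N \<Longrightarrow> \<delta> \<noteq> 0 \<Longrightarrow> g (\<delta> *\<^sub>R y + X *v \<eta>) = \<delta>\<^sup>2 * g y"
  shows "estimator_conditions X D (OLS X) (\<lambda>y. g y *\<^sub>R wald_matrix X R) N"
proof -
  have "det (g y *\<^sub>R wald_matrix X R) \<noteq> 0" if "y \<notin> N" for y
    using invertible_scaleR[OF wald_matrix_invertible[OF X R], of "g y"] g(2)[OF that]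
    by (simp add: invertible_det_nz)
  then show ?thesis
    unfolding estimator_conditions_def
    using D N g inv equi
    by (auto intro!: continuous_OLS continuous_intros
        simp: OLS_affine[OF X] transpose_wald_matrix[OF X] transpose_scalar)
qed

text \<open>A positive scalar keeps the matrix nonsingular off \<open>N\<close>, so the default
  value 0 of the statistic occurs by definition only on \<open>N\<close>.\<close>

lemma F_type_stat_scaled_wald_matrix:
  fixes X :: "real^'k^'n" and R :: "real^'k^'q" and g :: "real^'n \<Rightarrow> real"
  assumes X: "rank X = CARD('k)" and R: "rank R = CARD('q)" and g: "\<And>y. y \<notin> N \<Longrightarrow> 0 < g y"
  shows "F_type_stat R r (OLS X) (\<lambda>y. g y *\<^sub>R wald_matrix X R) N y =
    (if y \<in> N then 0
     else (R *v OLS X y - r) \<bullet> (matrix_inv (wald_matrix X R) *v (R *v OLS X y - r)) / g y)"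
proof (cases "y \<in> N")
  case False
  have i: "invertible (wald_matrix X R)" by (rule wald_matrix_invertible[OF X R])
  have gy: "g y \<noteq> 0" using g[OF False] by simp
  have "det (g y *\<^sub>R wald_matrix X R) \<noteq> 0"
    using invertible_scaleR[OF i gy] by (simp add: invertible_det_nz)
  with False show ?thesis
    by (simp add: F_type_stat_def matrix_inv_scaleR[OF i gy] scaleR_matrix_vector_assoc[symmetric])
qed (simp add: F_type_stat_def)

section \<open>Bandwidth, kernel and exceptional sets\<close>

text \<open>The sum is the value at \<open>cis (c * t)\<close> of a polynomial with coefficients
  \<open>u $ j\<close>, and a polynomial vanishing on an arc of the unit circle is zero.\<close>

lemma trigonometric_sum_eq_0:
  fixes u :: "real^'n::{finite,linorder}"
  assumes c: "0 < c" and zero: "\<And>t. t \<in> {-1..1} \<Longrightarrow> (\<Sum>j\<in>UNIV. u $ j *\<^sub>R cis (c * t * real (pos j))) = 0"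
  shows "u = 0"
proof -
  define p :: "complex poly" where "p = (\<Sum>j\<in>UNIV. monom (of_real (u $ j)) (pos j))"
  have root: "poly p (cis (c * t)) = 0" if "t \<in> {-1..1}" for t
  proof -
    have "cis (c * t) ^ pos j = cis (c * t * real (pos j))" for j :: 'n
      unfolding Complex.DeMoivre by (simp only: mult.commute)
    then show ?thesis using zero[OF that] by (simp add: p_def poly_sum poly_monom scaleR_conv_of_real)
  qed
  \<comment> \<open>The bound 1 stays in the range of the hypothesis; the bound 1 / c keeps the
    angle below 1, where the cosine already separates points of the arc.\<close>
  let ?I = "{0<..<min 1 (1 / c)}"
  have "inj_on (\<lambda>t. cis (c * t)) ?I"
  proof (rule inj_onI)
    fix s t assume st: "s \<in> ?I" "t \<in> ?I" and eq: "cis (c * s) = cis (c * t)"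
    have "c * s < 1" "c * t < 1" "0 < c * s" "0 < c * t" using st c by (auto simp: field_simps)
    with pi_gt3 have "0 \<le> c * s" "c * s \<le> pi" "0 \<le> c * t" "c * t \<le> pi" by linarith+
    moreover have "cos (c * s) = cos (c * t)" using eq by (simp add: complex_eq_iff)
    ultimately have "c * s = c * t" by (rule cos_inj_pi)
    then show "s = t" using c by simp
  qed
  moreover have "infinite ?I" using c by (intro infinite_Ioo) simp
  ultimately have "infinite ((\<lambda>t. cis (c * t)) ` ?I)" using finite_imageD by blast
  moreover have "(\<lambda>t. cis (c * t)) ` ?I \<subseteq> {z. poly p z = 0}" using root by auto
  ultimately have "infinite {z. poly p z = 0}" using finite_subset by blast
  then have "p = 0" using poly_roots_finite by blast
  have "u $ i = 0" for i
  proof -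
    have "coeff p (pos i) = (\<Sum>j\<in>UNIV. if j = i then of_real (u $ j) else 0)"
      unfolding p_def coeff_sum coeff_monom
      by (intro sum.cong) (auto simp: strict_mono_eq[OF strict_mono_pos])
    with \<open>p = 0\<close> show ?thesis by simp
  qed
  then show ?thesis by (simp add: vec_eq_iff)
qed

text \<open>The kernel is the characteristic function of the uniform law on [-1, 1], the source of
  its positive definiteness.\<close>

lemma daniell_eq_integral: "daniell x = integral {-1..1} (\<lambda>t. cos (pi * x * t)) / 2"
proof (cases "x = 0")
  case False
  have "((\<lambda>t. cos (pi * x * t)) has_integral
     (sin (pi * x * 1) / (pi * x) - sin (pi * x * -1) / (pi * x))) {-1..1}"
    using False
    by (intro fundamental_theorem_of_calculus)
       (auto intro!: derivative_eq_intros simp: has_real_derivative_iff_has_vector_derivative[symmetric])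
  with False show ?thesis by (simp add: integral_unique daniell_def)
qed (simp add: daniell_def)

lemma abs_daniell_le_1: "\<bar>daniell x\<bar> \<le> 1"
proof (cases "x = 0")
  case False
  then have "\<bar>sin (pi * x) / (pi * x)\<bar> \<le> 1"
    using abs_sin_x_le_abs_x[of "pi * x"] by (simp only: abs_divide) (simp add: divide_le_eq_1)
  with False show ?thesis by (simp add: daniell_def)
qed (simp add: daniell_def)

text \<open>For d = 0 the value is constantly 1, otherwise the argument never vanishes; the case
  distinction inside \<open>daniell\<close> is therefore never crossed.\<close>

lemma continuous_daniell_inverse:
  fixes f :: "'a::metric_space \<Rightarrow> real"
  assumes "continuous_on S f" "\<And>y. y \<in> S \<Longrightarrow> 0 < f y"
  shows "continuous_on S (\<lambda>y. daniell (d / f y))"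
proof (cases "d = 0")
  case False
  have "continuous_on S (\<lambda>y. sin (pi * (d / f y)) / (pi * (d / f y)))"
    using False assms(2) by (intro continuous_intros assms(1) ballI) force+
  then show ?thesis
    by (rule continuous_on_eq) (use False assms(2) in \<open>force simp: daniell_def\<close>)
qed (simp add: daniell_def)

text \<open>The form is an average over t in [-1, 1] of squared moduli of trigonometric sums. A
  continuous nonnegative integrand with zero integral vanishes identically, which forces u =
  0.\<close>

lemma daniell_quadratic_form_pos:
  fixes u :: "real^'n::{finite,linorder}"
  assumes M: "0 < M" and u: "u \<noteq> 0"
  shows "0 < u \<bullet> ((\<chi> i j. daniell (\<bar>real (pos i) - real (pos j)\<bar> / M)) *v u)"
proof -
  define q where "q t = (norm (\<Sum>j\<in>UNIV. u $ j *\<^sub>R cis (pi / M * t * real (pos j))))\<^sup>2" for t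
  define F where "F j l t = u $ j * u $ l * cos ((real (pos j) - real (pos l)) * (pi / M * t))" for j l t
  have i: "F j l integrable_on {-1..1}" for j l
    unfolding F_def by (intro integrable_continuous_real continuous_intros)
  have cont: "continuous_on {-1..1} q"
    unfolding q_def cis.ctr by (intro continuous_intros)
  have d: "daniell (\<bar>real (pos i) - real (pos j)\<bar> / M) =
      integral {-1..1} (\<lambda>t. cos ((real (pos i) - real (pos j)) * (pi / M * t))) / 2" for i j :: 'n
  proof -
    have "cos (pi * (\<bar>real (pos i) - real (pos j)\<bar> / M) * t) = cos ((real (pos i) - real (pos j)) * (pi / M * t))" for t
    proof -
      have "pi * (\<bar>x\<bar> / M) * t = x * (pi / M * t) \<or> pi * (\<bar>x\<bar> / M) * t = - (x * (pi / M * t))" for x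
        by (auto simp: abs_if)
      then show ?thesis by (metis cos_minus)
    qed
    then show ?thesis unfolding daniell_eq_integral by simp
  qed
  have "u \<bullet> ((\<chi> i j. daniell (\<bar>real (pos i) - real (pos j)\<bar> / M)) *v u)
    = (\<Sum>j\<in>UNIV. \<Sum>l\<in>UNIV. integral {-1..1} (F j l)) / 2"
  proof -
    have "u $ j * u $ l * daniell (\<bar>real (pos j) - real (pos l)\<bar> / M) = integral {-1..1} (F j l) / 2" for j l
      unfolding d F_def by simp
    then show ?thesis unfolding inner_matrix_vector_sum sum_divide_distrib vec_lambda_beta
      by (simp only:)
  qed
  also have "\<dots> = integral {-1..1} (\<lambda>t. \<Sum>j\<in>UNIV. \<Sum>l\<in>UNIV. F j l t) / 2"
    by (simp add: integral_sum integrable_sum i)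
  also have "(\<lambda>t. \<Sum>j\<in>UNIV. \<Sum>l\<in>UNIV. F j l t) = q"
    by (rule ext) (simp only: q_def norm_cis_sum_sq F_def)
  finally have eq: "u \<bullet> ((\<chi> i j. daniell (\<bar>real (pos i) - real (pos j)\<bar> / M)) *v u) = integral {-1..1} q / 2" .
  have "integral {-1..1} q \<noteq> 0"
  proof
    assume "integral {-1..1} q = 0"
    then have "\<forall>t\<in>{-1..1}. q t = 0"
      by (subst (asm) integral_eq_0_iff[OF cont]) (auto simp: q_def)
    then have "(\<Sum>j\<in>UNIV. u $ j *\<^sub>R cis (pi / M * t * real (pos j))) = 0" if "t \<in> {-1..1}" for t
      using that by (auto simp: q_def)
    then have "u = 0" by (rule trigonometric_sum_eq_0[rotated]) (use M in auto)
    with u show False by simp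
  qed
  moreover have "0 \<le> integral {-1..1} q"
    by (intro integral_nonneg integrable_continuous_real cont) (auto simp: q_def)
  ultimately show ?thesis unfolding eq by simp
qed

lemma omega_BV_pos:
  assumes "OLS_resid X y \<noteq> 0"
  shows "0 < omega_BV X m1 a abar y"
  unfolding omega_BV_def W_BV_def
  by (intro divide_pos_pos daniell_quadratic_form_pos assms) auto

text \<open>Kernel entries are at most 1 in modulus, so the form is at most n times the squared
  residual norm; the division by n in \<open>omega_BV\<close> cancels this factor.\<close>

lemma omega_BV_le: "omega_BV X m1 a abar y \<le> OLS_resid X y \<bullet> OLS_resid X y"
proof -
  let ?u = "OLS_resid X y"
  have "\<bar>?u \<bullet> (W_BV X m1 a abar y *v ?u) - ?u \<bullet> (0 *v ?u)\<bar> \<le> 1 * real CARD('b) * (?u \<bullet> ?u)"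
    by (rule quadratic_form_perturbation) (simp add: W_BV_def abs_daniell_le_1)
  then show ?thesis unfolding omega_BV_def
    by (simp add: field_simps)
qed

lemma b_BV_bounds:
  assumes "\<forall>i\<in>{0..m1}. a i > 0"
  shows "0 < b_BV X m1 a abar y" "b_BV X m1 a abar y \<le> (\<Sum>i=0..m1. a i)"
proof -
  have "0 \<le> (\<Sum>i = 1..m1. a i * indicat_real {abar i..} (rho_hat X y))"
    using assms by (intro sum_nonneg mult_nonneg_nonneg) (auto simp: less_imp_le)
  then show "0 < b_BV X m1 a abar y" using assms by (simp add: b_BV_def add_pos_nonneg)
  have "(\<Sum>i = 1..m1. a i * indicat_real {abar i..} (rho_hat X y)) \<le> (\<Sum>i = 1..m1. a i)"
    using assms by (intro sum_mono) (auto simp: indicator_def less_imp_le)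
  then show "b_BV X m1 a abar y \<le> (\<Sum>i=0..m1. a i)"
    by (simp add: b_BV_def sum.atLeast_Suc_atMost)
qed

lemma abs_polynomial_le:
  fixes x B :: real
  assumes "0 \<le> x" "x \<le> B"
  shows "\<bar>\<Sum>i=0..m. h i * x ^ i\<bar> \<le> (\<Sum>i=0..m. \<bar>h i\<bar> * B ^ i)"
proof (rule order_trans[OF sum_abs], rule sum_mono)
  fix i
  have "\<bar>h i * x ^ i\<bar> = \<bar>h i\<bar> * x ^ i" using assms(1) by (simp add: abs_mult)
  also have "\<dots> \<le> \<bar>h i\<bar> * B ^ i" by (intro mult_left_mono power_mono assms) simp
  finally show "\<bar>h i * x ^ i\<bar> \<le> \<bar>h i\<bar> * B ^ i" .
qed

text \<open>Average over the translates of \<open>S\<close> by \<open>t *\<^sub>R w\<close>, \<open>0 \<le> t \<le> 1\<close>, and apply Tonelli's theorem.\<close>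

lemma null_set_if_finite_on_lines:
  fixes S :: "'a::euclidean_space set"
  assumes S: "S \<in> sets borel" and fin: "\<And>y. finite {t :: real. t *\<^sub>R w + y \<in> S}"
  shows "S \<in> null_sets lborel"
proof -
  define F where "F = (\<lambda>(t, y). indicator {0..1::real} t * (indicator S (t *\<^sub>R w + y) :: ennreal))"
  have Fm: "(\<lambda>(t, y). F (t, y)) \<in> borel_measurable (lborel \<Otimes>\<^sub>M lborel)"
    unfolding F_def split_beta' fst_conv snd_conv using S by measurable
  have tr: "(\<integral>\<^sup>+y. indicator S (c + y) \<partial>lborel) = emeasure lborel S" for c :: 'a
  proof -
    have "emeasure lborel S = (\<integral>\<^sup>+y. indicator S y \<partial>distr lborel borel ((+) c))"
      unfolding lborel_distr_plus using S by simp
    also have "\<dots> = (\<integral>\<^sup>+y. indicator S (c + y) \<partial>lborel)"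
      using S by (subst nn_integral_distr) auto
    finally show ?thesis by simp
  qed
  have "emeasure lborel S = (\<integral>\<^sup>+t. indicator {0..1::real} t * emeasure lborel S \<partial>lborel)"
    by (subst nn_integral_multc) auto
  also have "\<dots> = (\<integral>\<^sup>+t. \<integral>\<^sup>+y. F (t, y) \<partial>lborel \<partial>lborel)"
    unfolding F_def using S by (intro nn_integral_cong) (simp add: nn_integral_cmult tr)
  also have "\<dots> = (\<integral>\<^sup>+y. \<integral>\<^sup>+t. F (t, y) \<partial>lborel \<partial>lborel)"
    by (rule lborel_pair.Fubini'[OF Fm, symmetric])
  also have "\<dots> = (\<integral>\<^sup>+y. 0 \<partial>(lborel :: 'a measure))"
  proof (rule nn_integral_cong)
    fix y :: 'a
    have "{t. t *\<^sub>R w + y \<in> S} \<in> null_sets lborel"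
      using fin by (intro finite_imp_null_set_lborel)
    then have "AE t in lborel. t \<notin> {t. t *\<^sub>R w + y \<in> S}" by (rule AE_not_in)
    then have "AE t in lborel. F (t, y) = 0" by eventually_elim (simp add: F_def)
    then show "(\<integral>\<^sup>+t. F (t, y) \<partial>lborel) = 0"
      using nn_integral_cong_AE[of "\<lambda>t. F (t, y)" "\<lambda>_. 0" lborel] by simp
  qed
  finally show ?thesis using S by (auto simp: null_sets_def)
qed

section \<open>Level sets of the autocorrelation coefficient and the exceptional sets\<close>

lemma continuous_rho_num: "continuous_on S (rho_num X)"
  and continuous_rho_denom: "continuous_on S (rho_denom X)"
  unfolding rho_num_def rho_denom_def by (intro continuous_intros continuous_OLS_resid)+

text \<open>Numerator and denominator are quadratic forms in y. The leading coefficient along the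
  line is the form at \<open>w\<close> alone, so one good direction works for every starting point
  \<open>y\<close>.\<close>

lemma rho_quadratic_along_line:
  obtains B where "\<And>t. rho_num X (t *\<^sub>R w + y) - c * rho_denom X (t *\<^sub>R w + y) =
    (rho_num X y - c * rho_denom X y) + B * t + (rho_num X w - c * rho_denom X w) * t\<^sup>2"
proof -
  let ?r = "\<lambda>t. OLS_resid X y $ at_pos t" and ?s = "\<lambda>t. OLS_resid X w $ at_pos t"
  have lin: "OLS_resid X (t *\<^sub>R w + y) = t *\<^sub>R OLS_resid X w + OLS_resid X y" for t
    by (simp add: linear_add[OF linear_OLS_resid] linear_scale[OF linear_OLS_resid])
  have num: "rho_num X (t *\<^sub>R w + y) =
      rho_num X y + (\<Sum>i = 2..CARD('b). ?s i * ?r (i - 1) + ?r i * ?s (i - 1)) * t + rho_num X w * t\<^sup>2" for t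
    unfolding rho_num_def lin
    by (simp add: algebra_simps power2_eq_square sum.distrib sum_distrib_left)
  have denom: "rho_denom X (t *\<^sub>R w + y) =
      rho_denom X y + (\<Sum>i = 1..CARD('b) - 1. 2 * ?s i * ?r i) * t + rho_denom X w * t\<^sup>2" for t
    unfolding rho_denom_def lin
    by (simp add: algebra_simps power2_eq_square sum.distrib sum_distrib_left)
  show ?thesis
    by (rule that[of "(\<Sum>i = 2..CARD('b). ?s i * ?r (i - 1) + ?r i * ?s (i - 1))
        - c * (\<Sum>i = 1..CARD('b) - 1. 2 * ?s i * ?r i)"])
       (unfold num denom, simp add: algebra_simps)
qed

lemma rho_level_null:
  assumes "rho_num X w - c * rho_denom X w \<noteq> 0"
  shows "{y. rho_num X y - c * rho_denom X y = 0} \<in> null_sets lborel"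
proof (rule null_set_if_finite_on_lines[of _ w])
  show "{y. rho_num X y - c * rho_denom X y = 0} \<in> sets borel"
    by (intro borel_closed closed_Collect_eq continuous_intros continuous_rho_num continuous_rho_denom)
  fix y
  obtain B where B: "\<And>t. rho_num X (t *\<^sub>R w + y) - c * rho_denom X (t *\<^sub>R w + y) =
    (rho_num X y - c * rho_denom X y) + B * t + (rho_num X w - c * rho_denom X w) * t\<^sup>2"
    using rho_quadratic_along_line[of X w y c] by blast
  let ?p = "[:rho_num X y - c * rho_denom X y, B, rho_num X w - c * rho_denom X w:]"
  have "{t. t *\<^sub>R w + y \<in> {y. rho_num X y - c * rho_denom X y = 0}} = {t. poly ?p t = 0}"
    unfolding mem_Collect_eq B by (simp add: algebra_simps power2_eq_square)
  moreover have "?p \<noteq> 0" using assms by simp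
  ultimately show "finite {t. t *\<^sub>R w + y \<in> {y. rho_num X y - c * rho_denom X y = 0}}"
    using poly_roots_finite[of ?p] by simp
qed

text \<open>The denominator omits only the last residual. If all the others vanish, orthogonality to
  the constant column makes the residuals sum to zero, so the last one vanishes as well.\<close>

lemma rho_denom_pos:
  fixes X :: "real^'k^'n::{finite,linorder}"
  assumes X: "rank X = CARD('k)" and const: "\<And>i. X $ i $ j = 1" and y: "y \<notin> col_space X"
  shows "0 < rho_denom X y"
proof -
  let ?u = "OLS_resid X y"
  have nn: "0 \<le> rho_denom X y" unfolding rho_denom_def by (intro sum_nonneg) auto
  have "rho_denom X y \<noteq> 0"
  proof
    assume "rho_denom X y = 0"
    then have z: "?u $ at_pos t = 0" if "t \<in> {1..CARD('n) - 1}" for t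
      unfolding rho_denom_def using that by (subst (asm) sum_nonneg_eq_0_iff) auto
    have bij: "pos i \<in> {1..CARD('n)}" for i :: 'n using bij_betw_pos[where 'a='n] by (auto simp: bij_betw_def)
    have z': "?u $ i = 0" if "pos i \<noteq> CARD('n)" for i
    proof -
      have "pos i \<in> {1..CARD('n) - 1}" using bij[of i] that by auto
      from z[OF this] show ?thesis by (simp add: at_pos_pos)
    qed
    have "CARD('n) \<in> {1..CARD('n)}" by (simp add: Suc_le_eq)
    then have "CARD('n) \<in> range (pos :: 'n \<Rightarrow> nat)"
      using bij_betw_pos[where 'a='n] by (simp add: bij_betw_def)
    then obtain l :: 'n where l: "pos l = CARD('n)" by (auto simp del: One_nat_def)
    have z'': "?u $ i = 0" if "i \<noteq> l" for i
      using z'[of i] l that strict_mono_eq[OF strict_mono_pos, of i l] by simp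
    have "(X *v axis j 1) \<bullet> ?u = 0" by (rule OLS_resid_orthogonal[OF X])
    then have "(\<Sum>i\<in>UNIV. ?u $ i) = 0"
      by (simp add: matrix_vector_mult_basis column_def inner_vec_def const)
    then have "?u $ l = 0"
      using z'' sum.remove[of UNIV l "\<lambda>i. ?u $ i"] by simp
    then have "?u $ i = 0" for i using z''[of i] by (cases "i = l") auto
    then have "?u = 0" by (simp add: vec_eq_iff)
    with y show False by (simp add: OLS_resid_eq_0_iff[OF X])
  qed
  with nn show ?thesis by simp
qed

lemma rho_hat_affine:
  fixes X :: "real^'k^'n::{finite,linorder}"
  assumes "rank X = CARD('k)" "\<delta> \<noteq> 0"
  shows "rho_hat X (\<delta> *\<^sub>R y + X *v \<eta>) = rho_hat X y"
proof -
  have "rho_num X (\<delta> *\<^sub>R y + X *v \<eta>) = \<delta>\<^sup>2 * rho_num X y"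
    unfolding rho_num_def OLS_resid_affine[OF assms(1)]
    by (simp add: sum_distrib_left power2_eq_square mult_ac)
  moreover have "rho_denom X (\<delta> *\<^sub>R y + X *v \<eta>) = \<delta>\<^sup>2 * rho_denom X y"
    unfolding rho_denom_def OLS_resid_affine[OF assms(1)]
    by (simp add: sum_distrib_left power_mult_distrib)
  ultimately show ?thesis using assms(2) by (simp add: rho_hat_def)
qed

text \<open>A common form of \<open>N_BV\<close> (with \<open>Z = X\<close>) and
  \<open>N_BV_U\<close> (with \<open>Z = hcat X U\<close>); \<open>rho_hat\<close> is computed from
  \<open>X\<close> in both cases.\<close>

definition exceptional_set ::
    "real^'k^'n::{finite,linorder} \<Rightarrow> real^'l^'n::_ \<Rightarrow> nat \<Rightarrow> (nat \<Rightarrow> real) \<Rightarrow> (real^'n::_) set" where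
  "exceptional_set X Z m1 abar =
     (if rho_nonconst X
      then col_space Z \<union> {y. y \<notin> col_space Z \<and> rho_hat X y \<in> abar ` {1..m1}}
      else col_space Z)"

lemma N_BV_eq: "N_BV X m1 abar = exceptional_set X X m1 abar"
  and N_BV_U_eq: "N_BV_U X U m1 abar = exceptional_set X (hcat X U) m1 abar"
  by (simp_all add: N_BV_def N_BV_U_def exceptional_set_def)

lemma col_space_subset_exceptional_set: "y \<notin> exceptional_set X Z m1 abar \<Longrightarrow> y \<notin> col_space Z"
  by (auto simp: exceptional_set_def split: if_splits)

text \<open>\<open>Z\<close> stands for \<open>X\<close> or for \<open>(X, U)\<close>.\<close>

locale trend_regression =
  fixes X :: "real^'k^'n::{finite,linorder}" and Z :: "real^'l^'n::{finite,linorder}" and j1 :: 'k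
  assumes X: "rank X = CARD('k)" and Z: "rank Z = CARD('l)"
    and const: "\<And>i. X $ i $ j1 = 1"
    and less: "CARD('l) < CARD('n)"
    and sub: "\<And>\<eta>. X *v \<eta> \<in> col_space Z"
begin

lemma col_space_X_subset: "col_space X \<subseteq> col_space Z"
  using sub by (auto simp: col_space_range)

lemma rho_hat_eq_iff:
  assumes "y \<notin> col_space Z"
  shows "rho_hat X y = c \<longleftrightarrow> rho_num X y - c * rho_denom X y = 0"
proof -
  have "y \<notin> col_space X" using assms col_space_X_subset by blast
  then have "0 < rho_denom X y" by (rule rho_denom_pos[OF X const])
  then show ?thesis by (auto simp: rho_hat_def field_simps)
qed

text \<open>Clearing the denominator turns level sets of a quotient into zero sets of continuous
  quadratic forms, which are closed. Zeros inside \<open>col_space Z\<close> add nothing to the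
  union.\<close>

lemma exceptional_set_eq:
  "exceptional_set X Z m1 abar = (if rho_nonconst X
     then col_space Z \<union> (\<Union>i\<in>{1..m1}. {y. rho_num X y - abar i * rho_denom X y = 0})
     else col_space Z)"
  using rho_hat_eq_iff by (auto simp: exceptional_set_def)

lemma exceptional_set_closed: "closed (exceptional_set X Z m1 abar)"
  unfolding exceptional_set_eq
  by (auto intro!: closed_Un closed_UN closed_Collect_eq continuous_intros continuous_rho_num
      continuous_rho_denom col_space_null_closed(1)[OF less])

lemma exceptional_set_null: "exceptional_set X Z m1 abar \<in> null_sets lborel"
proof (cases "rho_nonconst X")
  case True
  have "{y. rho_num X y - c * rho_denom X y = 0} \<in> null_sets lborel" for c
  proof -
    obtain y z where yz: "y \<notin> col_space X" "z \<notin> col_space X" "rho_hat X y \<noteq> rho_hat X z"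
      using True unfolding rho_nonconst_def by blast
    have "rho_num X w - c * rho_denom X w = 0 \<Longrightarrow> w \<notin> col_space X \<Longrightarrow> rho_hat X w = c" for w
      using rho_denom_pos[OF X const, of w] by (simp add: rho_hat_def field_simps)
    \<comment> \<open>\<open>c\<close> can be the value of \<open>rho_hat\<close> at no more than
      one of the points \<open>y\<close> and \<open>z\<close>; the other one serves as
      \<open>w\<close>.\<close>
    then obtain w where "rho_num X w - c * rho_denom X w \<noteq> 0"
      using yz by metis
    then show ?thesis by (rule rho_level_null)
  qed
  then show ?thesis
    unfolding exceptional_set_eq using True
    by (auto intro!: null_sets.Un null_sets_UN' col_space_null_closed(2)[OF less] countable_finite)
qed (simp add: exceptional_set_def col_space_null_closed(2)[OF less])

lemma not_in_col_space_affine: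
  assumes "y \<notin> col_space Z" "\<delta> \<noteq> 0"
  shows "\<delta> *\<^sub>R y + X *v \<eta> \<notin> col_space Z"
proof -
  obtain b where b: "X *v \<eta> = Z *v b" using sub[of \<eta>] unfolding col_space_range by blast
  show ?thesis unfolding b col_space_affine_iff[OF Z assms(2)] by (rule assms(1))
qed

lemma exceptional_set_affine:
  assumes "y \<notin> exceptional_set X Z m1 abar" "\<delta> \<noteq> 0"
  shows "\<delta> *\<^sub>R y + X *v \<eta> \<notin> exceptional_set X Z m1 abar"
proof -
  have "y \<notin> col_space Z" by (rule col_space_subset_exceptional_set[OF assms(1)])
  from not_in_col_space_affine[OF this assms(2)] show ?thesis
    using assms(1) by (auto simp: exceptional_set_def rho_hat_affine[OF X assms(2)] split: if_splits)
qed

lemma resid_nz: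
  assumes "y \<notin> exceptional_set X Z m1 abar"
  shows "OLS_resid X y \<noteq> 0"
  using col_space_subset_exceptional_set[OF assms] col_space_X_subset
  by (auto simp: OLS_resid_eq_0_iff[OF X])

lemma continuous_b_BV: "continuous_on (- exceptional_set X Z m1 abar) (b_BV X m1 a abar)"
proof (cases "rho_nonconst X")
  case True
  let ?S = "- exceptional_set X Z m1 abar"
  have y: "y \<notin> col_space X" if "y \<in> ?S" for y
    using that col_space_subset_exceptional_set[of y X Z] col_space_X_subset by auto
  have rho: "continuous_on ?S (rho_hat X)"
    unfolding rho_hat_def
    by (intro continuous_intros continuous_rho_num continuous_rho_denom)
       (use y rho_denom_pos[OF X const] in \<open>auto simp: less_le\<close>)
  have ind: "continuous_on ?S (\<lambda>y. indicat_real {abar i..} (rho_hat X y))" if i: "i \<in> {1..m1}" for i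
  proof -
    have ne: "rho_hat X y \<noteq> abar i" if "y \<in> ?S" for y
      using that True i by (auto simp: exceptional_set_def)
    \<comment> \<open>Away from its jump the indicator equals this expression, and
      \<open>sgn\<close> is continuous off zero.\<close>
    have "continuous_on ?S (\<lambda>y. (1 + sgn (rho_hat X y - abar i)) / 2)"
      by (intro continuous_intros rho) (use ne in auto)
    then show ?thesis
      by (rule continuous_on_eq) (use ne in \<open>auto simp: sgn_if indicator_def less_le\<close>)
  qed
  show ?thesis unfolding b_BV_def by (intro continuous_intros ind)
next
  case False
  \<comment> \<open>Here no thresholds are removed, and the constant value of \<open>rho_hat\<close>
    may equal one of them. Continuity holds because the bandwidth is constant as well.\<close>
  have "b_BV X m1 a abar y = b_BV X m1 a abar z" if "y \<notin> exceptional_set X Z m1 abar" "z \<notin> exceptional_set X Z m1 abar" for y z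
  proof -
    have "y \<notin> col_space X" "z \<notin> col_space X"
      using that col_space_subset_exceptional_set[of _ X Z] col_space_X_subset by auto
    then have "rho_hat X y = rho_hat X z" using False unfolding rho_nonconst_def by blast
    then show ?thesis by (simp add: b_BV_def)
  qed
  then have "\<exists>c. \<forall>y\<in>- exceptional_set X Z m1 abar. b_BV X m1 a abar y = c" by (metis ComplD)
  then obtain c where "\<And>y. y \<in> - exceptional_set X Z m1 abar \<Longrightarrow> c = b_BV X m1 a abar y" by metis
  then show ?thesis by (rule continuous_on_eq[OF continuous_on_const])
qed

lemma continuous_omega_BV: "continuous_on (- exceptional_set X Z m1 abar) (omega_BV X m1 a abar)"
  unfolding omega_BV_def inner_matrix_vector_sum W_BV_def vec_lambda_beta
  by (intro continuous_intros continuous_OLS_resid continuous_daniell_inverse continuous_b_BV) auto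

lemma continuous_c_BV: "continuous_on (- exceptional_set X Z m1 abar) (c_BV X m1 a abar m3 p)"
  unfolding c_BV_def by (intro continuous_intros continuous_b_BV)

lemma b_BV_affine: "\<delta> \<noteq> 0 \<Longrightarrow> b_BV X m1 a abar (\<delta> *\<^sub>R y + X *v \<eta>) = b_BV X m1 a abar y"
  by (simp add: b_BV_def rho_hat_affine[OF X])

lemma omega_BV_affine:
  assumes "\<delta> \<noteq> 0"
  shows "omega_BV X m1 a abar (\<delta> *\<^sub>R y + X *v \<eta>) = \<delta>\<^sup>2 * omega_BV X m1 a abar y"
  unfolding omega_BV_def W_BV_def b_BV_affine[OF assms] OLS_resid_affine[OF X] matrix_vector_mult_scaleR
  by (simp add: power2_eq_square)

lemma c_BV_affine: "\<delta> \<noteq> 0 \<Longrightarrow> c_BV X m1 a abar m3 p (\<delta> *\<^sub>R y + X *v \<eta>) = c_BV X m1 a abar m3 p y"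
  by (simp add: c_BV_def b_BV_affine)

lemma borel_measurable_b_BV: "b_BV X m1 a abar \<in> borel_measurable borel"
proof -
  have [measurable]: "rho_num X \<in> borel_measurable borel" "rho_denom X \<in> borel_measurable borel"
    by (intro borel_measurable_continuous_onI continuous_rho_num continuous_rho_denom)+
  show ?thesis unfolding b_BV_def rho_hat_def by measurable
qed

lemma borel_measurable_C_BV: "C_BV X m1 a abar m2 h C0 \<in> borel_measurable borel"
proof -
  note borel_measurable_b_BV[measurable]
  have [measurable]: "col_space X \<in> sets borel" by (intro borel_closed closed_span)
  show ?thesis unfolding C_BV_def by measurable
qed

end

text \<open>The exponent is abstracted to \<open>e\<close>, later \<open>cumsum_ratio\<close> over
  n^2 or \<open>J_stat\<close>. As \<open>e\<close> is invariant under the affine maps, the factor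
  \<open>\<delta>\<^sup>2\<close> comes from \<open>omega_BV\<close> alone.\<close>

lemma exp_factor_estimator_conditions:
  fixes X :: "real^'k^'n::{finite,linorder}" and Z :: "real^'l^'n::{finite,linorder}" and R :: "real^'k^'q"
  assumes "trend_regression X Z j1" and R: "rank R = CARD('q)"
    and D: "- exceptional_set X Z m1 abar \<subseteq> D"
    and e: "continuous_on (- exceptional_set X Z m1 abar) e"
      "\<And>y \<delta> \<eta>. y \<notin> exceptional_set X Z m1 abar \<Longrightarrow> \<delta> \<noteq> 0 \<Longrightarrow> e (\<delta> *\<^sub>R y + X *v \<eta>) = e y"
  shows "estimator_conditions X D (OLS X)
    (\<lambda>y. (omega_BV X m1 a abar y * exp (c_BV X m1 a abar m3 p y * e y)) *\<^sub>R wald_matrix X R)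
    (exceptional_set X Z m1 abar)"
proof -
  interpret trend_regression X Z j1 by fact
  show ?thesis
  proof (rule estimator_conditions_scaled_wald_matrix[OF X R D exceptional_set_closed exceptional_set_null])
    show "continuous_on (- exceptional_set X Z m1 abar)
       (\<lambda>y. omega_BV X m1 a abar y * exp (c_BV X m1 a abar m3 p y * e y))"
      by (intro continuous_intros continuous_omega_BV continuous_c_BV e)
    show "0 < omega_BV X m1 a abar y * exp (c_BV X m1 a abar m3 p y * e y)"
      if "y \<notin> exceptional_set X Z m1 abar" for y
      using omega_BV_pos[OF resid_nz[OF that]] by simp
  qed (simp_all add: exceptional_set_affine omega_BV_affine c_BV_affine e(2))
qed

section \<open>The correction factors\<close>

lemma continuous_on_matrix_mult_vec:
  "continuous_on S f \<Longrightarrow> continuous_on S (\<lambda>x. (A :: real^'m^'n) *v f x)"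
  by (rule bounded_linear.continuous_on[of "(*v) A"]) (simp add: linear_conv_bounded_linear[symmetric])

lemma quadratic_form_bounded:
  fixes Q :: "real^'n^'n"
  shows "\<exists>G\<ge>0. \<forall>r. \<bar>r \<bullet> (Q *v r)\<bar> \<le> G * (r \<bullet> r)"
proof -
  have bl: "bounded_linear ((*v) Q)" by (simp add: linear_conv_bounded_linear[symmetric])
  show ?thesis
  proof (intro exI[of _ "onorm ((*v) Q)"] conjI allI)
    show "0 \<le> onorm ((*v) Q)" by (rule onorm_pos_le[OF bl])
    fix r
    have "\<bar>r \<bullet> (Q *v r)\<bar> \<le> norm r * norm (Q *v r)" by (rule Cauchy_Schwarz_ineq2)
    also have "\<dots> \<le> norm r * (onorm ((*v) Q) * norm r)" by (intro mult_left_mono onorm[OF bl]) simp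
    finally show "\<bar>r \<bullet> (Q *v r)\<bar> \<le> onorm ((*v) Q) * (r \<bullet> r)"
      by (simp add: dot_square_norm power2_eq_square mult_ac)
  qed
qed

text \<open>The entries of A'A are at most n, so the quadratic form is at most n^2 times the squared
  residual norm; this matches the normalization n^-2.\<close>

lemma abs_cumsum_ratio_le:
  fixes X :: "real^'k^'n::{finite,linorder}"
  assumes "OLS_resid X y \<noteq> 0"
  shows "\<bar>cumsum_ratio X y / (real CARD('n))\<^sup>2\<bar> \<le> 1"
proof -
  let ?u = "OLS_resid X y" and ?B = "transpose cumsum_mat ** cumsum_mat :: real^'n::_^'n::_"
  have "\<bar>?B $ i $ j\<bar> \<le> real CARD('n)" for i j
  proof -
    have "\<bar>?B $ i $ j\<bar> \<le> (\<Sum>k\<in>UNIV. \<bar>cumsum_mat $ k $ i * cumsum_mat $ k $ j :: real\<bar>)"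
      by (simp add: matrix_matrix_mult_def transpose_def)
    also have "\<dots> \<le> (\<Sum>k\<in>(UNIV :: 'n set). 1)"
      by (intro sum_mono) (simp add: cumsum_mat_def)
    finally show ?thesis by simp
  qed
  then have "\<bar>?u \<bullet> (?B *v ?u) - ?u \<bullet> (0 *v ?u)\<bar> \<le> real CARD('n) * real CARD('n) * (?u \<bullet> ?u)"
    by (intro quadratic_form_perturbation) simp
  then have "\<bar>?u \<bullet> (?B *v ?u)\<bar> \<le> (?u \<bullet> ?u) * (real CARD('n))\<^sup>2"
    by (simp add: power2_eq_square mult_ac)
  moreover have "0 < (?u \<bullet> ?u) * (real CARD('n))\<^sup>2" using assms by simp
  ultimately have "\<bar>?u \<bullet> (?B *v ?u)\<bar> / ((?u \<bullet> ?u) * (real CARD('n))\<^sup>2) \<le> 1"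
    by (simp only: divide_le_eq_1_pos)
  then show ?thesis unfolding cumsum_ratio_def by (simp add: abs_divide abs_mult divide_divide_eq_left)
qed

section \<open>The regression extended by U\<close>

lemma hcat_mult:
  fixes X :: "real^'k^'n" and U :: "real^'m^'n"
  shows "hcat X U *v b = X *v (\<chi> j. b $ Inl j) + U *v (\<chi> j. b $ Inr j)"
proof (simp add: vec_eq_iff, intro allI)
  fix i
  have "(hcat X U *v b) $ i = (\<Sum>j\<in>UNIV <+> UNIV. hcat X U $ i $ j * b $ j)"
    by (simp add: matrix_vector_mult_def)
  also have "\<dots> = (X *v (\<chi> j. b $ Inl j)) $ i + (U *v (\<chi> j. b $ Inr j)) $ i"
    by (subst sum.Plus) (simp_all add: hcat_def matrix_vector_mult_def)
  finally show "(hcat X U *v b) $ i = (X *v (\<chi> j. b $ Inl j)) $ i + (U *v (\<chi> j. b $ Inr j)) $ i" .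
qed

lemma selector_mult:
  fixes b :: "real^('k::finite + 'm::finite)"
  shows "(selector :: real^('k + 'm)^'m) *v b = (\<chi> j. b $ Inr j)"
  unfolding selector_def hcat_mult by (simp only: matrix_vector_mult_0 matrix_vector_mul_lid add_0)

lemma rank_selector: "rank (selector :: real^('k::finite + 'm)^'m) = CARD('m::finite)"
proof -
  have "surj ((*v) (selector :: real^('k + 'm)^'m))"
  proof (rule surjI)
    fix x :: "real^'m"
    show "(selector :: real^('k + 'm)^'m) *v (\<chi> j. case j of Inl _ \<Rightarrow> 0 | Inr i \<Rightarrow> x $ i) = x"
      unfolding selector_mult by (simp add: vec_eq_iff)
  qed
  then show ?thesis using full_rank_surjective by blast
qed

lemma fitted_eq_hcat_mult:
  fixes X :: "real^'k^'n" and U :: "real^'m^'n"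
  obtains b where "X *v \<eta> = hcat X U *v b" "(selector :: real^('k + 'm)^'m) *v b = 0"
proof (rule that)
  let ?b = "(\<chi> j. case j of Inl i \<Rightarrow> \<eta> $ i | Inr _ \<Rightarrow> 0) :: real^('k + 'm)"
  have "(\<chi> j. ?b $ Inl j) = \<eta>" "(\<chi> j. ?b $ Inr j) = (0 :: real^'m)"
    by (simp_all add: vec_eq_iff)
  then show "X *v \<eta> = hcat X U *v ?b" "(selector :: real^('k + 'm)^'m) *v ?b = 0"
    unfolding hcat_mult selector_mult by simp_all
qed

text \<open>The residual meets both requirements of the description, and two candidates differ by a
  vector in the complement and in its double complement, hence by zero.\<close>

lemma orth_proj_orthogonal_comp:
  fixes Z :: "real^'l^'n"
  assumes Z: "rank Z = CARD('l)"
  shows "orth_proj ((col_space Z)\<^sup>\<bottom>) y = OLS_resid Z y"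
  unfolding orth_proj_def
proof (rule the_equality)
  let ?r = "OLS_resid Z y"
  have r: "?r \<in> (col_space Z)\<^sup>\<bottom>"
    using OLS_resid_orthogonal[OF Z] by (auto simp: orthogonal_comp_def orthogonal_def col_space_range)
  have "y - ?r \<in> col_space Z" by (simp add: OLS_resid_def matrix_vector_mult_in_columnspace)
  then have f: "y - ?r \<in> (col_space Z)\<^sup>\<bottom>\<^sup>\<bottom>"
    using orthogonal_comp_subset by blast
  show "?r \<in> (col_space Z)\<^sup>\<bottom> \<and> y - ?r \<in> (col_space Z)\<^sup>\<bottom>\<^sup>\<bottom>" using r f by simp
  fix p assume p: "p \<in> (col_space Z)\<^sup>\<bottom> \<and> y - p \<in> (col_space Z)\<^sup>\<bottom>\<^sup>\<bottom>"
  have a: "p - ?r \<in> (col_space Z)\<^sup>\<bottom>"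
    using p r by (intro subspace_diff subspace_orthogonal_comp) auto
  have "(y - ?r) - (y - p) \<in> (col_space Z)\<^sup>\<bottom>\<^sup>\<bottom>"
    by (rule subspace_diff[OF subspace_orthogonal_comp f conjunct2[OF p]])
  then have "p - ?r \<in> (col_space Z)\<^sup>\<bottom>\<^sup>\<bottom>" by simp
  with a have "orthogonal (p - ?r) (p - ?r)" by (auto simp: orthogonal_comp_def)
  then show "p = ?r" by (simp add: orthogonal_self)
qed

lemma s2_stat_eq:
  fixes X :: "real^'k^'n" and U :: "real^'m^'n"
  assumes "rank (hcat X U) = CARD('k + 'm)"
  shows "s2_stat X U y = (OLS_resid (hcat X U) y \<bullet> OLS_resid (hcat X U) y) / real CARD('n)"
  unfolding s2_stat_def orth_proj_orthogonal_comp[OF assms] OLS_resid_idem[OF assms] ..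

text \<open>\<open>J_mat\<close> is \<open>s2_stat\<close> times the Wald matrix of the regression
  on (X, U) with restriction matrix \<open>selector\<close>. The 1 / n in \<open>s2_stat\<close>
  cancels against the 1 / n in \<open>J_stat\<close>.\<close>

lemma J_stat_eq:
  fixes X :: "real^'k^'n" and U :: "real^'m^'n"
  defines "L \<equiv> wald_root (hcat X U) (selector :: real^('k + 'm)^'m)"
    and "W \<equiv> wald_matrix (hcat X U) (selector :: real^('k + 'm)^'m)"
    and "u \<equiv> OLS_resid (hcat X U)"
  assumes Z: "rank (hcat X U) = CARD('k + 'm)" and y: "y \<notin> col_space (hcat X U)"
  shows "J_stat X U y = ((L *v y) \<bullet> (matrix_inv W *v (L *v y))) / (u y \<bullet> u y)"
    and "invertible (J_mat X U y)"
proof -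
  have i: "invertible W" unfolding W_def by (rule wald_matrix_invertible[OF Z rank_selector])
  have u: "u y \<noteq> 0" using y by (simp add: u_def OLS_resid_eq_0_iff[OF Z])
  then have s: "s2_stat X U y \<noteq> 0" by (simp add: s2_stat_eq[OF Z] u_def)
  have Jm: "J_mat X U y = s2_stat X U y *\<^sub>R W"
    by (simp add: J_mat_def W_def wald_matrix_def)
  show "invertible (J_mat X U y)" unfolding Jm by (rule invertible_scaleR[OF i s])
  have "J_stat X U y = ((L *v y) \<bullet> (((1 / s2_stat X U y) *\<^sub>R matrix_inv W) *v (L *v y))) / real CARD('n)"
    unfolding J_stat_def Let_def L_def wald_root_mult Jm matrix_inv_scaleR[OF i s] ..
  also have "\<dots> = ((L *v y) \<bullet> (matrix_inv W *v (L *v y))) / (u y \<bullet> u y)"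
    unfolding s2_stat_eq[OF Z] u_def by (simp add: scaleR_matrix_vector_assoc[symmetric])
  finally show "J_stat X U y = ((L *v y) \<bullet> (matrix_inv W *v (L *v y))) / (u y \<bullet> u y)" .
qed

lemma wald_root_selector_affine:
  fixes X :: "real^'k^'n" and U :: "real^'m^'n"
  defines "L \<equiv> wald_root (hcat X U) (selector :: real^('k + 'm)^'m)"
  assumes Z: "rank (hcat X U) = CARD('k + 'm)"
  shows "L *v (\<delta> *\<^sub>R y + X *v \<eta>) = \<delta> *\<^sub>R (L *v y)"
proof -
  obtain b where b: "X *v \<eta> = hcat X U *v b" "(selector :: real^('k + 'm)^'m) *v b = 0"
    by (rule fitted_eq_hcat_mult)
  have "L *v (X *v \<eta>) = 0"
    unfolding L_def wald_root_mult b(1) OLS_fitted[OF Z] b(2) ..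
  then show ?thesis by (simp add: matrix_vector_right_distrib matrix_vector_mult_scaleR)
qed

lemma J_stat_affine:
  fixes X :: "real^'k^'n" and U :: "real^'m^'n"
  assumes Z: "rank (hcat X U) = CARD('k + 'm)" and y: "y \<notin> col_space (hcat X U)" and d: "\<delta> \<noteq> 0"
  shows "J_stat X U (\<delta> *\<^sub>R y + X *v \<eta>) = J_stat X U y"
proof -
  obtain b where b: "X *v \<eta> = hcat X U *v b"
    by (rule fitted_eq_hcat_mult)
  have y': "\<delta> *\<^sub>R y + X *v \<eta> \<notin> col_space (hcat X U)"
    unfolding b col_space_affine_iff[OF Z d] by (rule y)
  have u: "OLS_resid (hcat X U) (\<delta> *\<^sub>R y + X *v \<eta>) = \<delta> *\<^sub>R OLS_resid (hcat X U) y"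
    unfolding b by (rule OLS_resid_affine[OF Z])
  show ?thesis
    unfolding J_stat_eq(1)[OF Z y] J_stat_eq(1)[OF Z y'] wald_root_selector_affine[OF Z] u
    using d by (simp add: matrix_vector_mult_scaleR)
qed

lemma continuous_J_stat:
  fixes X :: "real^'k^'n" and U :: "real^'m^'n"
  assumes Z: "rank (hcat X U) = CARD('k + 'm)" and S: "S \<inter> col_space (hcat X U) = {}"
  shows "continuous_on S (J_stat X U)"
proof -
  let ?L = "wald_root (hcat X U) (selector :: real^('k + 'm)^'m)"
  let ?W = "wald_matrix (hcat X U) (selector :: real^('k + 'm)^'m)"
  have nS: "y \<notin> col_space (hcat X U)" if "y \<in> S" for y
    using that S by blast
  then have "OLS_resid (hcat X U) y \<noteq> 0" if "y \<in> S" for y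
    unfolding OLS_resid_eq_0_iff[OF Z] using that by blast
  then have "continuous_on S (\<lambda>y. ((?L *v y) \<bullet> (matrix_inv ?W *v (?L *v y))) /
      (OLS_resid (hcat X U) y \<bullet> OLS_resid (hcat X U) y))"
    by (intro continuous_intros continuous_on_matrix_mult_vec continuous_OLS_resid ballI) auto
  then show ?thesis
    by (rule continuous_on_eq) (rule J_stat_eq(1)[OF Z nS, symmetric])
qed

text \<open>
  \<open>J_stat\<close> is a quotient of a quadratic form in the residuals of \<open>X\<close> and the squared length of the
  residuals of \<open>(X, U)\<close>; the latter is bounded from below by a single direction \<open>v\<close> orthogonal to
  \<open>(X, U)\<close>.
\<close>

lemma J_stat_bounded:
  fixes X :: "real^'k^'n" and U :: "real^'m^'n"
  assumes X: "rank X = CARD('k)" and Z: "rank (hcat X U) = CARD('k + 'm)"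
    and v: "\<And>b. v \<bullet> (hcat X U *v b) = 0" and \<kappa>: "0 < \<kappa>"
  obtains G where "0 \<le> G" "\<And>y. y \<notin> col_space (hcat X U) \<Longrightarrow> OLS_resid X y \<noteq> 0 \<Longrightarrow>
    \<kappa> * norm (OLS_resid X y) \<le> \<bar>v \<bullet> y\<bar> \<Longrightarrow> \<bar>J_stat X U y\<bar> \<le> G"
proof -
  let ?L = "wald_root (hcat X U) (selector :: real^('k + 'm)^'m)"
  let ?W = "wald_matrix (hcat X U) (selector :: real^('k + 'm)^'m)"
  define Q where "Q = transpose ?L ** matrix_inv ?W ** ?L"
  obtain G where G: "0 \<le> G" "\<forall>r. \<bar>r \<bullet> (Q *v r)\<bar> \<le> G * (r \<bullet> r)"
    using quadratic_form_bounded[of Q] by blast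
  show ?thesis
  proof (rule that[of "G * ((norm v)\<^sup>2 / \<kappa>\<^sup>2)"])
    fix y assume y: "y \<notin> col_space (hcat X U)" and nz: "OLS_resid X y \<noteq> 0"
      and vy: "\<kappa> * norm (OLS_resid X y) \<le> \<bar>v \<bullet> y\<bar>"
    let ?r = "OLS_resid X y" and ?u = "OLS_resid (hcat X U) y"
    \<comment> \<open>Subtracting a fitted value of \<open>X\<close> does not change the estimated
      coefficients of \<open>U\<close>, so the numerator depends on \<open>y\<close> only through
      its residual.\<close>
    have "?r = 1 *\<^sub>R y + X *v (- OLS X y)"
      by (simp add: OLS_resid_def linear_neg[OF matrix_vector_mul_linear])
    then have Lr: "?L *v ?r = ?L *v y" using wald_root_selector_affine[OF Z, of 1 y] by simp
    have "(?L *v y) \<bullet> (matrix_inv ?W *v (?L *v y)) = ?r \<bullet> (Q *v ?r)"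
      unfolding Q_def matrix_vector_mul_assoc[symmetric] Lr inner_matrix_vector_transpose[of ?r "transpose ?L"]
      by (simp only: transpose_transpose Lr)
    then have num: "\<bar>(?L *v y) \<bullet> (matrix_inv ?W *v (?L *v y))\<bar> \<le> G * (norm ?r)\<^sup>2"
      using G(2)[rule_format, of ?r] by (simp add: dot_square_norm)
    \<comment> \<open>Because \<open>v\<close> is orthogonal to (X, U), a lower bound on |v . y|
      carries over to the residual of the larger regression.\<close>
    have "v \<bullet> y = v \<bullet> ?u" using v[of "OLS (hcat X U) y"] by (simp add: OLS_resid_def inner_diff_right)
    then have "\<kappa> * norm ?r \<le> norm v * norm ?u"
      using vy Cauchy_Schwarz_ineq2[of v ?u] by simp
    then have "(\<kappa> * norm ?r)\<^sup>2 \<le> (norm v * norm ?u)\<^sup>2" using \<kappa> by (intro power_mono) auto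
    then have den: "(norm ?r)\<^sup>2 \<le> (norm v)\<^sup>2 / \<kappa>\<^sup>2 * (norm ?u)\<^sup>2"
      using \<kappa> by (simp add: field_simps)
    have u: "0 < (norm ?u)\<^sup>2" using y by (simp add: OLS_resid_eq_0_iff[OF Z])
    have "\<bar>J_stat X U y\<bar> = \<bar>(?L *v y) \<bullet> (matrix_inv ?W *v (?L *v y))\<bar> / (norm ?u)\<^sup>2"
      unfolding J_stat_eq(1)[OF Z y] by (simp add: dot_square_norm)
    also have "\<dots> \<le> G * ((norm v)\<^sup>2 / \<kappa>\<^sup>2 * (norm ?u)\<^sup>2) / (norm ?u)\<^sup>2"
      by (intro divide_right_mono order_trans[OF num] mult_left_mono den G(1)) simp
    also have "\<dots> = G * ((norm v)\<^sup>2 / \<kappa>\<^sup>2)" using u by simp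
    finally show "\<bar>J_stat X U y\<bar> \<le> G * ((norm v)\<^sup>2 / \<kappa>\<^sup>2)" .
  qed (use G(1) in simp)
qed

lemma Omega_BV_eq:
  fixes X :: "real^'k^'n::{finite,linorder}"
  shows "Omega_BV X R m1 a abar m3 p = (\<lambda>y. (omega_BV X m1 a abar y *
    exp (c_BV X m1 a abar m3 p y * (cumsum_ratio X y / (real CARD('n))\<^sup>2))) *\<^sub>R wald_matrix X R)"
  by (rule ext) (simp add: Omega_BV_def wald_matrix_def)

lemma Omega_BV_J_eq:
  "Omega_BV_J X U R m1 a abar m3 p = (\<lambda>y. (omega_BV X m1 a abar y *
    exp (c_BV X m1 a abar m3 p y * J_stat X U y)) *\<^sub>R wald_matrix X R)"
  by (rule ext) (simp add: Omega_BV_J_def wald_matrix_def)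

context trend_regression
begin

lemma continuous_cumsum_ratio:
  "continuous_on (- exceptional_set X Z m1 abar) (\<lambda>y. cumsum_ratio X y / (real CARD('n))\<^sup>2)"
  unfolding cumsum_ratio_def
  by (intro continuous_intros continuous_on_matrix_mult_vec continuous_OLS_resid ballI)
     (simp_all add: resid_nz)

lemma cumsum_ratio_affine:
  "\<delta> \<noteq> 0 \<Longrightarrow> cumsum_ratio X (\<delta> *\<^sub>R y + X *v \<eta>) = cumsum_ratio X y"
  unfolding cumsum_ratio_def OLS_resid_affine[OF X] matrix_vector_mult_scaleR by simp

end

section \<open>Rejection probabilities\<close>

text \<open>The coefficient of \<open>\<gamma> ^ l\<close> is, up to a constant, the l-th moment of
  the weights \<open>u\<close> over the positions. These moments link the covariance to the
  polynomial trend columns.\<close>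

lemma trigonometric_sum_taylor:
  fixes u :: "real^'n::{finite,linorder}"
  assumes "0 \<le> \<gamma>"
  shows "norm ((\<Sum>j\<in>UNIV. u $ j *\<^sub>R cis (\<gamma> * real (pos j))) -
      (\<Sum>l\<le>m. (\<i> * of_real \<gamma>) ^ l / fact l * of_real (\<Sum>j\<in>UNIV. u $ j * real (pos j) ^ l)))
    \<le> \<gamma> ^ Suc m * (\<Sum>j\<in>UNIV. \<bar>u $ j\<bar> * real (pos j) ^ Suc m)"
proof -
  define e where "e j = cis (\<gamma> * real (pos j)) - (\<Sum>l\<le>m. (\<i> * of_real (\<gamma> * real (pos j))) ^ l / fact l)" for j :: 'n
  have e: "norm (e j) \<le> \<gamma> ^ Suc m * real (pos j) ^ Suc m" for j
  proof -
    have "norm (e j) \<le> \<bar>\<gamma> * real (pos j)\<bar> ^ Suc m / fact (Suc m)"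
      unfolding e_def cis_conv_exp by (rule iexp_approx1)
    also have "\<dots> \<le> \<bar>\<gamma> * real (pos j)\<bar> ^ Suc m / 1"
      by (intro divide_left_mono fact_ge_1) auto
    finally show ?thesis using assms by (simp add: abs_mult power_mult_distrib mult_ac)
  qed
  have "(\<Sum>l\<le>m. (\<i> * of_real \<gamma>) ^ l / fact l * of_real (\<Sum>j\<in>UNIV. u $ j * real (pos j) ^ l))
     = (\<Sum>l\<le>m. \<Sum>j\<in>UNIV. of_real (u $ j) * ((\<i> * of_real (\<gamma> * real (pos j))) ^ l / fact l))"
    by (intro sum.cong refl) (simp add: sum_distrib_left power_mult_distrib mult_ac)
  also have "\<dots> = (\<Sum>j\<in>UNIV. u $ j *\<^sub>R (\<Sum>l\<le>m. (\<i> * of_real (\<gamma> * real (pos j))) ^ l / fact l))"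
    by (subst sum.swap) (simp add: sum_distrib_left scaleR_conv_of_real)
  finally have "(\<Sum>j\<in>UNIV. u $ j *\<^sub>R cis (\<gamma> * real (pos j))) -
      (\<Sum>l\<le>m. (\<i> * of_real \<gamma>) ^ l / fact l * of_real (\<Sum>j\<in>UNIV. u $ j * real (pos j) ^ l))
     = (\<Sum>j\<in>UNIV. u $ j *\<^sub>R e j)"
    by (simp add: e_def scaleR_diff_right sum_subtractf)
  also have "norm \<dots> \<le> (\<Sum>j\<in>UNIV. \<bar>u $ j\<bar> * (\<gamma> ^ Suc m * real (pos j) ^ Suc m))"
    by (intro order_trans[OF norm_sum] sum_mono) (simp only: norm_scaleR mult_left_mono[OF e] abs_ge_zero)
  also have "\<dots> = \<gamma> ^ Suc m * (\<Sum>j\<in>UNIV. \<bar>u $ j\<bar> * real (pos j) ^ Suc m)"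
    by (simp add: sum_distrib_left mult_ac)
  finally show ?thesis .
qed

text \<open>With k vanishing moments, the expansion up to degree k - 1 is zero and only the
  remainder of order k is left.\<close>

lemma trigonometric_sum_upper:
  fixes u :: "real^'n::{finite,linorder}"
  assumes "1 \<le> k" and mom: "\<And>l. l < k \<Longrightarrow> (\<Sum>j\<in>UNIV. u $ j * real (pos j) ^ l) = 0"
  shows "\<exists>C\<ge>0. \<forall>\<gamma>\<ge>0. norm (\<Sum>j\<in>UNIV. u $ j *\<^sub>R cis (\<gamma> * real (pos j))) \<le> C * \<gamma> ^ k"
proof (intro exI conjI allI impI)
  let ?C = "\<Sum>j\<in>UNIV. \<bar>u $ j\<bar> * real (pos j) ^ k"
  show "0 \<le> ?C" by (intro sum_nonneg) auto
  fix \<gamma> :: real assume g: "0 \<le> \<gamma>"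
  obtain m where k: "k = Suc m" using assms(1) by (cases k) auto
  have "(\<Sum>l\<le>m. (\<i> * of_real \<gamma>) ^ l / fact l * of_real (\<Sum>j\<in>UNIV. u $ j * real (pos j) ^ l)) = (0 :: complex)"
    by (intro sum.neutral) (simp add: mom k del: of_real_sum)
  with trigonometric_sum_taylor[OF g, of u m]
  show "norm (\<Sum>j\<in>UNIV. u $ j *\<^sub>R cis (\<gamma> * real (pos j))) \<le> ?C * \<gamma> ^ k"
    by (simp only: diff_zero k mult.commute)
qed

text \<open>The first nonvanishing moment gives the leading term, which dominates the remainder for
  small \<gamma>.\<close>

lemma trigonometric_sum_lower:
  fixes u :: "real^'n::{finite,linorder}"
  assumes mom: "\<And>l. l < k \<Longrightarrow> (\<Sum>j\<in>UNIV. u $ j * real (pos j) ^ l) = 0"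
    and nz: "(\<Sum>j\<in>UNIV. u $ j * real (pos j) ^ k) \<noteq> 0"
  shows "\<exists>c>0. \<exists>\<gamma>0>0. \<forall>\<gamma>. 0 < \<gamma> \<and> \<gamma> \<le> \<gamma>0 \<longrightarrow>
    c * \<gamma> ^ k \<le> norm (\<Sum>j\<in>UNIV. u $ j *\<^sub>R cis (\<gamma> * real (pos j)))"
proof -
  define \<rho> where "\<rho> = (\<Sum>j\<in>UNIV. u $ j * real (pos j) ^ k)"
  define C where "C = (\<Sum>j\<in>UNIV. \<bar>u $ j\<bar> * real (pos j) ^ Suc k)"
  define c where "c = \<bar>\<rho>\<bar> / fact k / 2"
  have c: "0 < c" using nz by (simp add: c_def \<rho>_def)
  have C: "0 \<le> C" unfolding C_def by (intro sum_nonneg) auto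
  have main: "c * \<gamma> ^ k \<le> norm (\<Sum>j\<in>UNIV. u $ j *\<^sub>R cis (\<gamma> * real (pos j)))"
    \<comment> \<open>\<open>c\<close> is half the coefficient of the leading term. Below the
      threshold c / (C + 1) the remainder takes at most the other half; the 1 guards against C =
      0.\<close>
    if g: "0 < \<gamma>" "\<gamma> \<le> c / (C + 1)" for \<gamma>
  proof -
    let ?s = "\<Sum>j\<in>UNIV. u $ j *\<^sub>R cis (\<gamma> * real (pos j))"
    let ?t = "\<lambda>l. (\<i> * of_real \<gamma>) ^ l / fact l * of_real (\<Sum>j\<in>UNIV. u $ j * real (pos j) ^ l) :: complex"
    have "(\<Sum>l\<le>k. ?t l) = ?t k + (\<Sum>l<k. ?t l)"
      by (simp only: lessThan_Suc_atMost[symmetric] sum.lessThan_Suc add.commute)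
    also have "(\<Sum>l<k. ?t l) = 0"
      by (intro sum.neutral) (simp add: mom del: of_real_sum)
    finally have tk: "(\<Sum>l\<le>k. ?t l) = ?t k" by simp
    have nt: "norm (?t k) = 2 * c * \<gamma> ^ k"
      unfolding \<rho>_def[symmetric] using g
      by (simp add: norm_mult norm_divide norm_power c_def)
    have "norm (?s - ?t k) \<le> \<gamma> ^ Suc k * C"
      using trigonometric_sum_taylor[of \<gamma> u k] g unfolding tk C_def by simp
    moreover have "norm (?t k) - norm (?s - ?t k) \<le> norm ?s"
      using norm_triangle_ineq2[of "?t k" "?t k - ?s"] by (simp add: norm_minus_commute)
    moreover have "\<gamma> ^ Suc k * C \<le> c * \<gamma> ^ k"
    proof -
      have "\<gamma> * C \<le> \<gamma> * (C + 1)" using g by simp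
      also have "\<dots> \<le> c" using g C by (simp add: field_simps)
      finally have "\<gamma> ^ k * (\<gamma> * C) \<le> \<gamma> ^ k * c" using g by (intro mult_left_mono) auto
      then show ?thesis by (simp add: mult_ac)
    qed
    ultimately show ?thesis using nt by linarith
  qed
  have "0 < c / (C + 1)" using c C by (intro divide_pos_pos) auto
  with c main show ?thesis by blast
qed

text \<open>For \<gamma> <= 1 the square is at most \<gamma>, so a threshold linear in the constants
  suffices.\<close>

lemma small_parameter_exists:
  fixes A A' B B' \<gamma>0 :: real
  assumes "0 < \<gamma>0" "0 \<le> A" "0 < B" "0 \<le> A'" "0 < B'"
  shows "\<exists>\<gamma>>0. \<gamma> \<le> 1 \<and> \<gamma> \<le> \<gamma>0 \<and> A * \<gamma>\<^sup>2 \<le> B \<and> A' * \<gamma>\<^sup>2 \<le> B'"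
proof -
  have aux: "A * \<gamma>\<^sup>2 \<le> B" if "0 < \<gamma>" "\<gamma> \<le> 1" "\<gamma> \<le> B / (A + 1)" "0 \<le> A" "0 < B" for A B \<gamma> :: real
  proof -
    have "A * \<gamma>\<^sup>2 \<le> A * \<gamma>" using that by (intro mult_left_mono) (auto simp: power2_eq_square mult_le_cancel_right1)
    also have "\<dots> \<le> (A + 1) * \<gamma>" using that by simp
    also have "\<dots> \<le> B" using that by (simp add: field_simps)
    finally show ?thesis .
  qed
  let ?g = "min (min 1 \<gamma>0) (min (B / (A + 1)) (B' / (A' + 1)))"
  have "0 < B / (A + 1)" "0 < B' / (A' + 1)" using assms by (auto intro!: divide_pos_pos)
  then have "0 < ?g" using assms by simp
  moreover have "?g \<le> 1" "?g \<le> \<gamma>0" "?g \<le> B / (A + 1)" "?g \<le> B' / (A' + 1)" by simp_all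
  ultimately show ?thesis using aux[of ?g B A] aux[of ?g B' A'] assms by blast
qed

lemma moment_eq_inner_column:
  fixes X :: "real^'k::{finite,linorder}^'n::{finite,linorder}"
  assumes "\<And>i. X $ i $ j = real (pos i) ^ (pos j - 1)"
  shows "(\<Sum>i\<in>UNIV. u $ i * real (pos i) ^ (pos j - 1)) = u \<bullet> (X *v axis j 1)"
  by (simp add: matrix_vector_mult_basis column_def inner_vec_def assms)

text \<open>
  Under \<open>spectral_AR2_ext_concentrated\<close> with \<open>\<eta> = \<gamma> ^ (2 * kF)\<close>, directions orthogonal to the trend have
  standard deviation of order \<open>\<gamma> ^ kF\<close>, whereas the component of \<open>R \<beta> - r\<close> belonging to the trend of lowest
  possible degree \<open>l0 < kF\<close> has standard deviation of order \<open>\<gamma> ^ l0\<close>.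
\<close>

lemma sup_rejection_probability_eq_1:
  fixes X :: "real^'k::{finite,linorder}^'n::{finite,linorder}" and R :: "real^'k::_^'q::finite"
    and g crit :: "real^'n::_ \<Rightarrow> real"
  assumes trend: "polynomial_trend X R kF" and R: "rank R = CARD('q)"
    and FF: "spectral_AR2_ext \<subseteq> \<FF>"
    and N: "closed N" "N \<in> null_sets lborel"
    and g: "continuous_on (- N) g" "\<And>y. y \<notin> N \<Longrightarrow> 0 < g y"
    and v: "v \<noteq> 0" "\<And>b. v \<bullet> (X *v b) = 0"
    and growth: "\<And>\<kappa>. 0 < \<kappa> \<Longrightarrow> \<exists>G>0. \<forall>y. y \<notin> N \<longrightarrow>
      \<kappa> * norm (OLS_resid X y) \<le> \<bar>v \<bullet> y\<bar> \<longrightarrow> g y \<le> G * (norm (OLS_resid X y))\<^sup>2"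
    and crit: "crit \<in> borel_measurable borel" "\<And>y. y \<notin> N \<Longrightarrow> crit y \<le> Cmax"
    and \<mu>: "\<mu> \<in> null_means X R r" and \<sigma>2: "0 < \<sigma>2"
  shows "(SUP f\<in>\<FF>. measure (gauss_measure \<mu> (\<sigma>2 *\<^sub>R spectral_cov f))
      {y. F_type_stat R r (OLS X) (\<lambda>y. g y *\<^sub>R wald_matrix X R) N y \<ge> crit y}) = 1"
proof -
  let ?L = "wald_root X R" and ?q = "\<lambda>y. (R *v OLS X y - r) \<bullet> (matrix_inv (wald_matrix X R) *v (R *v OLS X y - r))"
  let ?n = "real CARD('n)"
  define A where "A = {y. F_type_stat R r (OLS X) (\<lambda>y. g y *\<^sub>R wald_matrix X R) N y \<ge> crit y}"
  have X: "rank X = CARD('k)" and kF: "1 \<le> kF" "kF \<le> CARD('k)"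
    and cols: "\<And>i j. pos j \<le> kF \<Longrightarrow> X $ i $ j = real (pos i) ^ (pos j - 1)"
    and exj: "\<exists>j. pos j \<le> kF \<and> column j R \<noteq> 0"
    using trend unfolding polynomial_trend_def by auto
  have T: "F_type_stat R r (OLS X) (\<lambda>y. g y *\<^sub>R wald_matrix X R) N y = (if y \<in> N then 0 else ?q y / g y)" for y
    by (rule F_type_stat_scaled_wald_matrix[OF X R g(2)])
  have Am: "A \<in> sets borel"
  proof -
    have "(\<lambda>y. if y \<in> N then 0 else ?q y / g y) \<in> borel_measurable borel"
      by (intro borel_measurable_continuous_on_if borel_closed N continuous_intros
          continuous_on_matrix_mult_vec continuous_OLS g) (use g(2) in \<open>force\<close>)
    with crit(1) have "{y \<in> space borel. crit y \<le> (if y \<in> N then 0 else ?q y / g y)} \<in> sets borel"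
      by measurable
    then show ?thesis by (simp add: A_def T)
  qed

  obtain \<beta> where \<beta>: "\<mu> = X *v \<beta>" "R *v \<beta> = r" using \<mu> unfolding null_means_def by blast

  text \<open>The lowest degree whose coefficient is restricted.\<close>
  obtain j0 where j0: "pos j0 \<le> kF" "column j0 R \<noteq> 0"
    and min: "\<And>j. pos j < pos j0 \<Longrightarrow> column j R = 0"
  proof -
    let ?P = "\<lambda>j. pos j \<le> kF \<and> column j R \<noteq> 0"
    obtain i where "?P i" using exj by blast
    then obtain j where j: "?P j" "\<And>i. ?P i \<Longrightarrow> pos j \<le> pos i"
      using ex_has_least_nat[of ?P i pos] by blast
    have "column i R = 0" if "pos i < pos j" for i
      using j(2)[of i] that j(1) by auto
    with j(1) show ?thesis by (intro that) auto
  qed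
  obtain s where s: "R $ s $ j0 \<noteq> 0" using j0(2) by (auto simp: vec_eq_iff column_def)
  \<comment> \<open>\<open>a\<close> represents the s-th coordinate of R beta_hat as a functional of
    the data. Its moments below kF are the entries of row s of \<open>R\<close>: zero below degree
    \<open>l0\<close>, nonzero at \<open>l0\<close>.\<close>
  define a where "a = row s ?L"
  have a_mult: "a \<bullet> y = (R *v OLS X y) $ s" for y
    unfolding a_def wald_root_mult[symmetric] by (simp add: matrix_vector_mult_def inner_vec_def row_def)
  have a_col: "a \<bullet> (X *v axis j 1) = R $ s $ j" for j
    unfolding a_mult OLS_fitted[OF X] by (simp add: matrix_vector_mult_basis column_def)
  define l0 where "l0 = pos j0 - 1"
  have pos1: "1 \<le> pos j" "pos j \<le> CARD('k)" for j :: 'k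
    using bij_betw_pos[where 'a='k] by (auto simp: bij_betw_def)
  have l0: "l0 < kF" using j0(1) pos1(1)[of j0] by (simp add: l0_def)
  have degree_col: "\<exists>j :: 'k. pos j = Suc l" if "l < kF" for l
  proof -
    have "Suc l \<in> {1..CARD('k)}" using that kF by auto
    then have "Suc l \<in> range (pos :: 'k \<Rightarrow> nat)" using bij_betw_pos[where 'a='k] by (simp add: bij_betw_def)
    then show ?thesis by auto
  qed
  have mom: "(\<Sum>i\<in>UNIV. u $ i * real (pos i) ^ l) = u \<bullet> (X *v axis j 1)" if "pos j = Suc l" "l < kF" for u j l
    using moment_eq_inner_column[of X j u] cols[of j] that by simp
  have a_low: "(\<Sum>i\<in>UNIV. a $ i * real (pos i) ^ l) = 0" if "l < l0" for l
  proof -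
    from that l0 have l: "l < kF" by (rule less_trans)
    obtain j :: 'k where j: "pos j = Suc l" using degree_col[OF l] by blast
    have "column j R = 0" using min[of j] j that by (simp add: l0_def)
    then have "R $ s $ j = 0" by (simp add: vec_eq_iff column_def)
    then show ?thesis using mom[OF j] a_col[of j] that l0 by simp
  qed
  have a_nz: "(\<Sum>i\<in>UNIV. a $ i * real (pos i) ^ l0) \<noteq> 0"
    using mom[of j0 l0 a] a_col[of j0] s pos1(1)[of j0] l0 by (simp add: l0_def)
  then have a0: "a \<noteq> 0" by auto
  then have aa: "0 < a \<bullet> a" by simp

  obtain c \<gamma>0 where c: "0 < c" and \<gamma>0: "0 < \<gamma>0"
    and lower: "\<And>\<gamma>. 0 < \<gamma> \<Longrightarrow> \<gamma> \<le> \<gamma>0 \<Longrightarrow> c * \<gamma> ^ l0 \<le> norm (\<Sum>j\<in>UNIV. a $ j *\<^sub>R cis (\<gamma> * real (pos j)))"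
    using trigonometric_sum_lower[OF a_low a_nz] by blast
  \<comment> \<open>By self-adjointness \<open>w j\<close> represents the j-th residual. It is
    orthogonal to all columns of \<open>X\<close>, so its first \<open>kF\<close> moments
    vanish.\<close>
  define w where "w j = OLS_resid X (axis j 1)" for j :: 'n
  have w_orth: "w j \<bullet> (X *v b) = 0" for j b
    unfolding w_def inner_commute[of _ "X *v b"] by (rule OLS_resid_orthogonal[OF X])
  have w_resid: "OLS_resid X y $ j = w j \<bullet> y" for j y
    unfolding w_def OLS_resid_self_adjoint[OF X, symmetric] by (simp add: inner_axis')
  have "\<exists>C\<ge>0. \<forall>\<gamma>\<ge>0. norm (\<Sum>i\<in>UNIV. w j $ i *\<^sub>R cis (\<gamma> * real (pos i))) \<le> C * \<gamma> ^ kF" for j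
  proof (rule trigonometric_sum_upper[OF kF(1)])
    fix l assume l: "l < kF"
    then obtain i :: 'k where "pos i = Suc l" using degree_col by blast
    from mom[OF this l] w_orth show "(\<Sum>i\<in>UNIV. w j $ i * real (pos i) ^ l) = 0" by simp
  qed
  then obtain C where C: "\<And>j. 0 \<le> C j"
    "\<And>j \<gamma>. 0 \<le> \<gamma> \<Longrightarrow> norm (\<Sum>i\<in>UNIV. w j $ i *\<^sub>R cis (\<gamma> * real (pos i))) \<le> C j * \<gamma> ^ kF"
    by metis
  \<comment> \<open>\<open>D j\<close> bounds the standard deviation of the j-th residual in units
    of \<sigma> \<gamma>^kF: the trigonometric sum contributes \<open>C j\<close>, the approximation
    error (n + 2) \<eta> the other term.\<close>
  define D where "D j = sqrt ((C j)\<^sup>2 + (?n + 2) * (w j \<bullet> w j))" for j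
  have D0: "0 \<le> D j" for j unfolding D_def by simp
  define Dt where "Dt = (\<Sum>j\<in>UNIV. D j) + 1"
  have Dt: "0 < Dt" unfolding Dt_def using D0 by (intro add_nonneg_pos sum_nonneg) auto

  have close: "\<exists>f\<in>\<FF>. 1 - \<epsilon> \<le> measure (gauss_measure \<mu> (\<sigma>2 *\<^sub>R spectral_cov f)) A" if \<epsilon>: "0 < \<epsilon>" for \<epsilon> :: real
  proof (rule gauss_measure_good_event[OF \<epsilon>, where 'n='n])
    fix K d :: real
    assume Kd: "0 < K" "0 < d"
    assume good: "\<And>(\<mu> :: real^'n::_) B v w N A. \<lbrakk>transpose B = B; \<And>u. u \<noteq> 0 \<Longrightarrow> 0 < u \<bullet> (B *v u); v \<noteq> 0; w \<noteq> 0;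
       N \<in> null_sets lborel; A \<in> sets borel;
       \<And>y. y \<notin> N \<Longrightarrow> (\<And>u. \<bar>u \<bullet> (y - \<mu>)\<bar> \<le> K * sqrt (u \<bullet> (B *v u))) \<Longrightarrow>
         d * sqrt (v \<bullet> (B *v v)) \<le> \<bar>v \<bullet> (y - \<mu>)\<bar> \<Longrightarrow>
         d * sqrt (w \<bullet> (B *v w)) \<le> \<bar>w \<bullet> (y - \<mu>)\<bar> \<Longrightarrow> y \<in> A\<rbrakk>
       \<Longrightarrow> 1 - \<epsilon> \<le> measure (gauss_measure \<mu> B) A"
    \<comment> \<open>Ratio of the lower bound d \<sigma> \<gamma>^kF |v| for |v . y| to the upper
      bound K \<sigma> \<gamma>^kF Dt for the residual norm. The powers of \<gamma> cancel, so
      \<open>G\<close> can be fixed before \<gamma>.\<close>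
    define \<kappa> where "\<kappa> = d * norm v / (K * Dt)"
    have \<kappa>: "0 < \<kappa>" using Kd Dt v(1) by (simp add: \<kappa>_def)
    obtain G where G: "0 < G"
      "\<And>y. y \<notin> N \<Longrightarrow> \<kappa> * norm (OLS_resid X y) \<le> \<bar>v \<bullet> y\<bar> \<Longrightarrow> g y \<le> G * (norm (OLS_resid X y))\<^sup>2"
      using growth[OF \<kappa>] by blast
    \<comment> \<open>Ratio of the constants in the lower bound for the numerator of the statistic
      and the upper bound for \<open>g\<close>. On the good event the statistic is at least P
      \<gamma>^(2 l0 - 2 kF); \<sigma>^2 cancels.\<close>
    define P where "P = (d\<^sup>2 * c\<^sup>2 / 2 / (a \<bullet> a)) / (G * (K * Dt)\<^sup>2)"
    have P: "0 < P" unfolding P_def using Kd c aa G Dt by simp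
    \<comment> \<open>The fourth condition keeps the approximation error below half of the variance
      of \<open>a\<close>; the fifth makes the final lower bound exceed the critical value.\<close>
    obtain \<gamma> where \<gamma>: "0 < \<gamma>" "\<gamma> \<le> 1" "\<gamma> \<le> \<gamma>0" "(?n + 2) * (a \<bullet> a) * \<gamma>\<^sup>2 \<le> c\<^sup>2 / 2" "(\<bar>Cmax\<bar> + 1) * \<gamma>\<^sup>2 \<le> P"
      using small_parameter_exists[OF \<gamma>0, of "(?n + 2) * (a \<bullet> a)" "c\<^sup>2 / 2" "\<bar>Cmax\<bar> + 1" P] aa c P by auto
    define \<eta> where "\<eta> = \<gamma> ^ (2 * kF)"
    have \<eta>: "0 < \<eta>" "\<eta> \<le> 1" using \<gamma> by (auto simp: \<eta>_def power_le_one)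
    have \<gamma>pi: "\<gamma> < pi" using \<gamma>(2) pi_gt3 by linarith
    obtain f where f: "f \<in> spectral_AR2_ext"
      and sym: "transpose (spectral_cov f) = (spectral_cov f :: real^'n::_^'n::_)"
      and ge: "\<And>u :: real^'n::_. \<eta> * (u \<bullet> u) \<le> u \<bullet> (spectral_cov f *v u)"
      and app: "\<And>u :: real^'n::_.
        \<bar>u \<bullet> (spectral_cov f *v u) - (norm (\<Sum>j\<in>UNIV. u $ j *\<^sub>R cis (\<gamma> * real (pos j))))\<^sup>2\<bar>
          \<le> (?n + 2) * \<eta> * (u \<bullet> u)"
      by (rule spectral_AR2_ext_concentrated[OF \<gamma>(1) \<gamma>pi \<eta>, where 'n='n]) (rule that)
    define \<sigma> where "\<sigma> = sqrt \<sigma>2"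
    have \<sigma>: "0 < \<sigma>" "\<sigma>\<^sup>2 = \<sigma>2" using \<sigma>2 by (auto simp: \<sigma>_def)
    define B :: "real^'n::_^'n::_" where "B = \<sigma>2 *\<^sub>R spectral_cov f"
    have Buu: "u \<bullet> (B *v u) = \<sigma>2 * (u \<bullet> (spectral_cov f *v u))" for u
      by (simp add: B_def scaleR_matrix_vector_assoc[symmetric])
    have w_sd: "sqrt (w j \<bullet> (B *v w j)) \<le> \<sigma> * \<gamma> ^ kF * D j" for j
    proof -
      have t: "(norm (\<Sum>i\<in>UNIV. w j $ i *\<^sub>R cis (\<gamma> * real (pos i))))\<^sup>2 \<le> (C j * \<gamma> ^ kF)\<^sup>2"
        using C(2)[of \<gamma> j] \<gamma>(1) by (intro power_mono) auto
      have "w j \<bullet> (spectral_cov f *v w j) \<le> (C j * \<gamma> ^ kF)\<^sup>2 + (?n + 2) * \<eta> * (w j \<bullet> w j)"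
        using app[of "w j"] t by linarith
      also have "\<dots> = (\<gamma> ^ kF)\<^sup>2 * (D j)\<^sup>2"
        by (simp add: D_def \<eta>_def power_mult_distrib algebra_simps flip: power_mult)
      finally have "w j \<bullet> (B *v w j) \<le> \<sigma>2 * ((\<gamma> ^ kF)\<^sup>2 * (D j)\<^sup>2)"
        unfolding Buu using \<sigma>2 by (intro mult_left_mono) auto
      also have "\<dots> = (\<sigma> * \<gamma> ^ kF * D j)\<^sup>2" by (simp add: \<sigma>(2)[symmetric] power_mult_distrib mult_ac)
      finally have "sqrt (w j \<bullet> (B *v w j)) \<le> \<bar>\<sigma> * \<gamma> ^ kF * D j\<bar>"
        using real_sqrt_le_mono by fastforce
      then show ?thesis using \<sigma>(1) \<gamma>(1) D0[of j] by simp
    qed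
    have v_sd: "\<sigma> * \<gamma> ^ kF * norm v \<le> sqrt (v \<bullet> (B *v v))"
    proof -
      have "(\<sigma> * \<gamma> ^ kF * norm v)\<^sup>2 = \<sigma>2 * (\<eta> * (v \<bullet> v))"
        by (simp add: \<sigma>(2)[symmetric] \<eta>_def power_mult_distrib dot_square_norm mult.commute[of 2] power_mult)
      also have "\<dots> \<le> v \<bullet> (B *v v)" unfolding Buu using \<sigma>2 by (intro mult_left_mono ge) auto
      finally show ?thesis by (rule real_le_rsqrt)
    qed
    have a_var: "\<sigma>2 * ((\<gamma> ^ l0)\<^sup>2 * (c\<^sup>2 / 2)) \<le> a \<bullet> (B *v a)"
    proof -
      have t: "(c * \<gamma> ^ l0)\<^sup>2 \<le> (norm (\<Sum>j\<in>UNIV. a $ j *\<^sub>R cis (\<gamma> * real (pos j))))\<^sup>2"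
        using lower[OF \<gamma>(1,3)] c \<gamma>(1) by (intro power_mono) auto
      \<comment> \<open>As l0 + 1 <= kF, the noise is smaller than the variance of \<open>a\<close>
        by at least the order \<gamma>^2.\<close>
      have "\<eta> \<le> (\<gamma> ^ l0)\<^sup>2 * \<gamma>\<^sup>2"
      proof -
        have "\<gamma> ^ (2 * kF) \<le> \<gamma> ^ (2 * Suc l0)" using \<gamma> l0 by (intro power_decreasing) auto
        also have "\<dots> = (\<gamma> ^ l0)\<^sup>2 * \<gamma>\<^sup>2"
          by (simp only: power_mult[symmetric] power_add[symmetric]) (simp add: algebra_simps)
        finally show ?thesis by (simp only: \<eta>_def)
      qed
      then have "(?n + 2) * \<eta> * (a \<bullet> a) \<le> (?n + 2) * ((\<gamma> ^ l0)\<^sup>2 * \<gamma>\<^sup>2) * (a \<bullet> a)"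
        using aa by (intro mult_right_mono mult_left_mono) auto
      also have "\<dots> = (\<gamma> ^ l0)\<^sup>2 * ((?n + 2) * (a \<bullet> a) * \<gamma>\<^sup>2)" by (simp only: mult_ac)
      also have "\<dots> \<le> (\<gamma> ^ l0)\<^sup>2 * (c\<^sup>2 / 2)" using \<gamma>(4) by (intro mult_left_mono) auto
      finally have "(?n + 2) * \<eta> * (a \<bullet> a) \<le> (\<gamma> ^ l0)\<^sup>2 * (c\<^sup>2 / 2)" .
      moreover have "(c * \<gamma> ^ l0)\<^sup>2 = (\<gamma> ^ l0)\<^sup>2 * (c\<^sup>2 / 2) + (\<gamma> ^ l0)\<^sup>2 * (c\<^sup>2 / 2)"
        by (simp add: power_mult_distrib)
      ultimately have "(\<gamma> ^ l0)\<^sup>2 * (c\<^sup>2 / 2) \<le> a \<bullet> (spectral_cov f *v a)"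
        using app[of a] t by linarith
      then show ?thesis unfolding Buu using \<sigma>2 by (intro mult_left_mono) auto
    qed
    have "1 - \<epsilon> \<le> measure (gauss_measure \<mu> B) A"
    proof (rule good[OF _ _ v(1) a0 N(2) Am])
      show "transpose B = B" by (simp add: B_def transpose_scalar sym)
      show "0 < u \<bullet> (B *v u)" if "u \<noteq> 0" for u
        unfolding Buu using \<sigma>2 \<eta>(1) ge[of u] that
        by (intro mult_pos_pos) (auto intro: less_le_trans[rotated])
      fix y assume yN: "y \<notin> N" and bound: "\<And>u. \<bar>u \<bullet> (y - \<mu>)\<bar> \<le> K * sqrt (u \<bullet> (B *v u))"
        and vy: "d * sqrt (v \<bullet> (B *v v)) \<le> \<bar>v \<bullet> (y - \<mu>)\<bar>"
        and ay: "d * sqrt (a \<bullet> (B *v a)) \<le> \<bar>a \<bullet> (y - \<mu>)\<bar>"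
      \<comment> \<open>The mean lies in the column space of \<open>X\<close>, so the residuals are
        already centred.\<close>
      have "\<bar>OLS_resid X y $ j\<bar> \<le> K * (\<sigma> * \<gamma> ^ kF * D j)" for j
      proof -
        have "OLS_resid X y $ j = w j \<bullet> (y - \<mu>)"
          unfolding w_resid \<beta>(1) by (simp add: inner_diff_right w_orth)
        then have "\<bar>OLS_resid X y $ j\<bar> \<le> K * sqrt (w j \<bullet> (B *v w j))" using bound by simp
        also have "\<dots> \<le> K * (\<sigma> * \<gamma> ^ kF * D j)" using Kd(1) by (intro mult_left_mono w_sd) simp
        finally show ?thesis .
      qed
      then have "norm (OLS_resid X y) \<le> (\<Sum>j\<in>UNIV. K * (\<sigma> * \<gamma> ^ kF * D j))"
        by (intro order_trans[OF norm_le_l1_cart] sum_mono)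
      also have "\<dots> = K * (\<sigma> * \<gamma> ^ kF) * (\<Sum>j\<in>UNIV. D j)"
        unfolding sum_distrib_left by (simp only: mult.assoc)
      also have "\<dots> \<le> K * (\<sigma> * \<gamma> ^ kF) * Dt"
        using Kd(1) \<sigma>(1) \<gamma>(1) by (intro mult_left_mono) (auto simp: Dt_def)
      finally have res: "norm (OLS_resid X y) \<le> K * (\<sigma> * \<gamma> ^ kF) * Dt" .
      have "\<kappa> * norm (OLS_resid X y) \<le> \<kappa> * (K * (\<sigma> * \<gamma> ^ kF) * Dt)"
        using \<kappa> res by (intro mult_left_mono) auto
      also have "\<dots> = d * (\<sigma> * \<gamma> ^ kF * norm v)" using Kd Dt by (simp add: \<kappa>_def)
      also have "\<dots> \<le> d * sqrt (v \<bullet> (B *v v))" using Kd by (intro mult_left_mono v_sd) auto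
      also have "\<dots> \<le> \<bar>v \<bullet> y\<bar>" using vy by (simp add: inner_diff_right \<beta>(1) v(2))
      finally have gy: "g y \<le> G * (norm (OLS_resid X y))\<^sup>2" by (rule G(2)[OF yN])
      also have "\<dots> \<le> G * (K * (\<sigma> * \<gamma> ^ kF) * Dt)\<^sup>2"
        using G(1) res by (intro mult_left_mono power_mono) auto
      also have "\<dots> = \<sigma>2 * (\<gamma> ^ kF)\<^sup>2 * (G * (K * Dt)\<^sup>2)"
        by (simp add: \<sigma>(2)[symmetric] power_mult_distrib mult_ac)
      finally have gy: "g y \<le> \<sigma>2 * (\<gamma> ^ kF)\<^sup>2 * (G * (K * Dt)\<^sup>2)" .
      have xs: "(R *v OLS X y - r) $ s = a \<bullet> (y - \<mu>)"
        by (simp add: inner_diff_right a_mult \<beta> OLS_fitted[OF X])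
      have "d\<^sup>2 * (\<sigma>2 * ((\<gamma> ^ l0)\<^sup>2 * (c\<^sup>2 / 2))) \<le> d\<^sup>2 * (a \<bullet> (B *v a))"
        by (intro mult_left_mono a_var) auto
      also have "\<dots> = (d * sqrt (a \<bullet> (B *v a)))\<^sup>2"
      proof -
        have "0 \<le> a \<bullet> (B *v a)" using a_var \<sigma>2 by (smt (verit) mult_nonneg_nonneg zero_le_power2 divide_nonneg_nonneg)
        then show ?thesis by (simp add: power_mult_distrib)
      qed
      also have "\<dots> \<le> ((R *v OLS X y - r) $ s)\<^sup>2"
        unfolding xs abs_le_square_iff[symmetric]
        using ay Kd(2) a_var \<sigma>2 by (smt (verit) abs_ge_self abs_of_nonneg mult_nonneg_nonneg real_sqrt_ge_zero zero_le_power2 divide_nonneg_nonneg)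
      also have "\<dots> \<le> (a \<bullet> a) * ?q y"
        unfolding a_def by (rule wald_matrix_quadratic_form_ge[OF X R])
      finally have q: "d\<^sup>2 * (\<sigma>2 * ((\<gamma> ^ l0)\<^sup>2 * (c\<^sup>2 / 2))) / (a \<bullet> a) \<le> ?q y"
        using aa by (simp add: divide_le_eq mult.commute)
      have "(\<bar>Cmax\<bar> + 1) * (\<gamma> ^ kF)\<^sup>2 \<le> P * (\<gamma> ^ l0)\<^sup>2"
      proof -
        \<comment> \<open>The gap of at least one degree between \<open>l0\<close> and
          \<open>kF\<close> leaves a spare factor \<gamma>^2 to absorb the critical value.\<close>
        have "(\<gamma> ^ kF)\<^sup>2 \<le> (\<gamma> ^ Suc l0)\<^sup>2"
          using \<gamma> l0 by (intro power_mono power_decreasing) auto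
        then have "(\<bar>Cmax\<bar> + 1) * (\<gamma> ^ kF)\<^sup>2 \<le> (\<bar>Cmax\<bar> + 1) * (\<gamma> ^ Suc l0)\<^sup>2"
          by (intro mult_left_mono) auto
        also have "\<dots> = (\<bar>Cmax\<bar> + 1) * \<gamma>\<^sup>2 * (\<gamma> ^ l0)\<^sup>2"
          by (simp only: power_Suc power_mult_distrib mult.assoc)
        also have "\<dots> \<le> P * (\<gamma> ^ l0)\<^sup>2" using \<gamma>(5) by (intro mult_right_mono) auto
        finally show ?thesis .
      qed
      then have "(\<bar>Cmax\<bar> + 1) * (\<gamma> ^ kF)\<^sup>2 * (\<sigma>2 * (G * (K * Dt)\<^sup>2)) \<le> P * (\<gamma> ^ l0)\<^sup>2 * (\<sigma>2 * (G * (K * Dt)\<^sup>2))"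
        using \<sigma>2 G(1) by (intro mult_right_mono) auto
      also have "\<dots> = d\<^sup>2 * (\<sigma>2 * ((\<gamma> ^ l0)\<^sup>2 * (c\<^sup>2 / 2))) / (a \<bullet> a)"
        unfolding P_def using G(1) Kd Dt aa by (simp add: field_simps)
      finally have "(\<bar>Cmax\<bar> + 1) * (\<gamma> ^ kF)\<^sup>2 * (\<sigma>2 * (G * (K * Dt)\<^sup>2)) \<le> ?q y" using q by linarith
      moreover have "(\<bar>Cmax\<bar> + 1) * g y \<le> (\<bar>Cmax\<bar> + 1) * (\<sigma>2 * (\<gamma> ^ kF)\<^sup>2 * (G * (K * Dt)\<^sup>2))"
        using gy by (intro mult_left_mono) auto
      ultimately have "(\<bar>Cmax\<bar> + 1) * g y \<le> ?q y" by (simp only: mult_ac)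
      then have "\<bar>Cmax\<bar> + 1 \<le> ?q y / g y" using g(2)[OF yN] by (simp add: le_divide_eq)
      then have "crit y \<le> ?q y / g y" using crit(2)[OF yN] by linarith
      then show "y \<in> A" using yN by (simp add: A_def T)
    qed
    then show ?thesis using f FF unfolding B_def by blast
  qed

  have ne: "\<FF> \<noteq> {}" using close[of 1] by auto
  have bdd: "bdd_above ((\<lambda>f. measure (gauss_measure \<mu> (\<sigma>2 *\<^sub>R spectral_cov f)) A) ` \<FF>)"
    by (auto intro!: bdd_aboveI2[where M=1] measure_gauss_measure_le_1)
  have "(SUP f\<in>\<FF>. measure (gauss_measure \<mu> (\<sigma>2 *\<^sub>R spectral_cov f)) A) = 1"
  proof (rule antisym)
    show "(SUP f\<in>\<FF>. measure (gauss_measure \<mu> (\<sigma>2 *\<^sub>R spectral_cov f)) A) \<le> 1"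
      by (rule cSUP_least[OF ne measure_gauss_measure_le_1])
    show "1 \<le> (SUP f\<in>\<FF>. measure (gauss_measure \<mu> (\<sigma>2 *\<^sub>R spectral_cov f)) A)"
    proof (rule field_le_epsilon)
      fix \<epsilon> :: real assume "0 < \<epsilon>"
      then obtain f where "f \<in> \<FF>" "1 - \<epsilon> \<le> measure (gauss_measure \<mu> (\<sigma>2 *\<^sub>R spectral_cov f)) A"
        using close by blast
      then have "1 - \<epsilon> \<le> (SUP f\<in>\<FF>. measure (gauss_measure \<mu> (\<sigma>2 *\<^sub>R spectral_cov f)) A)"
        by (intro cSUP_upper2[OF bdd])
      then show "1 \<le> (SUP f\<in>\<FF>. measure (gauss_measure \<mu> (\<sigma>2 *\<^sub>R spectral_cov f)) A) + \<epsilon>" by simp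
    qed
  qed
  then show ?thesis unfolding A_def .
qed

text \<open>Thresholding gives a bounded bandwidth, so the critical value and \<open>c_BV\<close>
  are bounded. A bound on the exponent \<open>e\<close> on the event for \<open>v\<close> then makes
  the scalar factor at most a constant times the squared residual norm.\<close>

lemma exp_factor_results:
  fixes X :: "real^'k::{finite,linorder}^'n::{finite,linorder}" and Z :: "real^'l^'n::_"
    and R :: "real^'k::_^'q::finite" and e :: "real^'n::_ \<Rightarrow> real"
    and m1 m2 m3 :: nat and a abar h p :: "nat \<Rightarrow> real"
  defines "N \<equiv> exceptional_set X Z m1 abar"
    and "\<Omega> \<equiv> \<lambda>y. (omega_BV X m1 a abar y * exp (c_BV X m1 a abar m3 p y * e y)) *\<^sub>R wald_matrix X R"
  assumes reg: "trend_regression X Z j1" and trend: "polynomial_trend X R kF" and R: "rank R = CARD('q)"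
    and FF: "spectral_AR2_ext \<subseteq> \<FF>" and a: "\<forall>i\<in>{0..m1}. a i > 0"
    and D: "- N \<subseteq> D" and e: "continuous_on (- N) e"
      "\<And>y \<delta> \<eta>. y \<notin> N \<Longrightarrow> \<delta> \<noteq> 0 \<Longrightarrow> e (\<delta> *\<^sub>R y + X *v \<eta>) = e y"
    and v: "v \<noteq> 0" "\<And>b. v \<bullet> (X *v b) = 0"
    and bounded: "\<And>\<kappa>. 0 < \<kappa> \<Longrightarrow> \<exists>E. \<forall>y. y \<notin> N \<longrightarrow>
      \<kappa> * norm (OLS_resid X y) \<le> \<bar>v \<bullet> y\<bar> \<longrightarrow> \<bar>e y\<bar> \<le> E"
  shows "estimator_conditions X D (OLS X) \<Omega> N \<and>
    (\<forall>\<mu>0 \<in> null_means X R r. \<forall>\<sigma>2 > 0.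
      (SUP f\<in>\<FF>. measure (gauss_measure \<mu>0 (\<sigma>2 *\<^sub>R spectral_cov f))
        {y. F_type_stat R r (OLS X) \<Omega> N y \<ge> C_BV X m1 a abar m2 h C0 y}) = 1)"
proof (intro conjI ballI allI impI)
  interpret trend_regression X Z j1 by fact
  show "estimator_conditions X D (OLS X) \<Omega> N"
    unfolding N_def \<Omega>_def
    by (rule exp_factor_estimator_conditions[where e=e, OF reg R D[unfolded N_def] e[unfolded N_def]])
  define S where "S = (\<Sum>i=0..m1. a i)"
  define pm where "pm = (\<Sum>i=0..m3. \<bar>p i\<bar> * S ^ i)"
  have S: "0 \<le> S" unfolding S_def using a by (intro sum_nonneg) (auto simp: less_imp_le)
  have pm0: "0 \<le> pm" unfolding pm_def using S by (intro sum_nonneg) auto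
  have b: "0 \<le> b_BV X m1 a abar y" "b_BV X m1 a abar y \<le> S" for y
    using b_BV_bounds[OF a, of X abar y] by (auto simp: S_def)
  have pm: "\<bar>c_BV X m1 a abar m3 p y\<bar> \<le> pm" for y
    unfolding c_BV_def pm_def by (rule abs_polynomial_le[OF b])
  let ?g = "\<lambda>y. omega_BV X m1 a abar y * exp (c_BV X m1 a abar m3 p y * e y)"
  fix \<mu>0 and \<sigma>2 :: real assume \<mu>0: "\<mu>0 \<in> null_means X R r" and \<sigma>2: "0 < \<sigma>2"
  show "(SUP f\<in>\<FF>. measure (gauss_measure \<mu>0 (\<sigma>2 *\<^sub>R spectral_cov f))
        {y. F_type_stat R r (OLS X) \<Omega> N y \<ge> C_BV X m1 a abar m2 h C0 y}) = 1"
    unfolding \<Omega>_def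
  proof (rule sup_rejection_probability_eq_1[OF trend R FF _ _ _ _ v _ borel_measurable_C_BV _ \<mu>0 \<sigma>2])
    show "closed N" "N \<in> null_sets lborel"
      unfolding N_def by (rule exceptional_set_closed exceptional_set_null)+
    show "continuous_on (- N) ?g"
      by (intro continuous_intros e(1)) (unfold N_def, rule continuous_omega_BV, rule continuous_c_BV)
    show "0 < ?g y" if "y \<notin> N" for y
      using omega_BV_pos[OF resid_nz[OF that[unfolded N_def]], of m1 a abar] by simp
    show "C_BV X m1 a abar m2 h C0 y \<le> (\<Sum>i=0..m2. \<bar>h i\<bar> * S ^ i)" if "y \<notin> N" for y
    proof -
      have "y \<notin> col_space X"
        using resid_nz[OF that[unfolded N_def]] by (simp add: OLS_resid_eq_0_iff[OF X])
      moreover have "\<bar>\<Sum>i=0..m2. h i * b_BV X m1 a abar y ^ i\<bar> \<le> (\<Sum>i=0..m2. \<bar>h i\<bar> * S ^ i)"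
        by (rule abs_polynomial_le[OF b])
      ultimately show ?thesis by (simp add: C_BV_def abs_le_iff)
    qed
    fix \<kappa> :: real assume "0 < \<kappa>"
    then obtain E where E: "\<And>y. y \<notin> N \<Longrightarrow> \<kappa> * norm (OLS_resid X y) \<le> \<bar>v \<bullet> y\<bar> \<Longrightarrow> \<bar>e y\<bar> \<le> E"
      using bounded by blast
    have "?g y \<le> exp (pm * E) * (norm (OLS_resid X y))\<^sup>2"
      if y: "y \<notin> N" "\<kappa> * norm (OLS_resid X y) \<le> \<bar>v \<bullet> y\<bar>" for y
    proof -
      have "c_BV X m1 a abar m3 p y * e y \<le> \<bar>c_BV X m1 a abar m3 p y\<bar> * \<bar>e y\<bar>"
        by (metis abs_ge_self abs_mult)
      also have "\<dots> \<le> pm * E" by (intro mult_mono pm E y pm0) auto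
      finally have "exp (c_BV X m1 a abar m3 p y * e y) \<le> exp (pm * E)" by simp
      moreover have "omega_BV X m1 a abar y \<le> (norm (OLS_resid X y))\<^sup>2"
        using omega_BV_le[of X m1 a abar y] by (simp add: dot_square_norm)
      ultimately have "?g y \<le> (norm (OLS_resid X y))\<^sup>2 * exp (pm * E)"
        by (intro mult_mono) auto
      then show ?thesis by (simp add: mult.commute)
    qed
    then show "\<exists>G>0. \<forall>y. y \<notin> N \<longrightarrow> \<kappa> * norm (OLS_resid X y) \<le> \<bar>v \<bullet> y\<bar> \<longrightarrow>
        ?g y \<le> G * (norm (OLS_resid X y))\<^sup>2"
      by (intro exI[of _ "exp (pm * E)"]) auto
  qed
qed

theorem corollary5p10:
  fixes X :: "real^'k::{finite,linorder}^'n::{finite,linorder}"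
    and R :: "real^'k::{finite,linorder}^'q::finite"
    and r :: "real^'q::finite"
    and U :: "real^'m::finite^'n::{finite,linorder}"
    and \<FF> :: "(real \<Rightarrow> real) set"
    and kF m1 m2 m3 :: nat
    and a abar h p :: "nat \<Rightarrow> real"
    and C0 :: real
  assumes k_less_n: "CARD('k) < CARD('n)"
    and rank_X: "rank X = CARD('k)"
    and rank_R: "rank R = CARD('q)"
    and F_all: "\<FF> \<subseteq> spectral_all"
    and F_AR2_ext: "spectral_AR2_ext \<subseteq> \<FF>"
    and trend: "polynomial_trend X R kF"
    and a_pos: "\<forall>i\<in>{0..m1}. a i > 0"
    and h_nz: "h m2 \<noteq> 0"
    and p_nz: "p m3 \<noteq> 0"
  shows
    "(estimator_conditions X (dom_BV X) (OLS X) (Omega_BV X R m1 a abar m3 p) (N_BV X m1 abar) \<and>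
      (\<forall>\<mu>0 \<in> null_means X R r. \<forall>\<sigma>2 > 0.
         (SUP f\<in>\<FF>. measure (gauss_measure \<mu>0 (\<sigma>2 *\<^sub>R spectral_cov f))
            {y. F_type_stat R r (OLS X) (Omega_BV X R m1 a abar m3 p) (N_BV X m1 abar) y
                \<ge> C_BV X m1 a abar m2 h C0 y}) = 1)) \<and>
     (rank (hcat X U) = CARD('k) + CARD('m) \<and> CARD('k) + CARD('m) < CARD('n) \<longrightarrow>
      estimator_conditions X (dom_BV_J X U) (OLS X) (Omega_BV_J X U R m1 a abar m3 p)
        (N_BV_U X U m1 abar) \<and>
      (\<forall>\<mu>0 \<in> null_means X R r. \<forall>\<sigma>2 > 0.
         (SUP f\<in>\<FF>. measure (gauss_measure \<mu>0 (\<sigma>2 *\<^sub>R spectral_cov f))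
            {y. F_type_stat R r (OLS X) (Omega_BV_J X U R m1 a abar m3 p) (N_BV_U X U m1 abar) y
                \<ge> C_BV X m1 a abar m2 h C0 y}) = 1))"
proof (rule conjI[OF _ impI])
  \<comment> \<open>The first trend column has exponent 0 and is therefore constant, which makes the
    denominator of \<open>rho_hat\<close> positive off the column space.\<close>
  have "1 \<in> {1..CARD('k)}" by (simp add: Suc_le_eq)
  then have "1 \<in> range (pos :: 'k \<Rightarrow> nat)" using bij_betw_pos[where 'a='k] by (simp add: bij_betw_def)
  then obtain j1 :: 'k where j1: "pos j1 = 1" by (auto simp del: One_nat_def)
  have const: "X $ i $ j1 = 1" for i
    using trend j1 by (simp add: polynomial_trend_def)
  note gram = gram_invertible[OF rank_X]
  have denom: "rho_denom X y \<noteq> 0" if "OLS_resid X y \<noteq> 0" for y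
    using rho_denom_pos[OF rank_X const, of y] that by (simp add: OLS_resid_eq_0_iff[OF rank_X])

  interpret x: trend_regression X X j1
    by unfold_locales (use rank_X const k_less_n in \<open>auto simp: matrix_vector_mult_in_columnspace\<close>)
  obtain v where v: "v \<noteq> 0" "\<And>b. v \<bullet> (X *v b) = 0"
    by (rule ex_orthogonal_col_space[OF k_less_n]) (rule that)
  show "estimator_conditions X (dom_BV X) (OLS X) (Omega_BV X R m1 a abar m3 p) (N_BV X m1 abar) \<and>
      (\<forall>\<mu>0 \<in> null_means X R r. \<forall>\<sigma>2 > 0.
         (SUP f\<in>\<FF>. measure (gauss_measure \<mu>0 (\<sigma>2 *\<^sub>R spectral_cov f))
            {y. F_type_stat R r (OLS X) (Omega_BV X R m1 a abar m3 p) (N_BV X m1 abar) y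
                \<ge> C_BV X m1 a abar m2 h C0 y}) = 1)"
    unfolding N_BV_eq Omega_BV_eq
  proof (rule exp_factor_results[OF x.trend_regression_axioms trend rank_R F_AR2_ext a_pos _
        x.continuous_cumsum_ratio _ v])
    show "- exceptional_set X X m1 abar \<subseteq> dom_BV X"
      using gram x.resid_nz denom by (auto simp: dom_BV_def)
    show "cumsum_ratio X (\<delta> *\<^sub>R y + X *v \<eta>) / (real CARD('n))\<^sup>2 = cumsum_ratio X y / (real CARD('n))\<^sup>2"
      if "\<delta> \<noteq> 0" for y \<delta> \<eta>
      by (simp add: x.cumsum_ratio_affine[OF that])
    show "\<exists>E. \<forall>y. y \<notin> exceptional_set X X m1 abar \<longrightarrow> \<kappa> * norm (OLS_resid X y) \<le> \<bar>v \<bullet> y\<bar> \<longrightarrow>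
        \<bar>cumsum_ratio X y / (real CARD('n))\<^sup>2\<bar> \<le> E" for \<kappa>
      using abs_cumsum_ratio_le[OF x.resid_nz] by blast
  qed

  assume "rank (hcat X U) = CARD('k) + CARD('m) \<and> CARD('k) + CARD('m) < CARD('n)"
  then have Z: "rank (hcat X U) = CARD('k + 'm)" and less: "CARD('k + 'm) < CARD('n)" by simp_all
  have sub: "X *v \<eta> \<in> col_space (hcat X U)" for \<eta>
    by (rule fitted_eq_hcat_mult[of X \<eta> U]) (simp add: matrix_vector_mult_in_columnspace)
  interpret z: trend_regression X "hcat X U" j1
    by unfold_locales (use rank_X Z const less sub in auto)
  let ?N = "exceptional_set X (hcat X U) m1 abar"
  have N: "y \<notin> col_space (hcat X U)" if "y \<notin> ?N" for y
    using col_space_subset_exceptional_set[OF that] .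
  \<comment> \<open>This direction must be orthogonal to \<open>U\<close> as well as to
    \<open>X\<close>, since it has to bound the residual of the extended regression in
    \<open>J_stat\<close>.\<close>
  obtain w where w: "w \<noteq> 0" "\<And>b. w \<bullet> (hcat X U *v b) = 0"
    by (rule ex_orthogonal_col_space[OF less]) (rule that)
  have wX: "w \<bullet> (X *v b) = 0" for b
    by (rule fitted_eq_hcat_mult[of X b U]) (simp add: w(2))
  show "estimator_conditions X (dom_BV_J X U) (OLS X) (Omega_BV_J X U R m1 a abar m3 p)
        (N_BV_U X U m1 abar) \<and>
      (\<forall>\<mu>0 \<in> null_means X R r. \<forall>\<sigma>2 > 0.
         (SUP f\<in>\<FF>. measure (gauss_measure \<mu>0 (\<sigma>2 *\<^sub>R spectral_cov f))
            {y. F_type_stat R r (OLS X) (Omega_BV_J X U R m1 a abar m3 p) (N_BV_U X U m1 abar) y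
                \<ge> C_BV X m1 a abar m2 h C0 y}) = 1)"
    unfolding N_BV_U_eq Omega_BV_J_eq
  proof (rule exp_factor_results[OF z.trend_regression_axioms trend rank_R F_AR2_ext a_pos _ _ _ w(1) wX])
    show "- ?N \<subseteq> dom_BV_J X U"
      using gram gram_invertible[OF Z] z.resid_nz denom J_stat_eq(2)[OF Z N] by (auto simp: dom_BV_J_def)
    show "continuous_on (- ?N) (J_stat X U)"
      by (rule continuous_J_stat[OF Z]) (use N in blast)
    show "J_stat X U (\<delta> *\<^sub>R y + X *v \<eta>) = J_stat X U y" if "y \<notin> ?N" "\<delta> \<noteq> 0" for y \<delta> \<eta>
      by (rule J_stat_affine[OF Z N[OF that(1)] that(2)])
    fix \<kappa> :: real assume \<kappa>: "0 < \<kappa>"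
    show "\<exists>E. \<forall>y. y \<notin> ?N \<longrightarrow> \<kappa> * norm (OLS_resid X y) \<le> \<bar>w \<bullet> y\<bar> \<longrightarrow> \<bar>J_stat X U y\<bar> \<le> E"
    proof (rule J_stat_bounded[OF rank_X Z w(2) \<kappa>])
      fix G assume "\<And>y. y \<notin> col_space (hcat X U) \<Longrightarrow> OLS_resid X y \<noteq> 0 \<Longrightarrow>
        \<kappa> * norm (OLS_resid X y) \<le> \<bar>w \<bullet> y\<bar> \<Longrightarrow> \<bar>J_stat X U y\<bar> \<le> G"
      then show ?thesis using N z.resid_nz by blast
    qed
  qed
qed

end
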